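(* For every integer $N\ge 3$, the bounded self-adjoint operator $\mathcal H_N=L_N-A_NM_N$ on $\ell^2(\mathbb Z^N\setminus\{0\})$ has essential spectrum $$\sigma_{\mathrm{ess}}(\mathcal H_N)=[0,4N].$$ For $N=3,4$, $\mathcal H_N$ is nonnegative. For every $N\ge 9$, $\mathcal H_N$ has at least one negative isolated eigenvalue of finite multiplicity.
   Context: Let $X_N=\mathbb Z^N\setminus\{0\}$, write $m\sim n$ when $m,n\in\mathbb Z^N$ are nearest neighbours (i.e. $|m-n|=1$ in Euclidean norm), and $A_N=(N-2)^2/4$. On $\ell^2(X_N)$ (complex-valued), $L_N$ is the Dirichlet lattice Laplacian $(L_Nu)(n)=2Nu(n)-\sum_{m\sim n,\ m\in X_N}u(m)$, and $M_N$ is multiplication by $|n|^{-2}$. *)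

theory Defs
  imports "HOL-Analysis.Analysis" "HOL-Library.Function_Algebras"
begin

section \<open>The complex Hilbert space of square-summable functions\<close>

text \<open>
  A function on \<open>X\<close> is represented by its extension by zero to the ambient type; the vector space
  operations \<open>+\<close>, \<open>-\<close>, \<open>0\<close> on functions are the pointwise ones of \<^theory>\<open>HOL-Library.Function_Algebras\<close>.
\<close>

definition cscale :: "complex \<Rightarrow> ('a \<Rightarrow> complex) \<Rightarrow> 'a \<Rightarrow> complex" where
  "cscale c u = (\<lambda>x. c * u x)"

lemma vector_space_cscale: "vector_space (cscale :: complex \<Rightarrow> ('a \<Rightarrow> complex) \<Rightarrow> 'a \<Rightarrow> complex)"
  by unfold_locales (simp_all add: cscale_def fun_eq_iff algebra_simps)

definition ell2 :: "'a set \<Rightarrow> ('a \<Rightarrow> complex) set" where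
  "ell2 X = {u. (\<forall>x. x \<notin> X \<longrightarrow> u x = 0) \<and> (\<lambda>x. (cmod (u x))\<^sup>2) summable_on X}"

definition ell2_norm :: "'a set \<Rightarrow> ('a \<Rightarrow> complex) \<Rightarrow> real" where
  "ell2_norm X u = sqrt (\<Sum>\<^sub>\<infinity>x\<in>X. (cmod (u x))\<^sup>2)"

definition ell2_inner :: "'a set \<Rightarrow> ('a \<Rightarrow> complex) \<Rightarrow> ('a \<Rightarrow> complex) \<Rightarrow> complex" where
  "ell2_inner X u v = (\<Sum>\<^sub>\<infinity>x\<in>X. u x * cnj (v x))"

section \<open>Bounded operators and their spectra\<close>

text \<open>Only the values of an operator on \<^term>\<open>ell2 X\<close> are relevant below.\<close>

definition bounded_op :: "'a set \<Rightarrow> (('a \<Rightarrow> complex) \<Rightarrow> 'a \<Rightarrow> complex) \<Rightarrow> bool" where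
  "bounded_op X T \<longleftrightarrow>
     (\<forall>u\<in>ell2 X. T u \<in> ell2 X) \<and>
     (\<forall>u\<in>ell2 X. \<forall>v\<in>ell2 X. T (u + v) = T u + T v) \<and>
     (\<forall>c. \<forall>u\<in>ell2 X. T (cscale c u) = cscale c (T u)) \<and>
     (\<exists>C. \<forall>u\<in>ell2 X. ell2_norm X (T u) \<le> C * ell2_norm X u)"

definition selfadjoint_op :: "'a set \<Rightarrow> (('a \<Rightarrow> complex) \<Rightarrow> 'a \<Rightarrow> complex) \<Rightarrow> bool" where
  "selfadjoint_op X T \<longleftrightarrow> (\<forall>u\<in>ell2 X. \<forall>v\<in>ell2 X. ell2_inner X (T u) v = ell2_inner X u (T v))"

definition nonnegative_op :: "'a set \<Rightarrow> (('a \<Rightarrow> complex) \<Rightarrow> 'a \<Rightarrow> complex) \<Rightarrow> bool" where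
  "nonnegative_op X T \<longleftrightarrow> (\<forall>u\<in>ell2 X. ell2_inner X (T u) u \<in> \<real>\<^sub>\<ge>\<^sub>0)"

definition resolvent_set :: "'a set \<Rightarrow> (('a \<Rightarrow> complex) \<Rightarrow> 'a \<Rightarrow> complex) \<Rightarrow> complex set" where
  "resolvent_set X T = {z. \<exists>R. bounded_op X R \<and>
     (\<forall>u\<in>ell2 X. R (T u - cscale z u) = u \<and> T (R u) - cscale z (R u) = u)}"

definition spectrum :: "'a set \<Rightarrow> (('a \<Rightarrow> complex) \<Rightarrow> 'a \<Rightarrow> complex) \<Rightarrow> complex set" where
  "spectrum X T = - resolvent_set X T"

definition eigenspace :: "'a set \<Rightarrow> (('a \<Rightarrow> complex) \<Rightarrow> 'a \<Rightarrow> complex) \<Rightarrow> complex \<Rightarrow> ('a \<Rightarrow> complex) set" where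
  "eigenspace X T z = {u \<in> ell2 X. T u = cscale z u}"

definition eigenvalue :: "'a set \<Rightarrow> (('a \<Rightarrow> complex) \<Rightarrow> 'a \<Rightarrow> complex) \<Rightarrow> complex \<Rightarrow> bool" where
  "eigenvalue X T z \<longleftrightarrow> (\<exists>u\<in>eigenspace X T z. u \<noteq> 0)"

definition finite_multiplicity :: "'a set \<Rightarrow> (('a \<Rightarrow> complex) \<Rightarrow> 'a \<Rightarrow> complex) \<Rightarrow> complex \<Rightarrow> bool" where
  "finite_multiplicity X T z \<longleftrightarrow> (\<exists>B. finite B \<and> eigenspace X T z \<subseteq> module.span cscale B)"

text \<open>
  For self-adjoint operators: the discrete spectrum consists of the isolated points of the spectrum
  that are eigenvalues of finite multiplicity, and the essential spectrum is the rest of the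
  spectrum. (For a non-self-adjoint operator one would have to use algebraic multiplicities.)
\<close>

definition discrete_spectrum :: "'a set \<Rightarrow> (('a \<Rightarrow> complex) \<Rightarrow> 'a \<Rightarrow> complex) \<Rightarrow> complex set" where
  "discrete_spectrum X T =
     {z. z isolated_in spectrum X T \<and> eigenvalue X T z \<and> finite_multiplicity X T z}"

definition essential_spectrum :: "'a set \<Rightarrow> (('a \<Rightarrow> complex) \<Rightarrow> 'a \<Rightarrow> complex) \<Rightarrow> complex set" where
  "essential_spectrum X T = spectrum X T - discrete_spectrum X T"

section \<open>The lattice Hardy operator\<close>

definition lattice_norm :: "int ^ 'n \<Rightarrow> real" where
  "lattice_norm n = norm (\<chi> i. real_of_int (n $ i))"

definition nearest_neighbour :: "int ^ 'n \<Rightarrow> int ^ 'n \<Rightarrow> bool" where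
  "nearest_neighbour m n \<longleftrightarrow> lattice_norm (m - n) = 1"

definition punctured_lattice :: "(int ^ 'n) set" where
  "punctured_lattice = UNIV - {0}"

definition dirichlet_laplacian :: "(int ^ 'n \<Rightarrow> complex) \<Rightarrow> int ^ 'n \<Rightarrow> complex" where
  "dirichlet_laplacian u = (\<lambda>n. if n \<in> punctured_lattice
     then 2 * of_nat CARD('n) * u n - (\<Sum>m | nearest_neighbour m n \<and> m \<in> punctured_lattice. u m)
     else 0)"

lemma finite_nearest_neighbours: "finite {m. nearest_neighbour m (n :: int ^ 'n) \<and> m \<in> S}"
proof -
  have "{m. nearest_neighbour m n \<and> m \<in> S} \<subseteq> vec_lambda ` (PiE UNIV (\<lambda>i. {n $ i - 1..n $ i + 1}))"
  proof
    fix m assume "m \<in> {m. nearest_neighbour m n \<and> m \<in> S}"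
    then have nm: "norm (\<chi> i. real_of_int ((m - n) $ i)) = 1"
      by (simp add: nearest_neighbour_def lattice_norm_def)
    have "m $ i \<in> {n $ i - 1..n $ i + 1}" for i
    proof -
      have "\<bar>real_of_int ((m - n) $ i)\<bar> \<le> 1"
        using component_le_norm_cart[of "\<chi> i. real_of_int ((m - n) $ i)" i] nm by simp
      then show ?thesis by auto
    qed
    then have "vec_nth m \<in> PiE UNIV (\<lambda>i. {n $ i - 1..n $ i + 1})" by auto
    then show "m \<in> vec_lambda ` (PiE UNIV (\<lambda>i. {n $ i - 1..n $ i + 1}))"
      by (metis image_eqI vec_nth_inverse)
  qed
  moreover have "finite (PiE (UNIV :: 'n set) (\<lambda>i. {n $ i - 1..n $ i + 1}))"
    by (intro finite_PiE) auto
  ultimately show ?thesis by (meson finite_imageI finite_subset)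
qed

definition inverse_square_op :: "(int ^ 'n \<Rightarrow> complex) \<Rightarrow> int ^ 'n \<Rightarrow> complex" where
  "inverse_square_op u = (\<lambda>n. if n \<in> punctured_lattice then u n / of_real ((lattice_norm n)\<^sup>2) else 0)"

definition hardy_const :: "nat \<Rightarrow> real" where
  "hardy_const N = (real N - 2)\<^sup>2 / 4"

definition hardy_op :: "(int ^ 'n \<Rightarrow> complex) \<Rightarrow> int ^ 'n \<Rightarrow> complex" where
  "hardy_op u = dirichlet_laplacian u - cscale (of_real (hardy_const CARD('n))) (inverse_square_op u)"

end

theory Submission
  imports Defs "HOL-Complex_Analysis.Great_Picard"
begin

text \<open>
  Write \<open>H\<close> for the Hardy operator in dimension \<open>N\<close>, \<open>L\<close> for the Dirichlet Laplacian and
  \<open>A = (N - 2)\<^sup>2 / 4\<close>.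

  Essential spectrum.  For a bounded self-adjoint operator, a number belongs to the resolvent set if
  and only if subtracting it leaves an operator that is bounded below (\<open>selfadjoint_resolvent_iff\<close>).
  The form of \<open>L\<close> lies between \<open>0\<close> and \<open>4 N\<close>, so the nonreal numbers and the numbers above \<open>4 N\<close> are in the
  resolvent set of \<open>H\<close>.  For \<open>z < 0\<close> the potential exceeds \<open>\<bar>z\<bar> / 2\<close> at finitely many sites only, so
  \<open>H - z\<close> is coercive up to a perturbation of finite rank.  Approximate eigenvectors at \<open>z\<close> then have
  convergent subsequences, and \<open>z\<close> can only be an isolated eigenvalue of finite multiplicity
  (\<open>coercive_mod_finite_imp_discrete\<close>).  Conversely, plane waves cut off to large cubes far from the
  origin are approximate eigenvectors for every point of \<open>[0, 4 N]\<close> (\<open>wave_packet_approx_eigenvector\<close>),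
  and an interval has no isolated points.

  Nonnegativity for \<open>N = 3, 4\<close>.  A positive function \<open>w\<close> with \<open>L w \<ge> A w / \<bar>n\<bar>\<^sup>2\<close> forces the form of \<open>H\<close> to
  be nonnegative (\<open>supersolution_imp_hardy_nonneg\<close>).  Such a function is \<open>\<bar>n\<bar>\<^sup>2 + 3\<close> to the power
  \<open>- (N - 2) / 4\<close>, extended by \<open>0\<close> at the origin.  Expanding its values at the neighbours of \<open>n\<close> in
  binomial series reduces this property to a polynomial inequality in \<open>\<bar>n\<bar>\<^sup>2\<close>
  (\<open>power_weight_supersolution\<close>).

  Negative eigenvalue for \<open>N \<ge> 9\<close>.  If the form of \<open>H\<close> is negative somewhere, the infimum of the form on
  unit vectors is a negative point of the spectrum (\<open>negative_form_imp_negative_spectrum\<close>), hence a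
  discrete eigenvalue by the above.  For \<open>N \<ge> 12\<close> the form is negative at the indicator function of the unit
  vectors.  For \<open>N = 9, 10, 11\<close> it is negative at a radial function with large finite support; the form
  at a radial function is a finite sum with numbers of representations by sums of squares as
  coefficients (\<open>hardy_form_le_radial_energy\<close>), and its sign is found by integer evaluation.
\<close>

section \<open>The Hilbert space of square-summable functions\<close>

lemma cscale_apply [simp]: "cscale c u x = c * u x"
  by (simp add: cscale_def)

lemma ell2_summable: "u \<in> ell2 X \<Longrightarrow> (\<lambda>x. (cmod (u x))\<^sup>2) summable_on X"
  and ell2_outside: "u \<in> ell2 X \<Longrightarrow> x \<notin> X \<Longrightarrow> u x = 0"
  by (auto simp: ell2_def)

lemma ell2_zero [simp]: "0 \<in> ell2 X"
  by (simp add: ell2_def)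

lemma ell2_cscale [simp]: "u \<in> ell2 X \<Longrightarrow> cscale c u \<in> ell2 X"
  by (auto simp: ell2_def norm_mult power_mult_distrib intro: summable_on_cmult_right)

lemma ell2_add [simp]:
  assumes "u \<in> ell2 X" "v \<in> ell2 X"
  shows "u + v \<in> ell2 X"
proof -
  have "(cmod (a + b))\<^sup>2 \<le> 2 * (cmod a)\<^sup>2 + 2 * (cmod b)\<^sup>2" for a b
  proof -
    have "(cmod (a + b))\<^sup>2 \<le> (cmod a + cmod b)\<^sup>2"
      by (simp add: norm_triangle_ineq power_mono)
    also have "\<dots> \<le> 2 * (cmod a)\<^sup>2 + 2 * (cmod b)\<^sup>2"
      using zero_le_power2[of "cmod a - cmod b"] by (simp add: power2_sum power2_diff)
    finally show ?thesis .
  qed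
  moreover have "(\<lambda>x. 2 * (cmod (u x))\<^sup>2 + 2 * (cmod (v x))\<^sup>2) summable_on X"
    using assms by (intro summable_on_add summable_on_cmult_right ell2_summable)
  ultimately have "(\<lambda>x. (cmod ((u + v) x))\<^sup>2) summable_on X"
    by (auto intro: summable_on_comparison_test)
  then show ?thesis
    using assms by (simp add: ell2_def)
qed

lemma ell2_diff [simp]: "u \<in> ell2 X \<Longrightarrow> v \<in> ell2 X \<Longrightarrow> u - v \<in> ell2 X"
proof -
  assume "u \<in> ell2 X" "v \<in> ell2 X"
  then have "u + cscale (-1) v \<in> ell2 X" by simp
  moreover have "u + cscale (-1) v = u - v" by (simp add: fun_eq_iff)
  ultimately show ?thesis by simp
qed

lemma ell2_finite_supportI:
  assumes "finite {x. u x \<noteq> 0}" "\<And>x. x \<notin> X \<Longrightarrow> u x = 0"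
  shows "u \<in> ell2 X"
proof -
  have "(\<lambda>x. (cmod (u x))\<^sup>2) summable_on X \<longleftrightarrow> (\<lambda>x. (cmod (u x))\<^sup>2) summable_on {x. u x \<noteq> 0}"
    using assms by (intro summable_on_cong_neutral) auto
  then show ?thesis using assms by (simp add: ell2_def)
qed

lemma ell2_inner_summable:
  assumes "u \<in> ell2 X" "v \<in> ell2 X"
  shows "(\<lambda>x. cmod (u x * cnj (v x))) summable_on X"
    and "(\<lambda>x. u x * cnj (v x)) summable_on X"
proof -
  have le: "cmod (u x * cnj (v x)) \<le> (cmod (u x))\<^sup>2 + (cmod (v x))\<^sup>2" for x
  proof -
    have "0 \<le> (cmod (u x) - cmod (v x))\<^sup>2" "0 \<le> (cmod (u x))\<^sup>2" "0 \<le> (cmod (v x))\<^sup>2" by auto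
    then show ?thesis unfolding norm_mult complex_mod_cnj power2_diff by linarith
  qed
  show 1: "(\<lambda>x. cmod (u x * cnj (v x))) summable_on X"
    by (rule summable_on_comparison_test[OF summable_on_add[OF assms[THEN ell2_summable]]])
      (use le in auto)
  show "(\<lambda>x. u x * cnj (v x)) summable_on X"
    using 1 by (rule abs_summable_summable)
qed

lemma ell2_inner_add_left:
  "u \<in> ell2 X \<Longrightarrow> v \<in> ell2 X \<Longrightarrow> w \<in> ell2 X \<Longrightarrow>
    ell2_inner X (u + v) w = ell2_inner X u w + ell2_inner X v w"
  by (simp add: ell2_inner_def ell2_inner_summable infsum_add distrib_right)

lemma ell2_inner_cscale_left:
  "ell2_inner X (cscale c u) w = c * ell2_inner X u w"
  by (simp add: ell2_inner_def infsum_cmult_right' mult.assoc)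

lemma ell2_inner_cnj: "cnj (ell2_inner X u v) = ell2_inner X v u"
  by (simp add: ell2_inner_def flip: infsum_cnj) (simp add: mult.commute)

lemma ell2_inner_diff_left:
  "u \<in> ell2 X \<Longrightarrow> v \<in> ell2 X \<Longrightarrow> w \<in> ell2 X \<Longrightarrow>
    ell2_inner X (u - v) w = ell2_inner X u w - ell2_inner X v w"
  using ell2_inner_add_left[of "u - v" X v w] by simp

lemma ell2_inner_add_right:
  "u \<in> ell2 X \<Longrightarrow> v \<in> ell2 X \<Longrightarrow> w \<in> ell2 X \<Longrightarrow>
    ell2_inner X w (u + v) = ell2_inner X w u + ell2_inner X w v"
  using ell2_inner_add_left[of u X v w] by (metis complex_cnj_add ell2_inner_cnj)

lemma ell2_inner_diff_right:
  "u \<in> ell2 X \<Longrightarrow> v \<in> ell2 X \<Longrightarrow> w \<in> ell2 X \<Longrightarrow>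
    ell2_inner X w (u - v) = ell2_inner X w u - ell2_inner X w v"
  using ell2_inner_diff_left[of u X v w] by (metis complex_cnj_diff ell2_inner_cnj)

lemma ell2_inner_cscale_right:
  "ell2_inner X w (cscale c u) = cnj c * ell2_inner X w u"
  by (metis complex_cnj_mult ell2_inner_cnj ell2_inner_cscale_left)

lemma ell2_norm_sq: "(ell2_norm X u)\<^sup>2 = (\<Sum>\<^sub>\<infinity>x\<in>X. (cmod (u x))\<^sup>2)"
  by (simp add: ell2_norm_def infsum_nonneg)

lemma ell2_inner_self:
  assumes "u \<in> ell2 X"
  shows "ell2_inner X u u = of_real ((ell2_norm X u)\<^sup>2)"
  unfolding ell2_norm_sq ell2_inner_def complex_norm_square[symmetric]
  by (intro infsumI has_sum_of_real has_sum_infsum ell2_summable assms)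

lemma ell2_norm_nonneg [simp]: "0 \<le> ell2_norm X u"
  by (simp add: ell2_norm_def infsum_nonneg)

lemma ell2_norm_zero [simp]: "ell2_norm X 0 = 0"
  by (simp add: ell2_norm_def)

lemma ell2_norm_cscale [simp]: "ell2_norm X (cscale c u) = cmod c * ell2_norm X u"
proof -
  have "(ell2_norm X (cscale c u))\<^sup>2 = (cmod c * ell2_norm X u)\<^sup>2"
    by (simp add: ell2_norm_sq norm_mult power_mult_distrib infsum_cmult_right')
  then show ?thesis
    by simp
qed

lemma ell2_norm_minus_commute: "ell2_norm X (u - v) = ell2_norm X (v - u)"
  by (simp add: ell2_norm_def norm_minus_commute)

lemma ell2_apply_le_norm:
  assumes "u \<in> ell2 X"
  shows "cmod (u x) \<le> ell2_norm X u"
proof (cases "x \<in> X")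
  case True
  have "sum (\<lambda>x. (cmod (u x))\<^sup>2) {x} \<le> (ell2_norm X u)\<^sup>2"
    unfolding ell2_norm_sq using assms True by (intro finite_sum_le_infsum ell2_summable) auto
  then show ?thesis by (simp add: power2_le_iff_abs_le)
qed (use assms in \<open>simp add: ell2_outside\<close>)

lemma ell2_norm_eq_0_iff:
  assumes "u \<in> ell2 X"
  shows "ell2_norm X u = 0 \<longleftrightarrow> u = 0"
proof
  assume "ell2_norm X u = 0"
  then show "u = 0" using ell2_apply_le_norm[OF assms] by (simp add: fun_eq_iff)
qed simp

lemma ell2_inner_le:
  assumes u: "u \<in> ell2 X" and v: "v \<in> ell2 X"
  shows "cmod (ell2_inner X u v) \<le> ell2_norm X u * ell2_norm X v"
proof (cases "v = 0")
  case True
  then show ?thesis by (simp add: ell2_inner_def)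
next
  case False
  define s where "s = (ell2_norm X v)\<^sup>2"
  have s: "s > 0" using False v by (simp add: s_def ell2_norm_eq_0_iff)
  define p where "p = ell2_inner X u v"
  \<comment> \<open>the squared distance from \<open>u\<close> to the line through \<open>v\<close>\<close>
  define w where "w = u - cscale (p / of_real s) v"
  have vv: "ell2_inner X v v = of_real s"
    using v by (simp add: ell2_inner_self s_def)
  have vu: "ell2_inner X v u = cnj p"
    by (simp add: p_def ell2_inner_cnj)
  have w: "w \<in> ell2 X" using u v by (simp add: w_def)
  have "of_real ((ell2_norm X w)\<^sup>2) = ell2_inner X w w"
    using w by (simp add: ell2_inner_self)
  also have "\<dots> = ell2_inner X u w - p / of_real s * ell2_inner X v w"
    using u v w
    by (subst (1) w_def) (simp add: ell2_inner_diff_left ell2_inner_cscale_left)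
  also have "\<dots> = ell2_inner X u u - p * cnj p / of_real s"
    using u v s unfolding w_def
    by (simp add: ell2_inner_diff_right ell2_inner_cscale_right vv vu flip: p_def)
  also have "\<dots> = of_real ((ell2_norm X u)\<^sup>2) - p * cnj p / of_real s"
    using u by (simp add: ell2_inner_self)
  also have "\<dots> = of_real ((ell2_norm X u)\<^sup>2 - (cmod p)\<^sup>2 / s)"
    by (simp add: complex_norm_square[symmetric])
  finally have "(ell2_norm X w)\<^sup>2 = (ell2_norm X u)\<^sup>2 - (cmod p)\<^sup>2 / s"
    using of_real_eq_iff by blast
  then have "(cmod p)\<^sup>2 / s \<le> (ell2_norm X u)\<^sup>2"
    by (metis diff_ge_0_iff_ge zero_le_power2)
  then have "(cmod p)\<^sup>2 \<le> (ell2_norm X u * ell2_norm X v)\<^sup>2"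
    using s by (simp add: field_simps s_def)
  then show ?thesis
    unfolding p_def by (rule power2_le_imp_le) simp
qed

lemma ell2_norm_add_sq:
  assumes "u \<in> ell2 X" "v \<in> ell2 X"
  shows "(ell2_norm X (u + v))\<^sup>2
    = (ell2_norm X u)\<^sup>2 + 2 * Re (ell2_inner X u v) + (ell2_norm X v)\<^sup>2"
proof -
  have "Re (ell2_inner X v u) = Re (ell2_inner X u v)"
    by (metis complex_cnj(1) complex.sel(1) ell2_inner_cnj complex_surj)
  moreover have "ell2_inner X (u + v) (u + v) =
      ell2_inner X u u + ell2_inner X u v + (ell2_inner X v u + ell2_inner X v v)"
    using ell2_inner_add_left[of u X v "u + v"] assms by (simp add: ell2_inner_add_right)
  then have "Re (ell2_inner X (u + v) (u + v)) = Re (ell2_inner X u u) + Re (ell2_inner X u v)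
      + (Re (ell2_inner X v u) + Re (ell2_inner X v v))"
    by simp
  moreover have "Re (ell2_inner X w w) = (ell2_norm X w)\<^sup>2" if "w \<in> ell2 X" for w
    using that by (simp add: ell2_inner_self flip: of_real_power)
  ultimately show ?thesis using assms by simp
qed

lemma ell2_norm_diff_sq:
  assumes "u \<in> ell2 X" "v \<in> ell2 X"
  shows "(ell2_norm X (u - v))\<^sup>2
    = (ell2_norm X u)\<^sup>2 - 2 * Re (ell2_inner X u v) + (ell2_norm X v)\<^sup>2"
  using ell2_norm_add_sq[of "u - v" X v] assms
  by (simp add: ell2_inner_diff_left ell2_inner_self flip: of_real_power)

lemma ell2_norm_triangle:
  assumes "u \<in> ell2 X" "v \<in> ell2 X"
  shows "ell2_norm X (u + v) \<le> ell2_norm X u + ell2_norm X v"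
proof (rule power2_le_imp_le)
  have "Re (ell2_inner X u v) \<le> ell2_norm X u * ell2_norm X v"
    using ell2_inner_le[OF assms] complex_Re_le_cmod order_trans by blast
  then show "(ell2_norm X (u + v))\<^sup>2 \<le> (ell2_norm X u + ell2_norm X v)\<^sup>2"
    using ell2_norm_add_sq[OF assms] by (simp add: power2_sum)
qed simp

lemma ell2_norm_triangle_diff:
  assumes "u \<in> ell2 X" "v \<in> ell2 X" "w \<in> ell2 X"
  shows "ell2_norm X (u - w) \<le> ell2_norm X (u - v) + ell2_norm X (v - w)"
  using ell2_norm_triangle[of "u - v" X "v - w"] assms by simp

lemma ell2_norm_diff_le:
  assumes "u \<in> ell2 X" "v \<in> ell2 X"
  shows "ell2_norm X (u - v) \<le> ell2_norm X u + ell2_norm X v"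
proof -
  have eq: "u - v = u + cscale (-1) v" by (simp add: fun_eq_iff)
  show ?thesis
    unfolding eq
    using ell2_norm_triangle[of u X "cscale (-1) v"] assms by simp
qed

lemma ell2_norm_reverse_triangle:
  assumes "u \<in> ell2 X" "v \<in> ell2 X"
  shows "\<bar>ell2_norm X u - ell2_norm X v\<bar> \<le> ell2_norm X (u - v)"
  using ell2_norm_triangle_diff[of u X v 0] ell2_norm_triangle_diff[of v X u 0] assms
  by (simp add: ell2_norm_minus_commute[of X v])

lemma ell2_sum [simp]: "(\<And>i. i \<in> I \<Longrightarrow> u i \<in> ell2 X) \<Longrightarrow> sum u I \<in> ell2 X"
  by (induction I rule: infinite_finite_induct) auto

lemma ell2_norm_sum_le:
  "(\<And>i. i \<in> I \<Longrightarrow> u i \<in> ell2 X) \<Longrightarrow> ell2_norm X (sum u I) \<le> (\<Sum>i\<in>I. ell2_norm X (u i))"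
proof (induction I rule: infinite_finite_induct)
  case (insert i I)
  then have "ell2_norm X (u i + sum u I) \<le> ell2_norm X (u i) + ell2_norm X (sum u I)"
    by (intro ell2_norm_triangle) auto
  moreover have "ell2_norm X (sum u I) \<le> (\<Sum>i\<in>I. ell2_norm X (u i))"
    using insert by auto
  ultimately show ?case
    unfolding sum.insert[OF insert(1,2)] by linarith
qed auto

lemma ell2_inner_sum_left:
  "(\<And>i. i \<in> I \<Longrightarrow> u i \<in> ell2 X) \<Longrightarrow> v \<in> ell2 X \<Longrightarrow>
    ell2_inner X (sum u I) v = (\<Sum>i\<in>I. ell2_inner X (u i) v)"
proof (induction I rule: infinite_finite_induct)
  case (insert i I)
  then show ?case
    unfolding sum.insert[OF insert(1,2)] by (subst ell2_inner_add_left) auto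
qed (auto simp: ell2_inner_def)

lemma ell2_dominated:
  assumes v: "v \<in> ell2 X" and "\<And>x. x \<notin> X \<Longrightarrow> u x = 0" "\<And>x. x \<in> X \<Longrightarrow> cmod (u x) \<le> cmod (v x)"
  shows "u \<in> ell2 X" "ell2_norm X u \<le> ell2_norm X v"
proof -
  have le: "(cmod (u x))\<^sup>2 \<le> (cmod (v x))\<^sup>2" if "x \<in> X" for x
    using assms(3)[OF that] by (simp add: power_mono)
  have summ: "(\<lambda>x. (cmod (u x))\<^sup>2) summable_on X"
    by (rule summable_on_comparison_test[OF ell2_summable[OF v] le]) auto
  then show "u \<in> ell2 X" using assms(2) by (simp add: ell2_def)
  have "(ell2_norm X u)\<^sup>2 \<le> (ell2_norm X v)\<^sup>2"
    unfolding ell2_norm_sq using summ ell2_summable[OF v] le by (rule infsum_mono)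
  then show "ell2_norm X u \<le> ell2_norm X v" by (rule power2_le_imp_le) simp
qed

text \<open>A Cauchy sequence converges pointwise, and passing to the limit in each finite partial sum
  of \<open>\<parallel>u j - u k\<parallel>\<^sup>2\<close> shows that the pointwise limit is also the limit in norm.\<close>

lemma ell2_complete:
  assumes u: "\<And>k. u k \<in> ell2 X"
    and Cauchy: "\<And>e. e > 0 \<Longrightarrow> \<exists>K. \<forall>j\<ge>K. \<forall>k\<ge>K. ell2_norm X (u j - u k) \<le> e"
  obtains v where "v \<in> ell2 X" "(\<lambda>k. ell2_norm X (u k - v)) \<longlonglongrightarrow> 0"
proof -
  have "Cauchy (\<lambda>k. u k x)" for x
  proof (rule metric_CauchyI)
    fix e :: real assume "e > 0"
    then obtain K where K: "\<And>j k. j \<ge> K \<Longrightarrow> k \<ge> K \<Longrightarrow> ell2_norm X (u j - u k) \<le> e / 2"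
      using Cauchy[of "e/2"] by auto
    have "dist (u j x) (u k x) < e" if "j \<ge> K" "k \<ge> K" for j k
      using ell2_apply_le_norm[of "u j - u k" X x] K[OF that] u \<open>e > 0\<close> by (simp add: dist_norm)
    then show "\<exists>K. \<forall>j\<ge>K. \<forall>k\<ge>K. dist (u j x) (u k x) < e" by blast
  qed
  then have "\<forall>x. \<exists>l. (\<lambda>k. u k x) \<longlonglongrightarrow> l"
    by (simp add: Cauchy_convergent_iff convergent_def)
  then obtain v where v: "\<And>x. (\<lambda>k. u k x) \<longlonglongrightarrow> v x" by metis
  have close: "u j - v \<in> ell2 X \<and> ell2_norm X (u j - v) \<le> e"
    if e: "e > 0" and K: "\<And>k. k \<ge> K \<Longrightarrow> ell2_norm X (u j - u k) \<le> e" for e j K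
  proof -
    have fin: "(\<Sum>x\<in>F. (cmod ((u j - v) x))\<^sup>2) \<le> e\<^sup>2" if F: "finite F" "F \<subseteq> X" for F
    proof (rule LIMSEQ_le_const2)
      show "(\<lambda>k. \<Sum>x\<in>F. (cmod (u j x - u k x))\<^sup>2) \<longlonglongrightarrow> (\<Sum>x\<in>F. (cmod ((u j - v) x))\<^sup>2)"
        by (auto intro!: tendsto_intros v)
      have "(\<Sum>x\<in>F. (cmod (u j x - u k x))\<^sup>2) \<le> e\<^sup>2" if "k \<ge> K" for k
      proof -
        have "(\<Sum>x\<in>F. (cmod ((u j - u k) x))\<^sup>2) \<le> (ell2_norm X (u j - u k))\<^sup>2"
          unfolding ell2_norm_sq
          by (intro finite_sum_le_infsum ell2_summable ell2_diff u F) auto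
        also have "\<dots> \<le> e\<^sup>2"
          using K[OF that] by (simp add: power_mono)
        finally show ?thesis by simp
      qed
      then show "\<exists>K. \<forall>k\<ge>K. (\<Sum>x\<in>F. (cmod (u j x - u k x))\<^sup>2) \<le> e\<^sup>2" by blast
    qed
    then have summ: "(\<lambda>x. (cmod ((u j - v) x))\<^sup>2) summable_on X"
      by (intro nonneg_bdd_above_summable_on bdd_aboveI[of _ "e\<^sup>2"]) auto
    have "(u j - v) x = 0" if "x \<notin> X" for x
    proof -
      have "u k x = 0" for k using u that by (rule ell2_outside)
      then show ?thesis using v[of x] by (simp add: LIMSEQ_const_iff)
    qed
    moreover have "(ell2_norm X (u j - v))\<^sup>2 \<le> e\<^sup>2"
      unfolding ell2_norm_sq using summ fin by (rule infsum_le_finite_sums)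
    ultimately show ?thesis
      using summ e by (auto simp: ell2_def intro: power2_le_imp_le)
  qed
  obtain K0 where "\<And>k. k \<ge> K0 \<Longrightarrow> ell2_norm X (u K0 - u k) \<le> 1"
    using Cauchy[of 1] by auto
  then have "u K0 - v \<in> ell2 X" using close[of 1 K0 K0] by simp
  then have "u K0 - (u K0 - v) \<in> ell2 X" by (rule ell2_diff[OF u])
  moreover have "u K0 - (u K0 - v) = v" by (simp add: fun_eq_iff)
  ultimately have vl: "v \<in> ell2 X" by metis
  have "(\<lambda>k. ell2_norm X (u k - v)) \<longlonglongrightarrow> 0"
  proof (rule LIMSEQ_I)
    fix e :: real assume e: "e > 0"
    then obtain K where K: "\<And>j k. j \<ge> K \<Longrightarrow> k \<ge> K \<Longrightarrow> ell2_norm X (u j - u k) \<le> e / 2"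
      using Cauchy[of "e/2"] by auto
    have "norm (ell2_norm X (u j - v) - 0) < e" if "j \<ge> K" for j
      using close[of "e/2" K j] K[OF that] e by auto
    then show "\<exists>K. \<forall>j\<ge>K. norm (ell2_norm X (u j - v) - 0) < e" by blast
  qed
  with vl show thesis by (rule that)
qed

section \<open>The spectrum of a bounded self-adjoint operator\<close>

lemma bounded_op_closed: "bounded_op X T \<Longrightarrow> u \<in> ell2 X \<Longrightarrow> T u \<in> ell2 X"
  and bounded_op_add: "bounded_op X T \<Longrightarrow> u \<in> ell2 X \<Longrightarrow> v \<in> ell2 X \<Longrightarrow> T (u + v) = T u + T v"
  and bounded_op_cscale: "bounded_op X T \<Longrightarrow> u \<in> ell2 X \<Longrightarrow> T (cscale c u) = cscale c (T u)"
  by (auto simp: bounded_op_def)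

lemma bounded_op_diff:
  assumes "bounded_op X T" "u \<in> ell2 X" "v \<in> ell2 X"
  shows "T (u - v) = T u - T v"
  using bounded_op_add[OF assms(1), of "u - v" v] assms by simp

lemma bounded_op_bound:
  assumes "bounded_op X T"
  obtains C where "C > 0" "\<And>u. u \<in> ell2 X \<Longrightarrow> ell2_norm X (T u) \<le> C * ell2_norm X u"
proof -
  obtain C where C: "\<And>u. u \<in> ell2 X \<Longrightarrow> ell2_norm X (T u) \<le> C * ell2_norm X u"
    using assms unfolding bounded_op_def by blast
  have "ell2_norm X (T u) \<le> (\<bar>C\<bar> + 1) * ell2_norm X u" if "u \<in> ell2 X" for u
    by (rule order_trans[OF C[OF that]]) (simp add: mult_right_mono)
  then show thesis using that[of "\<bar>C\<bar> + 1"] by auto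
qed

lemma bounded_opI:
  assumes "\<And>u. u \<in> ell2 X \<Longrightarrow> T u \<in> ell2 X"
    and "\<And>u v. u \<in> ell2 X \<Longrightarrow> v \<in> ell2 X \<Longrightarrow> T (u + v) = T u + T v"
    and "\<And>c u. u \<in> ell2 X \<Longrightarrow> T (cscale c u) = cscale c (T u)"
    and "\<And>u. u \<in> ell2 X \<Longrightarrow> ell2_norm X (T u) \<le> C * ell2_norm X u"
  shows "bounded_op X T"
  using assms unfolding bounded_op_def by blast

lemma bounded_op_scale_id: "bounded_op X (cscale c)"
  by (rule bounded_opI[where C = "cmod c"]) (auto simp: fun_eq_iff algebra_simps)

lemma bounded_op_minus:
  assumes S: "bounded_op X S" and T: "bounded_op X T"
  shows "bounded_op X (\<lambda>u. S u - T u)"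
proof -
  obtain C where C: "C > 0" "\<And>u. u \<in> ell2 X \<Longrightarrow> ell2_norm X (S u) \<le> C * ell2_norm X u"
    using bounded_op_bound[OF S] by blast
  obtain D where D: "D > 0" "\<And>u. u \<in> ell2 X \<Longrightarrow> ell2_norm X (T u) \<le> D * ell2_norm X u"
    using bounded_op_bound[OF T] by blast
  show ?thesis
  proof (rule bounded_opI[where C = "C + D"])
    fix u assume u: "u \<in> ell2 X"
    have "ell2_norm X (S u - T u) \<le> ell2_norm X (S u) + ell2_norm X (T u)"
      using bounded_op_closed[OF S u] bounded_op_closed[OF T u] by (rule ell2_norm_diff_le)
    then show "ell2_norm X (S u - T u) \<le> (C + D) * ell2_norm X u"
      using C(2)[OF u] D(2)[OF u] by (simp add: distrib_right)
  qed (auto simp: bounded_op_closed[OF S] bounded_op_closed[OF T] bounded_op_add[OF S]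
      bounded_op_add[OF T] bounded_op_cscale[OF S] bounded_op_cscale[OF T] fun_eq_iff
      algebra_simps)
qed

lemma bounded_op_comp:
  assumes S: "bounded_op X S" and T: "bounded_op X T"
  shows "bounded_op X (\<lambda>u. S (T u))"
proof -
  obtain C where C: "C > 0" "\<And>u. u \<in> ell2 X \<Longrightarrow> ell2_norm X (S u) \<le> C * ell2_norm X u"
    using bounded_op_bound[OF S] by blast
  obtain D where D: "D > 0" "\<And>u. u \<in> ell2 X \<Longrightarrow> ell2_norm X (T u) \<le> D * ell2_norm X u"
    using bounded_op_bound[OF T] by blast
  show ?thesis
  proof (rule bounded_opI[where C = "C * D"])
    fix u assume u: "u \<in> ell2 X"
    have "ell2_norm X (S (T u)) \<le> C * ell2_norm X (T u)"
      by (rule C(2)[OF bounded_op_closed[OF T u]])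
    also have "\<dots> \<le> C * (D * ell2_norm X u)"
      using D(2)[OF u] C(1) by simp
    finally show "ell2_norm X (S (T u)) \<le> C * D * ell2_norm X u" by (simp add: mult.assoc)
  qed (auto simp: bounded_op_closed[OF S] bounded_op_closed[OF T] bounded_op_add[OF S]
      bounded_op_add[OF T] bounded_op_cscale[OF S] bounded_op_cscale[OF T])
qed

text \<open>For small \<open>t\<close> the map \<open>u \<mapsto> u - t (Q u - f)\<close> contracts, because
  \<open>\<parallel>w - t Q w\<parallel>\<^sup>2 = \<parallel>w\<parallel>\<^sup>2 - 2 t Re \<langle>Q w, w\<rangle> + t\<^sup>2 \<parallel>Q w\<parallel>\<^sup>2\<close>; its fixed point solves \<open>Q u = f\<close>.\<close>

lemma coercive_imp_surj:
  assumes Q: "bounded_op X Q" and \<kappa>: "\<kappa> > 0"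
    and coercive: "\<And>u. u \<in> ell2 X \<Longrightarrow> \<kappa> * (ell2_norm X u)\<^sup>2 \<le> Re (ell2_inner X (Q u) u)"
    and f: "f \<in> ell2 X"
  obtains u where "u \<in> ell2 X" "Q u = f"
proof -
  note Qcl = bounded_op_closed[OF Q]
  obtain C0 where C0: "C0 > 0" "\<And>u. u \<in> ell2 X \<Longrightarrow> ell2_norm X (Q u) \<le> C0 * ell2_norm X u"
    using bounded_op_bound[OF Q] by blast
  define C where "C = C0 + \<kappa>"
  have "ell2_norm X (Q u) \<le> C * ell2_norm X u" if "u \<in> ell2 X" for u
    by (rule order_trans[OF C0(2)[OF that]]) (use \<kappa> in \<open>simp add: C_def mult_right_mono\<close>)
  moreover have "C > \<kappa>" using C0(1) by (simp add: C_def)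
  ultimately have C: "C > \<kappa>" "\<And>u. u \<in> ell2 X \<Longrightarrow> ell2_norm X (Q u) \<le> C * ell2_norm X u"
    by auto
  \<comment> \<open>this \<open>t\<close> minimises the bound \<open>1 - 2 t \<kappa> + t\<^sup>2 C\<^sup>2\<close>\<close>
  define t where "t = \<kappa> / C\<^sup>2"
  define q where "q = sqrt (1 - \<kappa>\<^sup>2 / C\<^sup>2)"
  have "C > 0" using \<kappa> C(1) by simp
  then have t: "t > 0" using \<kappa> by (simp add: t_def)
  have "\<kappa>\<^sup>2 < C\<^sup>2" using \<kappa> C(1) by (simp add: power_strict_mono)
  then have ratio: "0 < \<kappa>\<^sup>2 / C\<^sup>2" "\<kappa>\<^sup>2 / C\<^sup>2 < 1" using \<kappa> \<open>C > 0\<close> by auto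
  then have q: "0 < q" "q < 1" "q\<^sup>2 = 1 - \<kappa>\<^sup>2 / C\<^sup>2" by (auto simp: q_def)
  have contract: "ell2_norm X (w - cscale t (Q w)) \<le> q * ell2_norm X w" if w: "w \<in> ell2 X" for w
  proof (rule power2_le_imp_le)
    have "(ell2_norm X (w - cscale t (Q w)))\<^sup>2
      = (ell2_norm X w)\<^sup>2 - 2 * Re (ell2_inner X w (cscale t (Q w))) + (t * ell2_norm X (Q w))\<^sup>2"
      using ell2_norm_diff_sq[OF w, of "cscale t (Q w)"] Qcl[OF w] t by simp
    also have "Re (ell2_inner X w (cscale t (Q w))) = t * Re (ell2_inner X (Q w) w)"
      using ell2_inner_cnj[of X "Q w" w, symmetric] by (simp add: ell2_inner_cscale_right)
    also have "(ell2_norm X w)\<^sup>2 - 2 * (t * Re (ell2_inner X (Q w) w)) + (t * ell2_norm X (Q w))\<^sup>2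
      \<le> (ell2_norm X w)\<^sup>2 - 2 * (t * (\<kappa> * (ell2_norm X w)\<^sup>2)) + (t * (C * ell2_norm X w))\<^sup>2"
      using coercive[OF w] C(2)[OF w] \<kappa> \<open>C > 0\<close>
      by (intro add_mono diff_mono mult_left_mono power_mono) (auto simp: t_def)
    also have "\<dots> = (q * ell2_norm X w)\<^sup>2"
      unfolding power_mult_distrib q(3) t_def using \<open>C > 0\<close>
      by (simp add: field_simps power2_eq_square)
    finally show "(ell2_norm X (w - cscale t (Q w)))\<^sup>2 \<le> (q * ell2_norm X w)\<^sup>2" .
  qed (use q in simp)
  define g where "g u = u - cscale t (Q u - f)" for u
  have g: "g u \<in> ell2 X" if "u \<in> ell2 X" for u
    using that f Qcl by (simp add: g_def)
  have g_lip: "ell2_norm X (g u - g v) \<le> q * ell2_norm X (u - v)"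
    if u: "u \<in> ell2 X" and v: "v \<in> ell2 X" for u v
  proof -
    have "g u - g v = (u - v) - cscale t (Q (u - v))"
      unfolding bounded_op_diff[OF Q u v] by (simp add: g_def fun_eq_iff algebra_simps)
    then show ?thesis using contract[of "u - v"] u v by simp
  qed
  define s where "s k = (g ^^ k) 0" for k
  have s: "s k \<in> ell2 X" for k
  proof (induction k)
    case 0
    show ?case unfolding s_def funpow_0 by (rule ell2_zero)
  next
    case (Suc k)
    then show ?case using g by (simp add: s_def)
  qed
  define d where "d = ell2_norm X (s 1 - s 0)"
  have step: "ell2_norm X (s (Suc k) - s k) \<le> q ^ k * d" for k
  proof (induction k)
    case 0
    show ?case by (simp only: d_def power_0 mult_1_left One_nat_def order_refl)
  next
    case (Suc k)
    have "ell2_norm X (s (Suc (Suc k)) - s (Suc k)) \<le> q * ell2_norm X (s (Suc k) - s k)"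
      using g_lip[OF s s, of "Suc k" k] by (simp add: s_def)
    also have "\<dots> \<le> q * (q ^ k * d)" using q(1) by (intro mult_left_mono[OF Suc.IH]) simp
    finally show ?case by (simp only: power_Suc mult.assoc)
  qed
  have tail: "ell2_norm X (s (k + m) - s k) \<le> q ^ k * d / (1 - q)" for k m
  proof -
    have "ell2_norm X (s (k + m) - s k) \<le> (\<Sum>i<m. q ^ (k + i) * d)"
    proof (induction m)
      case (Suc m)
      have "ell2_norm X (s (k + Suc m) - s k)
        \<le> ell2_norm X (s (Suc (k + m)) - s (k + m)) + ell2_norm X (s (k + m) - s k)"
        using ell2_norm_triangle_diff[OF s s s, of "Suc (k + m)" k "k + m"] by simp
      then show ?case
        using Suc.IH step[of "k + m"] unfolding sum.lessThan_Suc add_Suc_right by linarith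
    qed (simp add: ell2_norm_def)
    also have "\<dots> = q ^ k * d * (\<Sum>i<m. q ^ i)"
      by (simp add: power_add sum_distrib_left mult_ac)
    also have "\<dots> \<le> q ^ k * d * (1 / (1 - q))"
      using q sum_le_suminf[of "\<lambda>i. q ^ i" "{..<m}"] suminf_geometric[of q] summable_geometric[of q]
      by (intro mult_left_mono) (auto simp: d_def)
    finally show ?thesis by simp
  qed
  have "(\<lambda>k. q ^ k * d / (1 - q)) \<longlonglongrightarrow> 0 * d / (1 - q)"
    using q by (intro tendsto_intros LIMSEQ_power_zero) auto
  then have lim: "(\<lambda>k. q ^ k * d / (1 - q)) \<longlonglongrightarrow> 0" by simp
  obtain v where v: "v \<in> ell2 X" "(\<lambda>k. ell2_norm X (s k - v)) \<longlonglongrightarrow> 0"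
  proof (rule ell2_complete[OF s])
    fix e :: real assume "e > 0"
    then obtain K where K: "q ^ K * d / (1 - q) < e / 2"
      using order_tendstoD(2)[OF lim, of "e/2"] by (auto simp: eventually_sequentially)
    have "ell2_norm X (s j - s k) \<le> e" if "j \<ge> K" "k \<ge> K" for j k
    proof -
      have "ell2_norm X (s i - s K) \<le> e / 2" if "i \<ge> K" for i
        using order_trans[OF tail[of K "i - K"] less_imp_le[OF K]] that by simp
      from this[OF \<open>j \<ge> K\<close>] this[OF \<open>k \<ge> K\<close>]
      have "ell2_norm X (s j - s K) \<le> e / 2" "ell2_norm X (s K - s k) \<le> e / 2"
        by (auto simp: ell2_norm_minus_commute[of X "s K"])
      then show ?thesis using ell2_norm_triangle_diff[OF s s s, of j k K] by linarith
    qed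
    then show "\<exists>K. \<forall>j\<ge>K. \<forall>k\<ge>K. ell2_norm X (s j - s k) \<le> e" by blast
  qed blast
  have "ell2_norm X (g v - v) \<le> q * ell2_norm X (s k - v) + ell2_norm X (s (Suc k) - v)" for k
  proof -
    have "ell2_norm X (g v - v) \<le> ell2_norm X (g v - s (Suc k)) + ell2_norm X (s (Suc k) - v)"
      using g v s by (intro ell2_norm_triangle_diff) auto
    moreover have "ell2_norm X (s (Suc k) - g v) \<le> q * ell2_norm X (s k - v)"
      using g_lip[OF s v(1), of k] by (simp add: s_def)
    ultimately show ?thesis by (simp add: ell2_norm_minus_commute[of X "g v"])
  qed
  moreover have "(\<lambda>k. q * ell2_norm X (s k - v) + ell2_norm X (s (Suc k) - v)) \<longlonglongrightarrow> q * 0 + 0"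
    by (intro tendsto_intros v(2) LIMSEQ_Suc[OF v(2)])
  ultimately have "ell2_norm X (g v - v) \<le> 0"
    by (intro LIMSEQ_le_const) auto
  then have "g v - v = 0"
    using v(1) g ell2_norm_eq_0_iff[of "g v - v" X] ell2_norm_nonneg[of X "g v - v"] by auto
  then have "(g v - v) x = 0" for x by simp
  then have "complex_of_real t * (Q v x - f x) = 0" for x
    by (simp add: g_def)
  moreover have "t \<noteq> 0" using \<kappa> \<open>C > 0\<close> by (simp add: t_def)
  ultimately have "Q v x = f x" for x by simp
  then have "Q v = f" by (rule ext)
  with v(1) show thesis by (rule that)
qed

text \<open>For self-adjoint \<open>T\<close> the operators \<open>P = T - z\<close> and \<open>P\<^sup>* = T - cnj z\<close> satisfy
  \<open>\<parallel>P u\<parallel> = \<parallel>P\<^sup>* u\<parallel>\<close>.  A lower bound for \<open>P\<close> therefore makes \<open>P P\<^sup>*\<close> coercive, hence \<open>P\<close>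
  surjective.  So every point of the spectrum is an approximate eigenvalue.\<close>

lemma selfadjoint_resolvent_iff:
  assumes T: "bounded_op X T" and sa: "selfadjoint_op X T"
  shows "z \<in> resolvent_set X T \<longleftrightarrow>
    (\<exists>c>0. \<forall>u\<in>ell2 X. c * ell2_norm X u \<le> ell2_norm X (T u - cscale z u))"
proof
  assume "z \<in> resolvent_set X T"
  then obtain R where R: "bounded_op X R" "\<And>u. u \<in> ell2 X \<Longrightarrow> R (T u - cscale z u) = u"
    by (auto simp: resolvent_set_def)
  obtain C where C: "C > 0" "\<And>u. u \<in> ell2 X \<Longrightarrow> ell2_norm X (R u) \<le> C * ell2_norm X u"
    using bounded_op_bound[OF R(1)] by blast
  have "1 / C * ell2_norm X u \<le> ell2_norm X (T u - cscale z u)" if "u \<in> ell2 X" for u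
    using C(2)[of "T u - cscale z u"] R(2)[OF that] that C(1) bounded_op_closed[OF T that]
    by (simp add: field_simps)
  then show "\<exists>c>0. \<forall>u\<in>ell2 X. c * ell2_norm X u \<le> ell2_norm X (T u - cscale z u)"
    using C(1) by (intro exI[of _ "1 / C"]) auto
next
  assume "\<exists>c>0. \<forall>u\<in>ell2 X. c * ell2_norm X u \<le> ell2_norm X (T u - cscale z u)"
  then obtain c where c: "c > 0"
    "\<And>u. u \<in> ell2 X \<Longrightarrow> c * ell2_norm X u \<le> ell2_norm X (T u - cscale z u)" by auto
  define P where "P w u = T u - cscale w u" for w u
  have P: "bounded_op X (P w)" for w
    unfolding P_def by (intro bounded_op_minus T bounded_op_scale_id)
  note Pcl = bounded_op_closed[OF P]
  have adj: "ell2_inner X (P w u) v = ell2_inner X u (P (cnj w) v)"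
    if "u \<in> ell2 X" "v \<in> ell2 X" for u v w
    using that sa bounded_op_closed[OF T] unfolding P_def
    by (simp add: selfadjoint_op_def ell2_inner_diff_left ell2_inner_diff_right
        ell2_inner_cscale_left ell2_inner_cscale_right)
  have comm: "P w (P w' u) = P w' (P w u)" if "u \<in> ell2 X" for w w' u
    using that bounded_op_closed[OF T] unfolding P_def
    by (simp add: bounded_op_diff[OF T] bounded_op_cscale[OF T] fun_eq_iff algebra_simps)
  have norm_adj: "(ell2_norm X (P (cnj z) u))\<^sup>2 = (ell2_norm X (P z u))\<^sup>2" if u: "u \<in> ell2 X" for u
  proof -
    have "of_real ((ell2_norm X (P (cnj z) u))\<^sup>2) = ell2_inner X (P (cnj z) u) (P (cnj z) u)"
      using Pcl u by (simp add: ell2_inner_self)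
    also have "\<dots> = ell2_inner X (P (cnj z) (P z u)) u"
      using adj[OF Pcl[OF u] u, of z "cnj z"] comm[OF u, of z "cnj z"] Pcl[OF u]
        adj[OF Pcl[OF u] u, of "cnj z" z] by simp
    also have "\<dots> = ell2_inner X (P z u) (P z u)"
      using adj[OF Pcl[OF u] u, of "cnj z" z] by simp
    also have "\<dots> = of_real ((ell2_norm X (P z u))\<^sup>2)"
      using Pcl u by (simp add: ell2_inner_self)
    finally show ?thesis using of_real_eq_iff by blast
  qed
  have coercive: "c\<^sup>2 * (ell2_norm X u)\<^sup>2 \<le> Re (ell2_inner X (P z (P (cnj z) u)) u)"
    if u: "u \<in> ell2 X" for u
  proof -
    have "ell2_inner X (P z (P (cnj z) u)) u = of_real ((ell2_norm X (P (cnj z) u))\<^sup>2)"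
      using adj[OF Pcl[OF u] u, of z "cnj z"] Pcl[OF u] by (simp add: ell2_inner_self)
    then have "Re (ell2_inner X (P z (P (cnj z) u)) u) = (ell2_norm X (P z u))\<^sup>2"
      using norm_adj[OF u] by (simp flip: of_real_power)
    moreover have "(c * ell2_norm X u)\<^sup>2 \<le> (ell2_norm X (P z u))\<^sup>2"
      using c(2)[OF u] c(1) by (intro power_mono) (auto simp: P_def)
    ultimately show ?thesis by (simp add: power_mult_distrib)
  qed
  have "\<exists>u\<in>ell2 X. P z u = f" if f: "f \<in> ell2 X" for f
  proof -
    have "c\<^sup>2 > 0" using c(1) by simp
    then obtain u where "u \<in> ell2 X" "P z (P (cnj z) u) = f"
      by (rule coercive_imp_surj[OF bounded_op_comp[OF P P] _ coercive f])
    then show ?thesis using Pcl by blast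
  qed
  then obtain R where R: "\<And>f. f \<in> ell2 X \<Longrightarrow> R f \<in> ell2 X"
    and PR: "\<And>f. f \<in> ell2 X \<Longrightarrow> P z (R f) = f" by metis
  have inj: "u = v" if u: "u \<in> ell2 X" and v: "v \<in> ell2 X" and eq: "P z u = P z v" for u v
  proof -
    have "P z (u - v) = 0" unfolding bounded_op_diff[OF P u v] eq by (simp add: fun_eq_iff)
    then have "c * ell2_norm X (u - v) \<le> 0"
      using c(2)[OF ell2_diff[OF u v]] unfolding P_def by simp
    then have "ell2_norm X (u - v) = 0"
      using c(1) ell2_norm_nonneg[of X "u - v"] by (simp add: mult_le_0_iff)
    then show ?thesis using ell2_norm_eq_0_iff[OF ell2_diff[OF u v]] by simp
  qed
  have "bounded_op X R"
  proof (rule bounded_opI[where C = "1 / c"])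
    fix u v assume u: "u \<in> ell2 X" and v: "v \<in> ell2 X"
    show "R (u + v) = R u + R v"
      by (rule inj) (simp_all add: R PR u v bounded_op_add[OF P])
  next
    fix a u assume u: "u \<in> ell2 X"
    show "R (cscale a u) = cscale a (R u)"
      by (rule inj) (simp_all add: R PR u bounded_op_cscale[OF P])
  next
    fix u assume u: "u \<in> ell2 X"
    have "c * ell2_norm X (R u) \<le> ell2_norm X u"
      using c(2)[OF R[OF u]] PR[OF u] unfolding P_def by simp
    then show "ell2_norm X (R u) \<le> 1 / c * ell2_norm X u"
      using c(1) by (simp add: field_simps)
  qed (rule R)
  moreover have "R (P z u) = u" "P z (R u) = u" if u: "u \<in> ell2 X" for u
    using inj[OF R[OF Pcl[OF u]] u PR[OF Pcl[OF u]]] PR[OF u] by auto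
  ultimately show "z \<in> resolvent_set X T"
    unfolding resolvent_set_def P_def by blast
qed

section \<open>Isolated eigenvalues of finite multiplicity\<close>

text \<open>In terms of forms: adding a suitable operator of finite rank makes \<open>T - z\<close> coercive.  This
  replaces the compactness of the perturbation in Weyl's theorem on essential spectra.\<close>

definition coercive_mod_finite :: "'a set \<Rightarrow> (('a \<Rightarrow> complex) \<Rightarrow> 'a \<Rightarrow> complex) \<Rightarrow> complex \<Rightarrow> bool" where
  "coercive_mod_finite X T z \<longleftrightarrow> (\<exists>F a \<kappa>. finite F \<and> \<kappa> > (0::real) \<and> (\<forall>u\<in>ell2 X.
     \<kappa> * (ell2_norm X u)\<^sup>2 \<le>
       Re (ell2_inner X (T u - cscale z u) u) + (\<Sum>x\<in>F. a x * (cmod (u x))\<^sup>2)))"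

text \<open>Along a subsequence the finitely many values of \<open>s k\<close> on \<open>F\<close> converge, and then the form
  bound applied to the differences \<open>s j - s k\<close> makes the subsequence Cauchy in norm.\<close>

lemma approx_eigenvectors_converge:
  assumes T: "bounded_op X T" and coercive: "coercive_mod_finite X T z"
    and s: "\<And>k. s k \<in> ell2 X" and s1: "\<And>k. ell2_norm X (s k) = 1"
    and approx: "(\<lambda>k. ell2_norm X (T (s k) - cscale z (s k))) \<longlonglongrightarrow> 0"
  obtains r v where "strict_mono (r :: nat \<Rightarrow> nat)" "v \<in> ell2 X" "ell2_norm X v = 1"
    "T v = cscale z v" "(\<lambda>k. ell2_norm X (s (r k) - v)) \<longlonglongrightarrow> 0"
proof -
  obtain F a \<kappa> where F: "finite F" and \<kappa>: "\<kappa> > (0::real)" and low: "\<And>u. u \<in> ell2 X \<Longrightarrow>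
     \<kappa> * (ell2_norm X u)\<^sup>2 \<le>
       Re (ell2_inner X (T u - cscale z u) u) + (\<Sum>x\<in>F. a x * (cmod (u x))\<^sup>2)"
    using coercive unfolding coercive_mod_finite_def by blast
  define P where "P u = T u - cscale z u" for u
  have P: "bounded_op X P"
    unfolding P_def by (intro bounded_op_minus T bounded_op_scale_id)
  note Pcl = bounded_op_closed[OF P]
  have "norm (s k x) \<le> 1" for k x
    using ell2_apply_le_norm[OF s, of k x] s1 by simp
  then obtain r where r: "strict_mono (r :: nat \<Rightarrow> nat)"
    and "\<And>x. x \<in> F \<Longrightarrow> \<exists>l. (\<lambda>k. s (r k) x) \<longlonglongrightarrow> l"
    using function_convergent_subsequence[of F s 1] countable_finite[OF F] by blast
  then obtain l where l: "\<And>x. x \<in> F \<Longrightarrow> (\<lambda>k. s (r k) x) \<longlonglongrightarrow> l x" by metis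
  define t where "t k = s (r k)" for k
  have t: "t k \<in> ell2 X" "ell2_norm X (t k) = 1" for k
    using s s1 by (auto simp: t_def)
  have Pt: "(\<lambda>k. ell2_norm X (P (t k))) \<longlonglongrightarrow> 0"
    using LIMSEQ_subseq_LIMSEQ[OF approx r] by (simp add: P_def t_def o_def)
  define \<eta> where
    "\<eta> k = 2 * ell2_norm X (P (t k)) + (\<Sum>x\<in>F. \<bar>a x\<bar> * (2 * (cmod (t k x - l x))\<^sup>2))" for k
  have "\<eta> \<longlonglongrightarrow> 2 * 0 + (\<Sum>x\<in>F. \<bar>a x\<bar> * (2 * (cmod (l x - l x))\<^sup>2))"
    unfolding \<eta>_def by (intro tendsto_intros Pt) (auto simp: t_def l)
  then have \<eta>: "\<eta> \<longlonglongrightarrow> 0" by simp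
  have key: "\<kappa> * (ell2_norm X (t j - t k))\<^sup>2 \<le> \<eta> j + \<eta> k" for j k
  proof -
    define v where "v = t j - t k"
    have v: "v \<in> ell2 X" using t by (simp add: v_def)
    have v2: "ell2_norm X v \<le> 2"
      using ell2_norm_diff_le[OF t(1) t(1), of j k] t(2) by (simp add: v_def)
    have "P v = P (t j) - P (t k)" unfolding v_def by (rule bounded_op_diff[OF P t(1) t(1)])
    then have Pv: "ell2_norm X (P v) \<le> ell2_norm X (P (t j)) + ell2_norm X (P (t k))"
      using ell2_norm_diff_le[OF Pcl Pcl] t(1) by metis
    have "Re (ell2_inner X (P v) v) \<le> cmod (ell2_inner X (P v) v)"
      by (rule complex_Re_le_cmod)
    also have "\<dots> \<le> ell2_norm X (P v) * ell2_norm X v"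
      by (rule ell2_inner_le[OF Pcl[OF v] v])
    also have "\<dots> \<le> (ell2_norm X (P (t j)) + ell2_norm X (P (t k))) * 2"
      using Pv v2 by (intro mult_mono) auto
    finally have 1: "Re (ell2_inner X (P v) v)
      \<le> 2 * ell2_norm X (P (t j)) + 2 * ell2_norm X (P (t k))" by simp
    have 2: "(\<Sum>x\<in>F. a x * (cmod (v x))\<^sup>2)
      \<le> (\<Sum>x\<in>F. \<bar>a x\<bar> * (2 * (cmod (t j x - l x))\<^sup>2) + \<bar>a x\<bar> * (2 * (cmod (t k x - l x))\<^sup>2))"
    proof (rule sum_mono)
      fix x
      have "cmod (v x) \<le> cmod (t j x - l x) + cmod (t k x - l x)"
        using norm_triangle_ineq4[of "t j x - l x" "t k x - l x"] by (simp add: v_def)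
      then have "(cmod (v x))\<^sup>2 \<le> (cmod (t j x - l x) + cmod (t k x - l x))\<^sup>2"
        by (intro power_mono) auto
      also have "\<dots> \<le> 2 * (cmod (t j x - l x))\<^sup>2 + 2 * (cmod (t k x - l x))\<^sup>2"
        using zero_le_power2[of "cmod (t j x - l x) - cmod (t k x - l x)"]
        by (simp add: power2_sum power2_diff)
      finally have "a x * (cmod (v x))\<^sup>2
        \<le> \<bar>a x\<bar> * (2 * (cmod (t j x - l x))\<^sup>2 + 2 * (cmod (t k x - l x))\<^sup>2)"
        by (intro mult_mono) auto
      then show "a x * (cmod (v x))\<^sup>2
        \<le> \<bar>a x\<bar> * (2 * (cmod (t j x - l x))\<^sup>2) + \<bar>a x\<bar> * (2 * (cmod (t k x - l x))\<^sup>2)"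
        by (simp add: distrib_left)
    qed
    show ?thesis
      using low[OF v] 1 2 unfolding \<eta>_def v_def P_def sum.distrib by linarith
  qed
  obtain v where v: "v \<in> ell2 X" "(\<lambda>k. ell2_norm X (t k - v)) \<longlonglongrightarrow> 0"
  proof (rule ell2_complete[OF t(1)])
    fix e :: real assume e: "e > 0"
    then have "\<kappa> * e\<^sup>2 / 2 > 0" using \<kappa> by simp
    then have "\<forall>\<^sub>F k in sequentially. \<eta> k < \<kappa> * e\<^sup>2 / 2" by (rule order_tendstoD(2)[OF \<eta>])
    then obtain K where K: "\<And>k. k \<ge> K \<Longrightarrow> \<eta> k < \<kappa> * e\<^sup>2 / 2"
      unfolding eventually_sequentially by blast
    have "ell2_norm X (t j - t k) \<le> e" if "j \<ge> K" "k \<ge> K" for j k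
    proof (rule power2_le_imp_le)
      have "\<kappa> * (ell2_norm X (t j - t k))\<^sup>2 \<le> \<kappa> * e\<^sup>2"
        using key[of j k] K[OF that(1)] K[OF that(2)] by linarith
      then show "(ell2_norm X (t j - t k))\<^sup>2 \<le> e\<^sup>2" using \<kappa> by simp
    qed (use e in simp)
    then show "\<exists>K. \<forall>j\<ge>K. \<forall>k\<ge>K. ell2_norm X (t j - t k) \<le> e" by blast
  qed blast
  have "\<bar>1 - ell2_norm X v\<bar> \<le> ell2_norm X (t k - v)" for k
    using ell2_norm_reverse_triangle[OF t(1) v(1), of k] t(2) by simp
  then have "\<bar>1 - ell2_norm X v\<bar> \<le> 0"
    by (intro LIMSEQ_le_const[OF v(2)]) auto
  then have v1: "ell2_norm X v = 1" by simp
  obtain C where C: "C > 0" "\<And>u. u \<in> ell2 X \<Longrightarrow> ell2_norm X (P u) \<le> C * ell2_norm X u"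
    using bounded_op_bound[OF P] by blast
  have "ell2_norm X (P v) \<le> C * ell2_norm X (t k - v) + ell2_norm X (P (t k))" for k
  proof -
    have "P (t k - v) = P (t k) - P v" by (rule bounded_op_diff[OF P t(1) v(1)])
    then have "ell2_norm X (P (t k) - P v) \<le> C * ell2_norm X (t k - v)"
      using C(2)[OF ell2_diff[OF t(1) v(1)], of k] by simp
    then show ?thesis
      using ell2_norm_reverse_triangle[OF Pcl[OF t(1)] Pcl[OF v(1)], of k] by linarith
  qed
  moreover have "(\<lambda>k. C * ell2_norm X (t k - v) + ell2_norm X (P (t k))) \<longlonglongrightarrow> C * 0 + 0"
    by (intro tendsto_intros v Pt)
  ultimately have "ell2_norm X (P v) \<le> 0"
    by (intro LIMSEQ_le_const) auto
  then have "P v = 0"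
    using ell2_norm_eq_0_iff[OF Pcl[OF v(1)]] ell2_norm_nonneg[of X "P v"] by simp
  then have "T v = cscale z v" by (simp add: P_def fun_eq_iff)
  with r v v1 show thesis
    by (intro that) (auto simp: t_def)
qed

lemma spectrum_approx_eigenvector:
  assumes T: "bounded_op X T" and sa: "selfadjoint_op X T" and z: "z \<in> spectrum X T" and "e > 0"
  obtains u where "u \<in> ell2 X" "ell2_norm X u = 1" "ell2_norm X (T u - cscale z u) < e"
proof -
  obtain w where w: "w \<in> ell2 X" "ell2_norm X (T w - cscale z w) < e * ell2_norm X w"
    using z \<open>e > 0\<close> unfolding spectrum_def Compl_iff selfadjoint_resolvent_iff[OF T sa]
    by (meson not_le)
  then have pos: "ell2_norm X w > 0"
    using ell2_norm_nonneg[of X w] ell2_norm_nonneg[of X "T w - cscale z w"] \<open>e > 0\<close>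
    by (smt (verit) mult_eq_0_iff)
  define u where "u = cscale (of_real (1 / ell2_norm X w)) w"
  have "T u - cscale z u = cscale (of_real (1 / ell2_norm X w)) (T w - cscale z w)"
    unfolding u_def bounded_op_cscale[OF T w(1)] by (simp add: fun_eq_iff algebra_simps)
  then have "ell2_norm X (T u - cscale z u) = ell2_norm X (T w - cscale z w) / ell2_norm X w"
    using pos by (simp add: norm_divide)
  then have "ell2_norm X (T u - cscale z u) < e"
    using w(2) pos by (simp add: pos_divide_less_eq)
  moreover have "ell2_norm X u = 1" "u \<in> ell2 X"
    using pos w(1) by (auto simp: u_def norm_divide)
  ultimately show thesis using that by blast
qed

text \<open>Induction on \<open>F\<close>: the functions of \<open>V\<close> that vanish at \<open>j\<close> are determined by one value fewer,
  and any function of \<open>V\<close> with a nonzero value at \<open>j\<close> spans the rest.\<close>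

lemma finitely_spanned_if_determined_on_finite:
  assumes "finite F"
    and "\<And>u v. u \<in> V \<Longrightarrow> v \<in> V \<Longrightarrow> u - v \<in> V" "\<And>c u. u \<in> V \<Longrightarrow> cscale c u \<in> V"
    and "\<And>u. u \<in> V \<Longrightarrow> (\<And>x. x \<in> F \<Longrightarrow> u x = 0) \<Longrightarrow> u = 0"
  shows "\<exists>B. finite B \<and> V \<subseteq> module.span cscale B"
  using assms
proof (induction F arbitrary: V rule: finite_induct)
  case empty
  interpret vector_space cscale by (rule vector_space_cscale)
  have "u = 0" if "u \<in> V" for u using empty.prems(3)[OF that] by blast
  then have "V \<subseteq> span {}" unfolding span_empty by blast
  then show ?case by blast
next
  case (insert j F)
  interpret vector_space cscale by (rule vector_space_cscale)
  have "\<exists>B. finite B \<and> {u \<in> V. u j = 0} \<subseteq> span B"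
  proof (rule insert.IH)
    fix u v assume "u \<in> {u \<in> V. u j = 0}" "v \<in> {u \<in> V. u j = 0}"
    then have "u \<in> V" "v \<in> V" "(u - v) j = 0" by simp_all
    then show "u - v \<in> {u \<in> V. u j = 0}" using insert.prems(1) by blast
  next
    fix c u assume "u \<in> {u \<in> V. u j = 0}"
    then have "u \<in> V" "cscale c u j = 0" by simp_all
    then show "cscale c u \<in> {u \<in> V. u j = 0}" using insert.prems(2) by blast
  next
    fix u assume "u \<in> {u \<in> V. u j = 0}" "\<And>x. x \<in> F \<Longrightarrow> u x = 0"
    then show "u = 0" using insert.prems(3)[of u] by blast
  qed
  then obtain B where B: "finite B" "{u \<in> V. u j = 0} \<subseteq> span B" by blast
  show ?case
  proof (cases "\<exists>v\<in>V. v j \<noteq> 0")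
    case True
    then obtain v where v: "v \<in> V" "v j \<noteq> 0" by blast
    have "u \<in> span (insert v B)" if u: "u \<in> V" for u
    proof -
      define w where "w = cscale (u j / v j) v"
      have "u - w \<in> V" unfolding w_def by (intro insert.prems(1,2) u v(1))
      moreover have "(u - w) j = 0" using v(2) by (simp add: w_def)
      ultimately have "u - w \<in> span (insert v B)"
        using B(2) span_mono[of B "insert v B"] by blast
      moreover have "w \<in> span (insert v B)"
        unfolding w_def by (intro span_scale span_base insertI1)
      ultimately have "(u - w) + w \<in> span (insert v B)" by (rule span_add)
      moreover have "(u - w) + w = u" by (simp add: fun_eq_iff)
      ultimately show ?thesis by metis
    qed
    then show ?thesis using B(1) by blast
  next
    case False
    then have "V \<subseteq> {u \<in> V. u j = 0}" by blast
    then show ?thesis using B by blast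
  qed
qed

lemma coercive_mod_finite_imp_finite_multiplicity:
  assumes T: "bounded_op X T" and coercive: "coercive_mod_finite X T z"
  shows "finite_multiplicity X T z"
proof -
  obtain F a \<kappa> where F: "finite F" and \<kappa>: "\<kappa> > (0::real)" and low: "\<And>u. u \<in> ell2 X \<Longrightarrow>
     \<kappa> * (ell2_norm X u)\<^sup>2 \<le>
       Re (ell2_inner X (T u - cscale z u) u) + (\<Sum>x\<in>F. a x * (cmod (u x))\<^sup>2)"
    using coercive unfolding coercive_mod_finite_def by blast
  show ?thesis
    unfolding finite_multiplicity_def
  proof (rule finitely_spanned_if_determined_on_finite[OF F])
    fix u v assume "u \<in> eigenspace X T z" "v \<in> eigenspace X T z"
    then show "u - v \<in> eigenspace X T z"
      by (auto simp: eigenspace_def bounded_op_diff[OF T] fun_eq_iff algebra_simps)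
  next
    fix c u assume "u \<in> eigenspace X T z"
    then show "cscale c u \<in> eigenspace X T z"
      by (auto simp: eigenspace_def bounded_op_cscale[OF T] fun_eq_iff algebra_simps)
  next
    fix u assume u: "u \<in> eigenspace X T z" and 0: "\<And>x. x \<in> F \<Longrightarrow> u x = 0"
    then have "u \<in> ell2 X" "T u - cscale z u = 0" by (auto simp: eigenspace_def fun_eq_iff)
    moreover have "ell2_inner X 0 u = 0" by (simp add: ell2_inner_def)
    ultimately have "\<kappa> * (ell2_norm X u)\<^sup>2 \<le> 0" using low[of u] 0 by simp
    then show "u = 0"
      using \<kappa> ell2_norm_eq_0_iff[OF \<open>u \<in> ell2 X\<close>]
      by (metis mult_le_0_iff not_le power2_less_eq_zero_iff)
  qed
qed

text \<open>Approximate eigenvectors at \<open>z\<close> converge to an eigenvector.  If spectral points \<open>w k \<noteq> z\<close>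
  tended to \<open>z\<close>, approximate eigenvectors at \<open>w k\<close> with error \<open>\<bar>w k - z\<bar>\<^sup>2\<close> would converge to an
  eigenvector at \<open>z\<close> although they are asymptotically orthogonal to it.\<close>

lemma coercive_mod_finite_imp_discrete:
  assumes T: "bounded_op X T" and sa: "selfadjoint_op X T"
    and z: "z \<in> spectrum X T" "z \<in> \<real>" and coercive: "coercive_mod_finite X T z"
  shows "z \<in> discrete_spectrum X T"
proof -
  note Tcl = bounded_op_closed[OF T]
  have "\<exists>u. u \<in> ell2 X \<and> ell2_norm X u = 1 \<and> ell2_norm X (T u - cscale z u) < 1 / real (Suc k)" for k
    by (rule spectrum_approx_eigenvector[OF T sa z(1), of "1 / real (Suc k)"]) auto
  then obtain s where s: "\<And>k. s k \<in> ell2 X" "\<And>k. ell2_norm X (s k) = 1"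
    "\<And>k. ell2_norm X (T (s k) - cscale z (s k)) < 1 / real (Suc k)" by metis
  have "(\<lambda>k. ell2_norm X (T (s k) - cscale z (s k))) \<longlonglongrightarrow> 0"
    by (rule tendsto_sandwich[OF _ _ tendsto_const LIMSEQ_Suc[OF lim_1_over_n]])
      (use s(3) in \<open>auto intro!: always_eventually less_imp_le\<close>)
  then obtain r v where v: "v \<in> ell2 X" "ell2_norm X v = 1" "T v = cscale z v"
    by (rule approx_eigenvectors_converge[OF T coercive s(1,2)])
  then have "v \<noteq> 0" by auto
  with v have ev: "eigenvalue X T z"
    unfolding eigenvalue_def eigenspace_def by blast
  have "\<not> z islimpt spectrum X T"
  proof
    assume "z islimpt spectrum X T"
    then obtain w where w: "\<And>k. w k \<in> spectrum X T - {z}" "w \<longlonglongrightarrow> z"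
      unfolding islimpt_sequential by blast
    have "\<exists>u. u \<in> ell2 X \<and> ell2_norm X u = 1 \<and> ell2_norm X (T u - cscale (w k) u) < (cmod (w k - z))\<^sup>2" for k
      by (rule spectrum_approx_eigenvector[OF T sa, of "w k" "(cmod (w k - z))\<^sup>2"])
        (use w(1)[of k] in auto)
    then obtain s where s: "\<And>k. s k \<in> ell2 X" "\<And>k. ell2_norm X (s k) = 1"
      "\<And>k. ell2_norm X (T (s k) - cscale (w k) (s k)) < (cmod (w k - z))\<^sup>2" by metis
    have d0: "(\<lambda>k. cmod (w k - z)) \<longlonglongrightarrow> 0"
      using w(2) LIM_zero tendsto_norm_zero by blast
    have le: "ell2_norm X (T (s k) - cscale z (s k)) \<le> (cmod (w k - z))\<^sup>2 + cmod (w k - z)" for k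
    proof -
      have "T (s k) - cscale z (s k) = (T (s k) - cscale (w k) (s k)) + cscale (w k - z) (s k)"
        by (simp add: fun_eq_iff algebra_simps)
      then have "ell2_norm X (T (s k) - cscale z (s k))
        \<le> ell2_norm X (T (s k) - cscale (w k) (s k)) + ell2_norm X (cscale (w k - z) (s k))"
        using ell2_norm_triangle s(1) Tcl by (metis ell2_cscale ell2_diff)
      then show ?thesis using s(3)[of k] s(2)[of k] by simp
    qed
    have bound_lim: "(\<lambda>k. (cmod (w k - z))\<^sup>2 + cmod (w k - z)) \<longlonglongrightarrow> 0"
      using tendsto_add[OF tendsto_power[OF d0, of 2] d0] by simp
    have "(\<lambda>k. ell2_norm X (T (s k) - cscale z (s k))) \<longlonglongrightarrow> 0"
      by (rule Lim_null_comparison[OF always_eventually bound_lim]) (use le in simp)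
    then obtain r v where r: "strict_mono r" and v: "v \<in> ell2 X" "ell2_norm X v = 1"
      "T v = cscale z v" "(\<lambda>k. ell2_norm X (s (r k) - v)) \<longlonglongrightarrow> 0"
      by (rule approx_eigenvectors_converge[OF T coercive s(1,2)])
    have orth: "cmod (ell2_inner X (s k) v) \<le> cmod (w k - z)" for k
    proof -
      have "ell2_inner X (T (s k)) v = ell2_inner X (s k) (T v)"
        using sa s(1) v(1) by (auto simp: selfadjoint_op_def)
      then have "ell2_inner X (T (s k)) v = z * ell2_inner X (s k) v"
        using v(3) z(2) by (auto simp: ell2_inner_cscale_right Reals_cnj_iff)
      then have "ell2_inner X (T (s k) - cscale (w k) (s k)) v = (z - w k) * ell2_inner X (s k) v"
        using s(1) v(1) Tcl by (simp add: ell2_inner_diff_left ell2_inner_cscale_left algebra_simps)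
      then have "cmod (w k - z) * cmod (ell2_inner X (s k) v)
        = cmod (ell2_inner X (T (s k) - cscale (w k) (s k)) v)"
        by (simp add: norm_mult norm_minus_commute)
      also have "\<dots> \<le> ell2_norm X (T (s k) - cscale (w k) (s k)) * ell2_norm X v"
        using s(1) v(1) Tcl by (intro ell2_inner_le) auto
      also have "\<dots> \<le> cmod (w k - z) * cmod (w k - z)"
        using s(3)[of k] v(2) by (simp add: power2_eq_square)
      finally show ?thesis using w(1)[of k] by simp
    qed
    have "1 \<le> cmod (w (r k) - z) + ell2_norm X (s (r k) - v)" for k
    proof -
      have "1 = cmod (ell2_inner X v v)" using v by (simp add: ell2_inner_self)
      also have "ell2_inner X v v = ell2_inner X (s (r k)) v - ell2_inner X (s (r k) - v) v"
        using s(1) v(1) by (simp add: ell2_inner_diff_left)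
      also have "cmod \<dots> \<le> cmod (ell2_inner X (s (r k)) v) + cmod (ell2_inner X (s (r k) - v) v)"
        by (rule norm_triangle_ineq4)
      also have "\<dots> \<le> cmod (w (r k) - z) + ell2_norm X (s (r k) - v) * ell2_norm X v"
        using s(1) v(1) by (intro add_mono orth ell2_inner_le) auto
      finally show ?thesis using v(2) by simp
    qed
    moreover have "(\<lambda>k. cmod (w (r k) - z) + ell2_norm X (s (r k) - v)) \<longlonglongrightarrow> 0 + 0"
      using LIMSEQ_subseq_LIMSEQ[OF d0 r] v(4) by (intro tendsto_add) (auto simp: o_def)
    ultimately have "(1::real) \<le> 0"
      by (intro LIMSEQ_le_const) auto
    then show False by simp
  qed
  then have "z isolated_in spectrum X T"
    using z(1) by (simp add: isolated_in_islimpt_iff)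
  with ev coercive_mod_finite_imp_finite_multiplicity[OF T coercive] show ?thesis
    by (simp add: discrete_spectrum_def)
qed

text \<open>Let \<open>m\<close> be the infimum of the form on unit vectors and \<open>P = T - m\<close>.  Nonnegativity of the form of
  \<open>P\<close> at \<open>u - P u / C\<close>, where \<open>C\<close> bounds \<open>P\<close>, gives \<open>\<parallel>P u\<parallel>\<^sup>2 \<le> C \<langle>P u, u\<rangle>\<close>; hence \<open>P\<close> is not bounded
  below along a minimising sequence.\<close>

lemma negative_form_imp_negative_spectrum:
  assumes T: "bounded_op X T" and sa: "selfadjoint_op X T"
    and w: "w \<in> ell2 X" "Re (ell2_inner X (T w) w) < 0"
  obtains m where "m < 0" "complex_of_real m \<in> spectrum X T"
proof -
  note Tcl = bounded_op_closed[OF T]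
  obtain C0 where C0: "C0 > 0" "\<And>u. u \<in> ell2 X \<Longrightarrow> ell2_norm X (T u) \<le> C0 * ell2_norm X u"
    using bounded_op_bound[OF T] by blast
  define f where "f u = Re (ell2_inner X (T u) u)" for u
  define S where "S = f ` {u \<in> ell2 X. ell2_norm X u = 1}"
  have "-C0 \<le> f u" if u: "u \<in> ell2 X" "ell2_norm X u = 1" for u
  proof -
    have "\<bar>f u\<bar> \<le> cmod (ell2_inner X (T u) u)" unfolding f_def by (rule abs_Re_le_cmod)
    also have "\<dots> \<le> C0" using ell2_inner_le[OF Tcl[OF u(1)] u(1)] C0(2)[OF u(1)] u(2) by simp
    finally show ?thesis by simp
  qed
  then have bdd: "bdd_below S" by (auto simp: S_def intro!: bdd_belowI)
  have scale: "f (cscale (of_real c) u) = c\<^sup>2 * f u" if "u \<in> ell2 X" for c u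
    using that by (simp add: f_def bounded_op_cscale[OF T] ell2_inner_cscale_left
        ell2_inner_cscale_right power2_eq_square mult.assoc)
  have normalize: "\<exists>u'. u' \<in> ell2 X \<and> ell2_norm X u' = 1 \<and> f u = (ell2_norm X u)\<^sup>2 * f u'"
    if u: "u \<in> ell2 X" "u \<noteq> 0" for u
  proof -
    define n where "n = ell2_norm X u"
    have "n > 0" using u(2) ell2_norm_eq_0_iff[OF u(1)] ell2_norm_nonneg[of X u]
      unfolding n_def by linarith
    then have "ell2_norm X (cscale (of_real (1 / n)) u) = 1" "f u = n\<^sup>2 * f (cscale (of_real (1 / n)) u)"
      unfolding scale[OF u(1)] by (auto simp: n_def norm_divide power_divide)
    then show ?thesis using u(1) unfolding n_def by (meson ell2_cscale)
  qed
  define m where "m = Inf S"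
  have m_le: "m * (ell2_norm X u)\<^sup>2 \<le> f u" if u: "u \<in> ell2 X" for u
  proof (cases "u = 0")
    case True
    then show ?thesis by (simp add: f_def ell2_inner_def)
  next
    case False
    then obtain u' where u': "u' \<in> ell2 X" "ell2_norm X u' = 1" "f u = (ell2_norm X u)\<^sup>2 * f u'"
      using normalize[OF u] by blast
    have "m \<le> f u'" unfolding m_def by (rule cInf_lower[OF _ bdd]) (use u' in \<open>auto simp: S_def\<close>)
    then show ?thesis unfolding u'(3) by (simp add: mult.commute[of m] mult_left_mono)
  qed
  have "w \<noteq> 0" using w(2) by (auto simp: ell2_inner_def)
  then obtain w' where w': "w' \<in> ell2 X" "ell2_norm X w' = 1" "f w = (ell2_norm X w)\<^sup>2 * f w'"
    using normalize[OF w(1)] by blast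
  have "f w' < 0" using w(2) w'(3) by (auto simp: f_def mult_less_0_iff)
  moreover have "f w' \<in> S" using w' by (auto simp: S_def)
  ultimately have "m < 0" unfolding m_def using cInf_lower[OF _ bdd] by (meson le_less_trans)
  define P where "P u = T u - cscale m u" for u
  have P: "bounded_op X P"
    unfolding P_def by (intro bounded_op_minus T bounded_op_scale_id)
  note Pcl = bounded_op_closed[OF P]
  obtain C where C: "C > 0" "\<And>u. u \<in> ell2 X \<Longrightarrow> ell2_norm X (P u) \<le> C * ell2_norm X u"
    using bounded_op_bound[OF P] by blast
  define g where "g u = Re (ell2_inner X (P u) u)" for u
  have gf: "g u = f u - m * (ell2_norm X u)\<^sup>2" if "u \<in> ell2 X" for u
    using that Tcl by (simp add: g_def f_def P_def ell2_inner_diff_left ell2_inner_cscale_left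
        ell2_inner_self flip: of_real_power)
  have Psa: "ell2_inner X (P u) v = ell2_inner X u (P v)" if "u \<in> ell2 X" "v \<in> ell2 X" for u v
    using that sa Tcl by (simp add: P_def selfadjoint_op_def ell2_inner_diff_left
        ell2_inner_diff_right ell2_inner_cscale_left ell2_inner_cscale_right)
  have sq: "(ell2_norm X (P u))\<^sup>2 \<le> C * g u" if u: "u \<in> ell2 X" for u
  proof -
    define v where "v = P u"
    have v: "v \<in> ell2 X" using Pcl[OF u] by (simp add: v_def)
    have gv: "g v \<le> C * (ell2_norm X v)\<^sup>2"
    proof -
      have "g v \<le> cmod (ell2_inner X (P v) v)" unfolding g_def by (rule complex_Re_le_cmod)
      also have "\<dots> \<le> ell2_norm X (P v) * ell2_norm X v" by (rule ell2_inner_le[OF Pcl[OF v] v])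
      also have "\<dots> \<le> C * ell2_norm X v * ell2_norm X v" by (intro mult_right_mono C(2) v) simp
      finally show ?thesis by (simp add: power2_eq_square mult.assoc)
    qed
    have "0 \<le> g (u - cscale (of_real (1 / C)) v)"
      using m_le[of "u - cscale (of_real (1 / C)) v"] u v by (simp add: gf)
    also have "\<dots> = g u - 2 / C * (ell2_norm X v)\<^sup>2 + g v / C\<^sup>2"
    proof -
      have "ell2_inner X (P v) u = ell2_inner X v v" using Psa[OF v u] by (simp add: v_def)
      moreover have "ell2_inner X (P u) v = ell2_inner X v v" by (simp add: v_def)
      moreover have "Re (ell2_inner X v v) = (ell2_norm X v)\<^sup>2"
        using v by (simp add: ell2_inner_self flip: of_real_power)
      ultimately show ?thesis
        using u v Pcl[OF u] Pcl[OF v] C(1) unfolding g_def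
        by (simp add: bounded_op_diff[OF P] bounded_op_cscale[OF P] ell2_inner_diff_left
            ell2_inner_diff_right ell2_inner_cscale_left ell2_inner_cscale_right
            power2_eq_square field_simps)
    qed
    also have "\<dots> \<le> g u - 2 / C * (ell2_norm X v)\<^sup>2 + C * (ell2_norm X v)\<^sup>2 / C\<^sup>2"
      using gv by (intro add_left_mono divide_right_mono) auto
    also have "\<dots> = g u - (ell2_norm X v)\<^sup>2 / C"
      using C(1) by (simp add: power2_eq_square field_simps)
    finally show ?thesis using C(1) by (simp add: v_def field_simps)
  qed
  have "complex_of_real m \<notin> resolvent_set X T"
  proof
    assume "complex_of_real m \<in> resolvent_set X T"
    then obtain c where c: "c > 0" "\<And>u. u \<in> ell2 X \<Longrightarrow> c * ell2_norm X u \<le> ell2_norm X (P u)"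
      unfolding selfadjoint_resolvent_iff[OF T sa] P_def by blast
    have "c\<^sup>2 / C > 0" using c C(1) by simp
    then have "\<exists>y\<in>S. y < m + c\<^sup>2 / C"
      using cInf_less_iff[OF _ bdd, of "m + c\<^sup>2 / C"] \<open>f w' \<in> S\<close> by (auto simp: m_def)
    then obtain u where u: "u \<in> ell2 X" "ell2_norm X u = 1" "f u < m + c\<^sup>2 / C"
      by (auto simp: S_def)
    have "c\<^sup>2 \<le> (ell2_norm X (P u))\<^sup>2"
      using c(2)[OF u(1)] u(2) c(1) by (intro power_mono) auto
    also have "\<dots> \<le> C * g u" by (rule sq[OF u(1)])
    also have "\<dots> < C * (c\<^sup>2 / C)"
      using u C(1) by (intro mult_strict_left_mono) (auto simp: gf)
    finally show False using C(1) by simp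
  qed
  with \<open>m < 0\<close> show thesis by (intro that) (auto simp: spectrum_def)
qed

lemma selfadjoint_inner_self_real:
  assumes "selfadjoint_op X T" "u \<in> ell2 X"
  shows "ell2_inner X (T u) u = of_real (Re (ell2_inner X (T u) u))"
proof -
  have "cnj (ell2_inner X (T u) u) = ell2_inner X (T u) u"
    using assms by (simp add: ell2_inner_cnj selfadjoint_op_def)
  then show ?thesis by (metis Reals_cnj_iff of_real_Re)
qed

text \<open>This puts all nonreal numbers, and all numbers above the supremum of the form on unit vectors,
  into the resolvent set.\<close>

lemma resolvent_if_form_bounded_below:
  assumes T: "bounded_op X T" and sa: "selfadjoint_op X T" and "c > 0"
    and low: "\<And>u. u \<in> ell2 X \<Longrightarrow> c * (ell2_norm X u)\<^sup>2 \<le> cmod (ell2_inner X (T u - cscale z u) u)"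
  shows "z \<in> resolvent_set X T"
  unfolding selfadjoint_resolvent_iff[OF T sa]
proof (intro exI[of _ c] conjI ballI)
  fix u assume u: "u \<in> ell2 X"
  note low[OF u]
  also have "cmod (ell2_inner X (T u - cscale z u) u)
    \<le> ell2_norm X (T u - cscale z u) * ell2_norm X u"
    using u bounded_op_closed[OF T u] by (intro ell2_inner_le) auto
  finally have "c * ell2_norm X u * ell2_norm X u \<le> ell2_norm X (T u - cscale z u) * ell2_norm X u"
    by (simp add: power2_eq_square mult.assoc)
  then show "c * ell2_norm X u \<le> ell2_norm X (T u - cscale z u)"
    using ell2_norm_nonneg[of X u] ell2_norm_nonneg[of X "T u - cscale z u"]
    by (cases "ell2_norm X u = 0") (auto simp: mult_le_cancel_right)
qed fact

section \<open>The lattice Hardy operator and its quadratic form\<close>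

definition lattice_sq :: "int ^ 'n \<Rightarrow> int" where
  "lattice_sq n = (\<Sum>i\<in>UNIV. (n $ i)\<^sup>2)"

lemma lattice_norm_sq: "(lattice_norm n)\<^sup>2 = of_int (lattice_sq n)"
  by (simp add: lattice_norm_def lattice_sq_def norm_vec_def L2_set_def sum_nonneg)

lemma lattice_sq_nonneg [simp]: "0 \<le> lattice_sq n"
  by (simp add: lattice_sq_def sum_nonneg)

lemma lattice_sq_eq_0_iff [simp]: "lattice_sq n = 0 \<longleftrightarrow> n = 0"
  by (simp add: lattice_sq_def sum_nonneg_eq_0_iff vec_eq_iff)

lemma lattice_sq_pos: "n \<noteq> 0 \<Longrightarrow> 1 \<le> lattice_sq n"
  using lattice_sq_nonneg[of n] lattice_sq_eq_0_iff[of n] by linarith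

lemma in_punctured_lattice_iff [simp]: "n \<in> punctured_lattice \<longleftrightarrow> n \<noteq> 0"
  by (simp add: punctured_lattice_def)

abbreviation unit_vec :: "'n \<Rightarrow> int ^ 'n::finite" where
  "unit_vec i \<equiv> axis i 1"

lemma lattice_sq_remove: "lattice_sq n = (n $ i)\<^sup>2 + (\<Sum>j\<in>UNIV - {i}. (n $ j)\<^sup>2)"
  unfolding lattice_sq_def by (simp add: sum.remove[of UNIV i])

lemma lattice_sq_add_unit:
  fixes n :: "int ^ 'n::finite"
  shows "lattice_sq (n + axis i c) = lattice_sq n + 2 * c * n $ i + c\<^sup>2"
proof -
  have "(\<Sum>j\<in>UNIV - {i}. ((n + axis i c) $ j)\<^sup>2) = (\<Sum>j\<in>UNIV - {i}. (n $ j)\<^sup>2)"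
    by (intro sum.cong) (auto simp: axis_def)
  then show ?thesis
    by (simp add: lattice_sq_remove[of _ i] power2_sum algebra_simps)
qed

lemma lattice_sq_uminus [simp]: "lattice_sq (- n) = lattice_sq n"
  by (simp add: lattice_sq_def)

lemma lattice_sq_eq_1_iff:
  fixes n :: "int ^ 'n::finite"
  shows "lattice_sq n = 1 \<longleftrightarrow> (\<exists>i. n = unit_vec i \<or> n = - unit_vec i)"
proof
  assume 1: "lattice_sq n = 1"
  then have "n \<noteq> 0" using lattice_sq_eq_0_iff[of n] by linarith
  then obtain i where i: "n $ i \<noteq> 0" by (auto simp: vec_eq_iff)
  then have "(n $ i)\<^sup>2 \<ge> 1" by (simp add: int_one_le_iff_zero_less)
  moreover have "(\<Sum>j\<in>UNIV - {i}. (n $ j)\<^sup>2) \<ge> 0" by (simp add: sum_nonneg)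
  ultimately have ni: "(n $ i)\<^sup>2 = 1" and 0: "(\<Sum>j\<in>UNIV - {i}. (n $ j)\<^sup>2) = 0"
    using 1 lattice_sq_remove[of n i] by linarith+
  have "n $ j = 0" if "j \<noteq> i" for j
    using 0 that by (subst (asm) sum_nonneg_eq_0_iff) auto
  moreover have "n $ i = 1 \<or> n $ i = -1" using ni by (simp add: power2_eq_1_iff)
  ultimately have "n = unit_vec i \<or> n = - unit_vec i" by (auto simp: vec_eq_iff axis_def)
  then show "\<exists>i. n = unit_vec i \<or> n = - unit_vec i" by blast
next
  have "lattice_sq (unit_vec i) = 1" for i :: 'n
    using lattice_sq_add_unit[of 0 i 1] by simp
  moreover assume "\<exists>i. n = unit_vec i \<or> n = - unit_vec i"
  ultimately show "lattice_sq n = 1" by auto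
qed

lemma sum_nearest_neighbours:
  fixes n :: "int ^ 'n::finite" and f :: "int ^ 'n \<Rightarrow> 'a::comm_monoid_add"
  shows "(\<Sum>m | nearest_neighbour m n. f m) = (\<Sum>i\<in>UNIV. f (n + unit_vec i) + f (n - unit_vec i))"
proof -
  define P where "P = (\<lambda>i. n + unit_vec i) ` UNIV"
  define Q where "Q = (\<lambda>i. n - unit_vec i) ` UNIV"
  have nn: "nearest_neighbour m n \<longleftrightarrow> lattice_sq (m - n) = 1" for m
  proof -
    have "lattice_norm (m - n) \<ge> 0" by (simp add: lattice_norm_def)
    then have "nearest_neighbour m n \<longleftrightarrow> (lattice_norm (m - n))\<^sup>2 = 1"
      by (auto simp: nearest_neighbour_def power2_eq_1_iff)
    then show ?thesis by (simp add: lattice_norm_sq)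
  qed
  have "m - n = unit_vec i \<longleftrightarrow> m = n + unit_vec i" "m - n = - unit_vec i \<longleftrightarrow> m = n - unit_vec i"
    for m i
    by (auto simp: algebra_simps)
  then have set: "{m. nearest_neighbour m n} = P \<union> Q"
    unfolding nn lattice_sq_eq_1_iff P_def Q_def by auto
  have inj: "inj (\<lambda>i. n + unit_vec i)" "inj (\<lambda>i. n - unit_vec i)"
    by (auto simp: inj_def axis_eq_axis)
  have "n + unit_vec i \<noteq> n - unit_vec j" for i j
  proof
    assume "n + unit_vec i = n - unit_vec j"
    then have "(n + unit_vec i) $ i = (n - unit_vec j) $ i" by simp
    then show False by (auto simp: axis_def split: if_splits)
  qed
  then have "P \<inter> Q = {}" by (auto simp: P_def Q_def)
  then have "(\<Sum>m | nearest_neighbour m n. f m) = sum f P + sum f Q"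
    unfolding set by (intro sum.union_disjoint) (auto simp: P_def Q_def)
  also have "sum f P = (\<Sum>i\<in>UNIV. f (n + unit_vec i))"
    unfolding P_def by (simp add: sum.reindex[OF inj(1)])
  also have "sum f Q = (\<Sum>i\<in>UNIV. f (n - unit_vec i))"
    unfolding Q_def by (simp add: sum.reindex[OF inj(2)])
  finally show ?thesis by (simp add: sum.distrib)
qed

lemma finite_lattice_sq_le: "finite {n :: int ^ 'n::finite. lattice_sq n \<le> r}"
proof -
  have "n $ i \<in> {-\<bar>r\<bar>..\<bar>r\<bar>}" if "lattice_sq n \<le> r" for n :: "int ^ 'n" and i
  proof -
    have "(n $ i)\<^sup>2 \<le> lattice_sq n"
      unfolding lattice_sq_remove[of n i] by (simp add: sum_nonneg)
    moreover have "\<bar>n $ i\<bar> \<le> (n $ i)\<^sup>2"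
      by (metis abs_ge_zero int_one_le_iff_zero_less linorder_not_le mult_le_cancel_left1
          not_less_iff_gr_or_eq power2_abs power2_eq_square)
    ultimately show ?thesis using that by auto
  qed
  then have "{n :: int ^ 'n. lattice_sq n \<le> r} \<subseteq> vec_lambda ` (PiE UNIV (\<lambda>_. {-\<bar>r\<bar>..\<bar>r\<bar>}))"
    by (auto intro!: image_eqI[of _ vec_lambda "vec_nth _"])
  moreover have "finite (PiE (UNIV :: 'n set) (\<lambda>_. {-\<bar>r\<bar>..\<bar>r\<bar>}))"
    by (intro finite_PiE) auto
  ultimately show ?thesis by (meson finite_imageI finite_subset)
qed

abbreviation X0 :: "(int ^ 'n) set" where
  "X0 \<equiv> punctured_lattice"

text \<open>Translation by \<open>a\<close>, compressed to functions that vanish at the origin.\<close>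

definition shift :: "int ^ 'n \<Rightarrow> (int ^ 'n \<Rightarrow> complex) \<Rightarrow> int ^ 'n \<Rightarrow> complex" where
  "shift a u = (\<lambda>n. if n = 0 then 0 else u (n + a))"

lemma bij_plus_lattice: "bij (\<lambda>n. n + a :: int ^ 'n)"
  by (rule bij_betw_byWitness[of _ "\<lambda>n. n - a"]) auto

lemma bounded_op_shift: "bounded_op X0 (shift a :: (int ^ 'n \<Rightarrow> complex) \<Rightarrow> _)"
  and ell2_norm_shift_le: "u \<in> ell2 X0 \<Longrightarrow> ell2_norm X0 (shift a u) \<le> ell2_norm X0 u"
proof -
  have *: "shift a u \<in> ell2 X0 \<and> ell2_norm X0 (shift a u) \<le> ell2_norm X0 u"
    if u: "u \<in> ell2 X0" for u :: "int ^ 'n \<Rightarrow> complex"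
  proof -
    have u0: "u 0 = 0" using ell2_outside[OF u] by simp
    have "(\<lambda>n. (cmod (u n))\<^sup>2) summable_on UNIV"
      using ell2_summable[OF u] u0 by (subst (asm) summable_on_cong_neutral[of UNIV]) auto
    then have summ: "(\<lambda>n. (cmod (u (n + a)))\<^sup>2) summable_on UNIV"
      using summable_on_reindex_bij_betw[OF bij_plus_lattice, of "\<lambda>n. (cmod (u n))\<^sup>2" a] by simp
    have summ': "(\<lambda>n. (cmod (shift a u n))\<^sup>2) summable_on X0"
      by (rule summable_on_comparison_test[OF summable_on_subset[OF summ, of X0]]) (auto simp: shift_def)
    have "(\<Sum>\<^sub>\<infinity>n\<in>X0. (cmod (shift a u n))\<^sup>2) \<le> (\<Sum>\<^sub>\<infinity>n. (cmod (u (n + a)))\<^sup>2)"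
      using summ' summ by (rule infsum_mono_neutral) (auto simp: shift_def)
    also have "\<dots> = (\<Sum>\<^sub>\<infinity>n. (cmod (u n))\<^sup>2)"
      by (rule infsum_reindex_bij_betw[OF bij_plus_lattice, of "\<lambda>n. (cmod (u n))\<^sup>2"])
    also have "\<dots> = (\<Sum>\<^sub>\<infinity>n\<in>X0. (cmod (u n))\<^sup>2)"
      using u0 by (intro infsum_cong_neutral) auto
    finally have "(ell2_norm X0 (shift a u))\<^sup>2 \<le> (ell2_norm X0 u)\<^sup>2"
      by (simp add: ell2_norm_sq)
    then have "ell2_norm X0 (shift a u) \<le> ell2_norm X0 u"
      by (rule power2_le_imp_le) simp
    then show ?thesis using summ' by (auto simp: ell2_def shift_def)
  qed
  then show "u \<in> ell2 X0 \<Longrightarrow> ell2_norm X0 (shift a u) \<le> ell2_norm X0 u" by blast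
  show "bounded_op X0 (shift a :: (int ^ 'n \<Rightarrow> complex) \<Rightarrow> _)"
    by (rule bounded_opI[where C = 1]) (use * in \<open>auto simp: shift_def fun_eq_iff\<close>)
qed

lemmas shift_ell2 [simp] = bounded_op_closed[OF bounded_op_shift]

lemma ell2_inner_shift_eq:
  assumes "v \<in> ell2 X0"
  shows "ell2_inner X0 (shift a u) v = (\<Sum>\<^sub>\<infinity>n. u (n + a) * cnj (v n))"
  unfolding ell2_inner_def using ell2_outside[OF assms]
  by (intro infsum_cong_neutral) (auto simp: shift_def)

lemma ell2_inner_shift:
  assumes u: "u \<in> ell2 X0" and v: "v \<in> ell2 X0"
  shows "ell2_inner X0 (shift a u) v = ell2_inner X0 u (shift (-a) v)"
proof -
  have "ell2_inner X0 (shift a u) v = (\<Sum>\<^sub>\<infinity>n. u (n + a) * cnj (v (n + a + (-a))))"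
    using ell2_inner_shift_eq[OF v] by simp
  also have "\<dots> = (\<Sum>\<^sub>\<infinity>n. u n * cnj (v (n + (-a))))"
    by (rule infsum_reindex_bij_betw[OF bij_plus_lattice, of "\<lambda>n. u n * cnj (v (n + (-a)))"])
  also have "\<dots> = cnj (\<Sum>\<^sub>\<infinity>n. v (n + (-a)) * cnj (u n))"
    by (simp add: mult.commute flip: infsum_cnj)
  also have "\<dots> = ell2_inner X0 u (shift (-a) v)"
    using ell2_inner_shift_eq[OF u, of "-a" v] by (metis ell2_inner_cnj)
  finally show ?thesis .
qed

lemma inverse_square_bounded: "bounded_op X0 (inverse_square_op :: (int ^ 'n::finite \<Rightarrow> complex) \<Rightarrow> _)"
proof (rule bounded_opI[where C = 1])
  fix u :: "int ^ 'n \<Rightarrow> complex" assume u: "u \<in> ell2 X0"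
  have "cmod (inverse_square_op u n) \<le> cmod (u n)" if "n \<in> X0" for n
  proof -
    have "(1::real) \<le> real_of_int (lattice_sq n)"
      using lattice_sq_pos[of n] that by simp
    then have "cmod (u n) / real_of_int (lattice_sq n) \<le> cmod (u n) / 1"
      by (intro divide_left_mono) auto
    then show ?thesis
      using that \<open>1 \<le> real_of_int (lattice_sq n)\<close>
      by (simp add: inverse_square_op_def norm_divide lattice_norm_sq flip: of_real_power)
  qed
  moreover have "inverse_square_op u n = 0" if "n \<notin> X0" for n
    using that by (simp add: inverse_square_op_def)
  ultimately show "inverse_square_op u \<in> ell2 X0"
    "ell2_norm X0 (inverse_square_op u) \<le> 1 * ell2_norm X0 u"
    using ell2_dominated[OF u, of "inverse_square_op u"] by auto
qed (auto simp: inverse_square_op_def fun_eq_iff add_divide_distrib)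

lemma inverse_square_selfadjoint:
  "ell2_inner X0 (inverse_square_op u) v = ell2_inner X0 u (inverse_square_op v)"
  unfolding ell2_inner_def by (intro infsum_cong) (simp add: inverse_square_op_def)

lemma hardy_op_eq:
  fixes u :: "int ^ 'n::finite \<Rightarrow> complex"
  assumes u: "u \<in> ell2 X0"
  shows "hardy_op u = cscale (2 * of_nat CARD('n)) u
    - (\<Sum>i\<in>UNIV. shift (unit_vec i) u + shift (- unit_vec i) u)
    - cscale (of_real (hardy_const CARD('n))) (inverse_square_op u)"
proof -
  have u0: "u 0 = 0" using ell2_outside[OF u] by simp
  have sum_fun: "(\<Sum>i\<in>I. f i) n = (\<Sum>i\<in>I. f i n)" for I and f :: "'n \<Rightarrow> int ^ 'n \<Rightarrow> complex" and n
    by (induction I rule: infinite_finite_induct) auto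
  have "dirichlet_laplacian u n = (cscale (2 * of_nat CARD('n)) u
    - (\<Sum>i\<in>UNIV. shift (unit_vec i) u + shift (- unit_vec i) u)) n" for n
  proof (cases "n = 0")
    case True
    then show ?thesis using u0 by (simp add: dirichlet_laplacian_def sum_fun shift_def)
  next
    case False
    have "(\<Sum>m | nearest_neighbour m n \<and> m \<in> X0. u m) = (\<Sum>m | nearest_neighbour m n. u m)"
      using finite_nearest_neighbours[of n UNIV] u0 by (intro sum.mono_neutral_left) auto
    then show ?thesis
      using False by (simp add: dirichlet_laplacian_def sum_nearest_neighbours sum_fun shift_def)
  qed
  then show ?thesis by (simp add: hardy_op_def fun_eq_iff)
qed

lemma hardy_op_bounded: "bounded_op X0 (hardy_op :: (int ^ 'n::finite \<Rightarrow> complex) \<Rightarrow> _)"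
proof -
  have plus: "bounded_op X (\<lambda>u. S u + T u)" if "bounded_op X S" "bounded_op X T"
    for X :: "(int ^ 'n) set" and S T
  proof -
    have "bounded_op X (\<lambda>u. S u - (cscale (-1) (T u)))"
      by (intro bounded_op_minus bounded_op_comp[OF bounded_op_scale_id] that)
    then show ?thesis by (simp add: cscale_def fun_diff_def plus_fun_def)
  qed
  have hop: "bounded_op X0 (\<lambda>u. \<Sum>i\<in>I. shift (unit_vec i :: int ^ 'n) u + shift (- unit_vec i) u)" for I
  proof (induction I rule: infinite_finite_induct)
    case (insert i I)
    then show ?case
      unfolding sum.insert[OF insert(1,2)] by (intro plus bounded_op_shift)
  qed (rule bounded_opI[where C = 0], simp_all add: ell2_norm_def ell2_def fun_eq_iff)+
  have "bounded_op X0 (\<lambda>u. cscale (2 * of_nat CARD('n)) u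
    - (\<Sum>i\<in>UNIV. shift (unit_vec i :: int ^ 'n) u + shift (- unit_vec i) u)
    - cscale (of_real (hardy_const CARD('n))) (inverse_square_op u))"
    by (intro bounded_op_minus[OF bounded_op_minus[OF bounded_op_scale_id hop]]
        bounded_op_comp[OF bounded_op_scale_id] inverse_square_bounded)
  then show ?thesis
    unfolding bounded_op_def by (simp add: hardy_op_eq)
qed

lemma hardy_op_inner:
  fixes u :: "int ^ 'n::finite \<Rightarrow> complex"
  assumes u: "u \<in> ell2 X0" and v: "v \<in> ell2 X0"
  shows "ell2_inner X0 (hardy_op u) v = 2 * of_nat CARD('n) * ell2_inner X0 u v
    - (\<Sum>i\<in>UNIV. ell2_inner X0 (shift (unit_vec i) u) v + ell2_inner X0 (shift (- unit_vec i) u) v)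
    - of_real (hardy_const CARD('n)) * ell2_inner X0 (inverse_square_op u) v"
proof -
  note cl = bounded_op_closed[OF inverse_square_bounded u]
  define s where "s = (\<Sum>i\<in>UNIV. shift (unit_vec i) u + shift (- unit_vec i) u)"
  have s: "s \<in> ell2 X0" unfolding s_def using u by (intro ell2_sum ell2_add shift_ell2)
  have "ell2_inner X0 s v = (\<Sum>i\<in>UNIV. ell2_inner X0 (shift (unit_vec i) u + shift (- unit_vec i) u) v)"
    unfolding s_def using u v by (intro ell2_inner_sum_left ell2_add shift_ell2)
  also have "\<dots> = (\<Sum>i\<in>UNIV. ell2_inner X0 (shift (unit_vec i) u) v + ell2_inner X0 (shift (- unit_vec i) u) v)"
    using u v by (intro sum.cong refl ell2_inner_add_left shift_ell2)
  finally show ?thesis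
    using u v s cl unfolding hardy_op_eq[OF u] s_def[symmetric]
    by (simp add: ell2_inner_diff_left ell2_inner_cscale_left)
qed

lemma hardy_op_selfadjoint: "selfadjoint_op X0 (hardy_op :: (int ^ 'n::finite \<Rightarrow> complex) \<Rightarrow> _)"
  unfolding selfadjoint_op_def
proof (intro ballI)
  fix u v :: "int ^ 'n \<Rightarrow> complex" assume u: "u \<in> ell2 X0" and v: "v \<in> ell2 X0"
  have "ell2_inner X0 u (hardy_op v) = cnj (ell2_inner X0 (hardy_op v) u)"
    by (simp add: ell2_inner_cnj)
  also have "\<dots> = 2 * of_nat CARD('n) * ell2_inner X0 u v
    - (\<Sum>i\<in>UNIV. ell2_inner X0 u (shift (unit_vec i) v) + ell2_inner X0 u (shift (- unit_vec i) v))
    - of_real (hardy_const CARD('n)) * ell2_inner X0 u (inverse_square_op v)"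
    unfolding hardy_op_inner[OF v u] by (simp add: ell2_inner_cnj)
  also have "\<dots> = ell2_inner X0 (hardy_op u) v"
    unfolding hardy_op_inner[OF u v] ell2_inner_shift[OF u v] inverse_square_selfadjoint
    by (simp add: add.commute)
  finally show "ell2_inner X0 (hardy_op u) v = ell2_inner X0 u (hardy_op v)" ..
qed

lemma hardy_weight_summable:
  fixes u :: "int ^ 'n::finite \<Rightarrow> complex"
  assumes u: "u \<in> ell2 X0"
  shows "(\<lambda>n. (cmod (u n))\<^sup>2 / real_of_int (lattice_sq n)) summable_on X0"
proof (rule summable_on_comparison_test[OF ell2_summable[OF u]])
  fix n :: "int ^ 'n" assume "n \<in> X0"
  then have "1 \<le> real_of_int (lattice_sq n)" using lattice_sq_pos[of n] by simp
  then show "(cmod (u n))\<^sup>2 / real_of_int (lattice_sq n) \<le> (cmod (u n))\<^sup>2"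
    using divide_left_mono[of 1 "real_of_int (lattice_sq n)" "(cmod (u n))\<^sup>2"] by simp
qed simp

lemma hardy_form:
  fixes u :: "int ^ 'n::finite \<Rightarrow> complex"
  assumes u: "u \<in> ell2 X0"
  shows "Re (ell2_inner X0 (hardy_op u) u) = 2 * real CARD('n) * (ell2_norm X0 u)\<^sup>2
    - (\<Sum>i\<in>UNIV. 2 * Re (ell2_inner X0 (shift (unit_vec i) u) u))
    - hardy_const CARD('n) * (\<Sum>\<^sub>\<infinity>n\<in>X0. (cmod (u n))\<^sup>2 / real_of_int (lattice_sq n))"
proof -
  have "ell2_inner X0 (shift (- a) u) u = cnj (ell2_inner X0 (shift a u) u)" for a
    using ell2_inner_shift[OF u u, of "-a"] by (simp add: ell2_inner_cnj)
  then have 1: "Re (ell2_inner X0 (shift (- a) u) u) = Re (ell2_inner X0 (shift a u) u)" for a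
    by simp
  have "ell2_inner X0 (inverse_square_op u) u
      = (\<Sum>\<^sub>\<infinity>n\<in>X0. of_real ((cmod (u n))\<^sup>2 / real_of_int (lattice_sq n)))"
    unfolding ell2_inner_def
    by (intro infsum_cong) (simp add: inverse_square_op_def lattice_norm_sq complex_norm_square
        flip: of_real_power)
  also have "\<dots> = of_real (\<Sum>\<^sub>\<infinity>n\<in>X0. (cmod (u n))\<^sup>2 / real_of_int (lattice_sq n))"
    by (intro infsumI has_sum_of_real has_sum_infsum hardy_weight_summable u)
  finally have 2: "Re (ell2_inner X0 (inverse_square_op u) u)
    = (\<Sum>\<^sub>\<infinity>n\<in>X0. (cmod (u n))\<^sup>2 / real_of_int (lattice_sq n))" by simp
  show ?thesis
    unfolding hardy_op_inner[OF u u]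
    by (simp add: ell2_inner_self[OF u] 1 2 flip: of_real_power)
qed

lemma hopping_form_bound:
  fixes u :: "int ^ 'n::finite \<Rightarrow> complex"
  assumes u: "u \<in> ell2 X0"
  shows "\<bar>\<Sum>i\<in>UNIV. 2 * Re (ell2_inner X0 (shift (unit_vec i) u) u)\<bar>
    \<le> 2 * real CARD('n) * (ell2_norm X0 u)\<^sup>2"
proof -
  have "\<bar>2 * Re (ell2_inner X0 (shift (unit_vec i) u) u)\<bar> \<le> 2 * (ell2_norm X0 u)\<^sup>2" for i :: 'n
  proof -
    have "\<bar>Re (ell2_inner X0 (shift (unit_vec i) u) u)\<bar> \<le> cmod (ell2_inner X0 (shift (unit_vec i) u) u)"
      by (rule abs_Re_le_cmod)
    also have "\<dots> \<le> ell2_norm X0 (shift (unit_vec i) u) * ell2_norm X0 u"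
      using u by (intro ell2_inner_le shift_ell2)
    also have "\<dots> \<le> ell2_norm X0 u * ell2_norm X0 u"
      using ell2_norm_shift_le[OF u] by (intro mult_right_mono) auto
    finally show ?thesis by (simp add: power2_eq_square)
  qed
  then have "(\<Sum>i\<in>UNIV. \<bar>2 * Re (ell2_inner X0 (shift (unit_vec i) u) u)\<bar>)
    \<le> (\<Sum>i\<in>(UNIV :: 'n set). 2 * (ell2_norm X0 u)\<^sup>2)"
    by (intro sum_mono)
  then show ?thesis
    by (intro order_trans[OF sum_abs]) simp
qed

text \<open>The sites where \<open>A / \<bar>n\<bar>\<^sup>2\<close> exceeds \<open>\<bar>z\<bar> / 2\<close> are finite in number, and at all others the
  potential costs at most half of \<open>- z\<close>.\<close>

lemma hardy_coercive_mod_finite: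
  assumes z: "z < 0"
  shows "coercive_mod_finite X0 (hardy_op :: (int ^ 'n::finite \<Rightarrow> complex) \<Rightarrow> _) (of_real z)"
proof -
  define A where "A = hardy_const CARD('n)"
  have A: "A \<ge> 0" by (simp add: A_def hardy_const_def)
  define a where "a n = A / real_of_int (lattice_sq n)" for n :: "int ^ 'n"
  define F where "F = {n :: int ^ 'n. n \<noteq> 0 \<and> a n > - z / 2}"
  have "F \<subseteq> {n. lattice_sq n \<le> \<lceil>2 * A / (- z)\<rceil>}"
  proof
    fix n assume n: "n \<in> F"
    then have "real_of_int (lattice_sq n) > 0" using lattice_sq_pos[of n] by (auto simp: F_def)
    then have "real_of_int (lattice_sq n) < 2 * A / (- z)"
      using n z unfolding F_def a_def by (simp add: field_simps)
    then show "n \<in> {n. lattice_sq n \<le> \<lceil>2 * A / (- z)\<rceil>}"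
      by (simp add: le_ceiling_iff)
  qed
  then have F: "finite F" "F \<subseteq> X0"
    using finite_subset[OF _ finite_lattice_sq_le] by (auto simp: F_def)
  have "- z / 2 * (ell2_norm X0 u)\<^sup>2 \<le> Re (ell2_inner X0 (hardy_op u - cscale (of_real z) u) u)
      + (\<Sum>n\<in>F. a n * (cmod (u n))\<^sup>2)" if u: "u \<in> ell2 X0" for u :: "int ^ 'n \<Rightarrow> complex"
  proof -
    have on_F: "((\<lambda>n. if n \<in> F then a n * (cmod (u n))\<^sup>2 else 0) has_sum
        (\<Sum>n\<in>F. a n * (cmod (u n))\<^sup>2)) X0"
      using F by (intro has_sum_finite_neutralI[of F]) auto
    have "A * (\<Sum>\<^sub>\<infinity>n\<in>X0. (cmod (u n))\<^sup>2 / real_of_int (lattice_sq n)) =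
      (\<Sum>\<^sub>\<infinity>n\<in>X0. a n * (cmod (u n))\<^sup>2)"
      by (simp add: a_def flip: infsum_cmult_right')
    also have "\<dots> \<le> (\<Sum>\<^sub>\<infinity>n\<in>X0. (if n \<in> F then a n * (cmod (u n))\<^sup>2 else 0) + - z / 2 * (cmod (u n))\<^sup>2)"
    proof (rule infsum_mono)
      show "(\<lambda>n. a n * (cmod (u n))\<^sup>2) summable_on X0"
        using summable_on_cmult_right[OF hardy_weight_summable[OF u], of A] by (simp add: a_def)
      show "(\<lambda>n. (if n \<in> F then a n * (cmod (u n))\<^sup>2 else 0) + - z / 2 * (cmod (u n))\<^sup>2) summable_on X0"
        by (intro summable_on_add summable_on_cmult_right ell2_summable[OF u]
            has_sum_imp_summable[OF on_F])
      show "a n * (cmod (u n))\<^sup>2 \<le> (if n \<in> F then a n * (cmod (u n))\<^sup>2 else 0) + - z / 2 * (cmod (u n))\<^sup>2"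
        if "n \<in> X0" for n
      proof (cases "n \<in> F")
        case True
        then show ?thesis using z by (simp add: mult_nonpos_nonneg)
      next
        case False
        then have "a n \<le> - z / 2" using that by (simp add: F_def)
        then show ?thesis using False mult_right_mono[of "a n" "- z / 2" "(cmod (u n))\<^sup>2"] by simp
      qed
    qed
    also have "\<dots> = (\<Sum>\<^sub>\<infinity>n\<in>X0. if n \<in> F then a n * (cmod (u n))\<^sup>2 else 0) + (\<Sum>\<^sub>\<infinity>n\<in>X0. - z / 2 * (cmod (u n))\<^sup>2)"
      by (intro infsum_add summable_on_cmult_right ell2_summable[OF u]
          has_sum_imp_summable[OF on_F])
    also have "(\<Sum>\<^sub>\<infinity>n\<in>X0. if n \<in> F then a n * (cmod (u n))\<^sup>2 else 0) = (\<Sum>n\<in>F. a n * (cmod (u n))\<^sup>2)"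
      by (rule infsumI[OF on_F])
    also have "(\<Sum>\<^sub>\<infinity>n\<in>X0. - z / 2 * (cmod (u n))\<^sup>2) = - z / 2 * (ell2_norm X0 u)\<^sup>2"
      unfolding ell2_norm_sq by (rule infsum_cmult_right')
    finally have pot: "A * (\<Sum>\<^sub>\<infinity>n\<in>X0. (cmod (u n))\<^sup>2 / real_of_int (lattice_sq n))
      \<le> (\<Sum>n\<in>F. a n * (cmod (u n))\<^sup>2) + - z / 2 * (ell2_norm X0 u)\<^sup>2" .
    have "Re (ell2_inner X0 (hardy_op u - cscale (of_real z) u) u)
      = Re (ell2_inner X0 (hardy_op u) u) - z * (ell2_norm X0 u)\<^sup>2"
      using u bounded_op_closed[OF hardy_op_bounded u]
      by (simp add: ell2_inner_diff_left ell2_inner_cscale_left ell2_inner_self flip: of_real_power)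
    then show ?thesis
      using pot hardy_form[OF u] hopping_form_bound[OF u] unfolding A_def by linarith
  qed
  moreover have "- z / 2 > 0" using z by simp
  ultimately show ?thesis
    using F(1) unfolding coercive_mod_finite_def
    by (intro exI[of _ F] exI[of _ a] exI[of _ "- z / 2"]) simp
qed

lemma hardy_spectrum_subset:
  fixes z :: complex
  assumes z: "z \<in> spectrum X0 (hardy_op :: (int ^ 'n::finite \<Rightarrow> complex) \<Rightarrow> _)"
  shows "z \<in> of_real ` {0..4 * real CARD('n)}
    \<or> z \<in> discrete_spectrum X0 (hardy_op :: (int ^ 'n \<Rightarrow> complex) \<Rightarrow> _)"
proof -
  let ?H = "hardy_op :: (int ^ 'n \<Rightarrow> complex) \<Rightarrow> _"
  note H = hardy_op_bounded[where 'n = 'n] and sa = hardy_op_selfadjoint[where 'n = 'n]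
  have form: "ell2_inner X0 (?H u - cscale z u) u
      = of_real (Re (ell2_inner X0 (?H u) u)) - z * of_real ((ell2_norm X0 u)\<^sup>2)"
    if u: "u \<in> ell2 X0" for u z
    using u bounded_op_closed[OF H u] selfadjoint_inner_self_real[OF sa u]
    by (simp add: ell2_inner_diff_left ell2_inner_cscale_left ell2_inner_self)
  have notres: "z \<notin> resolvent_set X0 ?H" using z by (simp add: spectrum_def)
  have im: "Im z = 0"
  proof (rule ccontr)
    assume "Im z \<noteq> 0"
    have "z \<in> resolvent_set X0 ?H"
    proof (rule resolvent_if_form_bounded_below[OF H sa])
      show "\<bar>Im z\<bar> > 0" using \<open>Im z \<noteq> 0\<close> by simp
      show "\<bar>Im z\<bar> * (ell2_norm X0 u)\<^sup>2 \<le> cmod (ell2_inner X0 (?H u - cscale z u) u)"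
        if "u \<in> ell2 X0" for u
        using abs_Im_le_cmod[of "ell2_inner X0 (?H u - cscale z u) u"]
        unfolding form[OF that] by (simp add: abs_mult flip: of_real_power)
    qed
    then show False using notres by simp
  qed
  define x where "x = Re z"
  have zx: "z = of_real x" using im by (simp add: x_def complex_eq_iff)
  have "x \<le> 4 * real CARD('n)"
  proof (rule ccontr)
    assume "\<not> x \<le> 4 * real CARD('n)"
    have "z \<in> resolvent_set X0 ?H"
    proof (rule resolvent_if_form_bounded_below[OF H sa])
      show "x - 4 * real CARD('n) > 0" using \<open>\<not> x \<le> 4 * real CARD('n)\<close> by simp
      show "(x - 4 * real CARD('n)) * (ell2_norm X0 u)\<^sup>2 \<le> cmod (ell2_inner X0 (?H u - cscale z u) u)"
        if u: "u \<in> ell2 X0" for u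
      proof -
        have "0 \<le> (\<Sum>\<^sub>\<infinity>n\<in>X0. (cmod (u n))\<^sup>2 / real_of_int (lattice_sq n))"
          by (intro infsum_nonneg) auto
        then have "0 \<le> hardy_const CARD('n) * (\<Sum>\<^sub>\<infinity>n\<in>X0. (cmod (u n))\<^sup>2 / real_of_int (lattice_sq n))"
          by (simp add: hardy_const_def)
        then have "Re (ell2_inner X0 (?H u) u) \<le> 4 * real CARD('n) * (ell2_norm X0 u)\<^sup>2"
          using hardy_form[OF u] hopping_form_bound[OF u] by linarith
        moreover have "\<bar>Re (ell2_inner X0 (?H u - cscale z u) u)\<bar>
          \<le> cmod (ell2_inner X0 (?H u - cscale z u) u)" by (rule abs_Re_le_cmod)
        moreover have "Re (ell2_inner X0 (?H u - cscale z u) u)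
          = Re (ell2_inner X0 (?H u) u) - x * (ell2_norm X0 u)\<^sup>2"
          unfolding form[OF u] by (simp add: zx flip: of_real_power)
        ultimately show ?thesis by (simp add: left_diff_distrib)
      qed
    qed
    then show False using notres by simp
  qed
  moreover have "z \<in> discrete_spectrum X0 ?H" if "x < 0"
    using coercive_mod_finite_imp_discrete[OF H sa z] hardy_coercive_mod_finite[OF that] zx by simp
  ultimately show ?thesis unfolding zx by (cases "x < 0") auto
qed

section \<open>The essential spectrum\<close>

lemma ell2_norm_finite_support_le:
  assumes S: "finite S" "S \<subseteq> X" and "\<And>x. x \<notin> S \<Longrightarrow> u x = 0" "\<And>x. x \<in> S \<Longrightarrow> cmod (u x) \<le> C"
  shows "(ell2_norm X u)\<^sup>2 \<le> C\<^sup>2 * real (card S)"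
proof -
  have "(ell2_norm X u)\<^sup>2 = (\<Sum>x\<in>S. (cmod (u x))\<^sup>2)"
    unfolding ell2_norm_sq using assms
    by (intro infsumI has_sum_finite_neutralI[of S]) auto
  also have "\<dots> \<le> (\<Sum>x\<in>S. C\<^sup>2)"
    by (intro sum_mono power_mono assms) auto
  finally show ?thesis by (simp add: mult.commute)
qed

lemma ell2_norm_unimodular_on:
  assumes S: "finite S" "S \<subseteq> X" and "\<And>x. x \<notin> S \<Longrightarrow> u x = 0" "\<And>x. x \<in> S \<Longrightarrow> cmod (u x) = 1"
  shows "(ell2_norm X u)\<^sup>2 = real (card S)"
proof -
  have "(ell2_norm X u)\<^sup>2 = (\<Sum>x\<in>S. (cmod (u x))\<^sup>2)"
    unfolding ell2_norm_sq using assms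
    by (intro infsumI has_sum_finite_neutralI[of S]) auto
  also have "\<dots> = (\<Sum>x\<in>S. 1)"
    by (intro sum.cong) (auto simp: assms)
  finally show ?thesis by simp
qed

lemma
  fixes B :: "'n::finite \<Rightarrow> 'a set"
  assumes "\<And>j. finite (B j)"
  shows finite_lattice_box: "finite {n :: 'a ^ 'n. \<forall>j. n $ j \<in> B j}"
    and card_lattice_box: "card {n :: 'a ^ 'n. \<forall>j. n $ j \<in> B j} = (\<Prod>j\<in>UNIV. card (B j))"
proof -
  have bij: "bij_betw vec_nth {n :: 'a ^ 'n. \<forall>j. n $ j \<in> B j} (PiE UNIV B)"
    by (rule bij_betw_byWitness[of _ vec_lambda]) auto
  have fin: "finite (PiE UNIV B)" using assms by (intro finite_PiE) auto
  show "finite {n :: 'a ^ 'n. \<forall>j. n $ j \<in> B j}"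
    using bij_betw_finite[OF bij] fin by simp
  show "card {n :: 'a ^ 'n. \<forall>j. n $ j \<in> B j} = (\<Prod>j\<in>UNIV. card (B j))"
    using bij_betw_same_card[OF bij] by (simp add: card_PiE)
qed

text \<open>The plane wave with frequency \<open>\<theta>\<close> in every coordinate, cut off to a cube of side \<open>k\<close> at
  distance at least \<open>k\<close> from the origin.\<close>

definition cube :: "nat \<Rightarrow> (int ^ 'n) set" where
  "cube k = {n. \<forall>j. n $ j \<in> {int k + 1..2 * int k}}"

definition wave_packet :: "real \<Rightarrow> nat \<Rightarrow> int ^ 'n \<Rightarrow> complex" where
  "wave_packet \<theta> k n = (if n \<in> cube k then cis (\<theta> * of_int (\<Sum>j\<in>UNIV. n $ j)) else 0)"

lemma zero_notin_cube: "0 \<notin> (cube k :: (int ^ 'n::finite) set)"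
  by (simp add: cube_def)

lemma finite_cube: "finite (cube k :: (int ^ 'n::finite) set)"
  and card_cube: "card (cube k :: (int ^ 'n::finite) set) = k ^ CARD('n)"
  using finite_lattice_box[of "\<lambda>_ :: 'n. {int k + 1..2 * int k}"]
    card_lattice_box[of "\<lambda>_ :: 'n. {int k + 1..2 * int k}"]
  by (simp_all add: cube_def)

lemma wave_packet_ell2: "wave_packet \<theta> k \<in> ell2 (X0 :: (int ^ 'n::finite) set)"
proof (rule ell2_finite_supportI)
  show "finite {n :: int ^ 'n. wave_packet \<theta> k n \<noteq> 0}"
    by (rule finite_subset[OF _ finite_cube[of k]]) (auto simp: wave_packet_def)
qed (use zero_notin_cube in \<open>auto simp: wave_packet_def\<close>)

lemma wave_packet_norm:
  "(ell2_norm X0 (wave_packet \<theta> k :: int ^ 'n::finite \<Rightarrow> complex))\<^sup>2 = real k ^ CARD('n)"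
proof -
  have "(ell2_norm X0 (wave_packet \<theta> k :: int ^ 'n \<Rightarrow> complex))\<^sup>2 = real (card (cube k :: (int ^ 'n) set))"
    using zero_notin_cube[where 'n = 'n]
    by (intro ell2_norm_unimodular_on finite_cube) (auto simp: wave_packet_def)
  then show ?thesis by (simp add: card_cube)
qed

text \<open>Away from the origin \<open>2 cos \<theta> - shift (unit_vec i) - shift (- unit_vec i)\<close> annihilates a full
  plane wave; for the wave packet, only the sites next to the two faces of the cube orthogonal to \<open>unit_vec i\<close>
  contribute, and there are at most \<open>4 k ^ (N - 1)\<close> of them.\<close>

lemma wave_packet_boundary:
  fixes i :: "'n::finite" and k :: nat and \<theta> :: real
  defines "u \<equiv> (wave_packet \<theta> k :: int ^ 'n \<Rightarrow> complex)"
  defines "D \<equiv> cscale (2 * cos \<theta>) u - (shift (unit_vec i) u + shift (- unit_vec i) u)"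
  assumes k: "k \<ge> 1"
  shows "(ell2_norm X0 D)\<^sup>2 \<le> 64 * real k ^ (CARD('n) - 1)"
proof -
  define E where "E = {int k, int k + 1, 2 * int k, 2 * int k + 1}"
  define B where "B j = (if j = i then E else {int k + 1..2 * int k})" for j
  define S where "S = {n :: int ^ 'n. \<forall>j. n $ j \<in> B j}"
  have finB: "finite (B j)" for j by (auto simp: B_def E_def)
  have "card E \<le> 4"
    unfolding E_def by (auto intro!: card_insert_le_m1)
  have "card S = card (B i) * (\<Prod>j\<in>UNIV - {i}. card (B j))"
    unfolding S_def card_lattice_box[OF finB] by (simp add: prod.remove)
  also have "(\<Prod>j\<in>UNIV - {i}. card (B j)) = (\<Prod>j\<in>UNIV - {i}. k)"
    by (intro prod.cong) (auto simp: B_def)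
  finally have cardS: "card S \<le> 4 * k ^ (CARD('n) - 1)"
    using \<open>card E \<le> 4\<close> by (simp add: B_def card_Diff_singleton)
  have finS: "finite S" unfolding S_def by (rule finite_lattice_box[OF finB])
  have S0: "S \<subseteq> X0"
  proof
    fix n assume "n \<in> S"
    then have "n $ i \<in> E" by (auto simp: S_def B_def split: if_splits)
    then show "n \<in> X0" using k by (auto simp: E_def)
  qed
  have u1: "cmod (u n) \<le> 1" for n by (simp add: u_def wave_packet_def)
  have u0: "u 0 = 0" using zero_notin_cube[of k, where 'n = 'n] by (simp add: u_def wave_packet_def)
  have nth: "(n + unit_vec i) $ j = n $ j + (if j = i then 1 else 0)"
    "(n + - unit_vec i) $ j = n $ j - (if j = i then 1 else 0)" for n :: "int ^ 'n" and j
    by (auto simp: axis_def)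
  have sums: "(\<Sum>j\<in>UNIV. (n + unit_vec i) $ j) = (\<Sum>j\<in>UNIV. n $ j) + 1"
    "(\<Sum>j\<in>UNIV. (n + - unit_vec i) $ j) = (\<Sum>j\<in>UNIV. n $ j) - 1" for n :: "int ^ 'n"
    unfolding nth by (simp_all add: sum.distrib sum_subtractf)
  have off: "D n = 0" if n: "n \<notin> S" for n
  proof (cases "n = 0")
    case True
    then show ?thesis by (simp add: D_def u0 shift_def)
  next
    case False
    then have D: "D n = 2 * cos \<theta> * u n - (u (n + unit_vec i) + u (n + - unit_vec i))"
      by (simp add: D_def shift_def)
    show ?thesis
    proof (cases "\<forall>j. j \<noteq> i \<longrightarrow> n $ j \<in> {int k + 1..2 * int k}")
      case False
      then obtain j where "j \<noteq> i" "n $ j \<notin> {int k + 1..2 * int k}" by blast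
      then have "n \<notin> cube k" "n + unit_vec i \<notin> cube k" "n + - unit_vec i \<notin> cube k"
        unfolding cube_def mem_Collect_eq nth by auto
      then show ?thesis by (simp add: D u_def wave_packet_def)
    next
      case True
      have "n $ i \<notin> E"
      proof
        assume "n $ i \<in> E"
        then have "n $ j \<in> B j" for j using True by (simp add: B_def)
        then show False using n by (simp add: S_def)
      qed
      then consider "n $ i < int k \<or> n $ i > 2 * int k + 1" | "int k + 1 < n $ i" "n $ i < 2 * int k"
        by (force simp: E_def)
      then show ?thesis
      proof cases
        case 1
        then have "n $ i \<notin> {int k + 1..2 * int k}" "(n + unit_vec i) $ i \<notin> {int k + 1..2 * int k}"
          "(n + - unit_vec i) $ i \<notin> {int k + 1..2 * int k}"
          unfolding nth by auto
        then have "n \<notin> cube k" "n + unit_vec i \<notin> cube k" "n + - unit_vec i \<notin> cube k"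
          unfolding cube_def by blast+
        then show ?thesis by (simp add: D u_def wave_packet_def)
      next
        case 2
        have "n $ j + d \<in> {int k + 1..2 * int k}" if "j \<noteq> i \<longrightarrow> d = 0" "\<bar>d\<bar> \<le> 1" for j d
        proof (cases "j = i")
          case True
          then show ?thesis using 2 that(2) by auto
        next
          case False
          then show ?thesis using True that(1) by simp
        qed
        note shifted = this
        have "n \<in> cube k"
          using shifted[of _ 0] unfolding cube_def mem_Collect_eq by simp
        moreover have "n + unit_vec i \<in> cube k"
          unfolding cube_def mem_Collect_eq nth by (intro allI shifted) auto
        moreover have "n + - unit_vec i \<in> cube k"
          unfolding cube_def mem_Collect_eq nth diff_conv_add_uminus by (intro allI shifted) auto
        moreover have "cis (\<theta> * of_int (s + 1)) + cis (\<theta> * of_int (s - 1)) = 2 * cos \<theta> * cis (\<theta> * of_int s)"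
          for s :: int
          by (simp add: complex_eq_iff algebra_simps cos_add sin_add cos_diff sin_diff)
        ultimately show ?thesis
          by (simp only: D u_def wave_packet_def sums if_True diff_self)
      qed
    qed
  qed
  have "cmod (D n) \<le> 4" for n
  proof (cases "n = 0")
    case True
    then show ?thesis by (simp add: D_def u0 shift_def)
  next
    case False
    then have Dn: "D n = 2 * cos \<theta> * u n - (u (n + unit_vec i) + u (n + - unit_vec i))"
      by (simp add: D_def shift_def)
    have "cmod (D n) \<le> cmod (2 * cos \<theta> * u n) + (cmod (u (n + unit_vec i)) + cmod (u (n + - unit_vec i)))"
      unfolding Dn using norm_triangle_ineq4[of "2 * cos \<theta> * u n" "u (n + unit_vec i) + u (n + - unit_vec i)"]
        norm_triangle_ineq[of "u (n + unit_vec i)" "u (n + - unit_vec i)"] by linarith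
    also have "cmod (2 * cos \<theta> * u n) \<le> 2 * 1"
    proof -
      have "\<bar>cos \<theta>\<bar> * cmod (u n) \<le> 1 * 1" using u1[of n] by (intro mult_mono) auto
      then show ?thesis by (simp add: norm_mult)
    qed
    finally show ?thesis using u1[of "n + unit_vec i"] u1[of "n + - unit_vec i"] by linarith
  qed
  then have "(ell2_norm X0 D)\<^sup>2 \<le> 4\<^sup>2 * real (card S)"
    using off by (intro ell2_norm_finite_support_le finS S0) auto
  also have "\<dots> \<le> 4\<^sup>2 * real (4 * k ^ (CARD('n) - 1))"
    using cardS by (intro mult_left_mono of_nat_mono) auto
  finally show ?thesis by simp
qed

lemma wave_packet_potential:
  fixes k :: nat and \<theta> :: real
  defines "u \<equiv> (wave_packet \<theta> k :: int ^ 'n::finite \<Rightarrow> complex)"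
  assumes k: "k \<ge> 1"
  shows "ell2_norm X0 (inverse_square_op u) \<le> ell2_norm X0 u / real k"
proof -
  have le: "cmod (inverse_square_op u n) \<le> cmod (cscale (of_real (1 / real k)) u n)" for n
  proof (cases "n \<in> cube k")
    case False
    then show ?thesis by (simp add: inverse_square_op_def u_def wave_packet_def)
  next
    case True
    have "int k \<le> (n $ i)\<^sup>2" for i
    proof -
      have "n $ i \<in> {int k + 1..2 * int k}" using True unfolding cube_def by blast
      then have "int k * 1 \<le> n $ i * n $ i" using k by (intro mult_mono) auto
      then show ?thesis by (simp add: power2_eq_square)
    qed
    then have "int k \<le> lattice_sq n"
      using lattice_sq_remove[of n undefined] sum_nonneg[of "UNIV - {undefined}" "\<lambda>j. (n $ j)\<^sup>2"]
      by (metis add_increasing2 zero_le_power2)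
    then have k': "real k \<le> real_of_int (lattice_sq n)" by linarith
    have "cmod (u n) / real_of_int (lattice_sq n) \<le> cmod (u n) / real k"
      using k k' by (intro divide_left_mono) auto
    then show ?thesis
      using k k' by (auto simp: inverse_square_op_def norm_divide norm_mult lattice_norm_sq
          simp flip: of_real_power)
  qed
  have "cscale (of_real (1 / real k)) u \<in> ell2 X0"
    unfolding u_def by (intro ell2_cscale wave_packet_ell2)
  then have "ell2_norm X0 (inverse_square_op u) \<le> ell2_norm X0 (cscale (of_real (1 / real k)) u)"
    by (rule ell2_dominated(2)) (simp add: inverse_square_op_def, rule le)
  then show ?thesis by (simp add: norm_divide)
qed

text \<open>The volume of the cube exceeds that of its boundary layer by a factor of order \<open>k\<close>, and the
  potential is at most of order \<open>1 / k\<close> on the cube.\<close>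

lemma wave_packet_approx_eigenvector:
  fixes k :: nat and \<theta> :: real
  defines "u \<equiv> (wave_packet \<theta> k :: int ^ 'n::finite \<Rightarrow> complex)"
  assumes k: "k \<ge> 1" and \<mu>: "\<mu> = 2 * real CARD('n) * (1 - cos \<theta>)"
  shows "ell2_norm X0 (hardy_op u - cscale (of_real \<mu>) u)
    \<le> (8 * real CARD('n) / sqrt (real k) + hardy_const CARD('n) / real k) * ell2_norm X0 u"
proof -
  define D where "D i = cscale (2 * cos \<theta>) u - (shift (unit_vec i) u + shift (- unit_vec i) u)" for i
  define V where "V = cscale (of_real (hardy_const CARD('n))) (inverse_square_op u)"
  have u: "u \<in> ell2 X0" unfolding u_def by (rule wave_packet_ell2)
  have D: "D i \<in> ell2 X0" for i unfolding D_def using u by (intro ell2_diff ell2_add ell2_cscale shift_ell2)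
  have V: "V \<in> ell2 X0"
    unfolding V_def by (intro ell2_cscale bounded_op_closed[OF inverse_square_bounded] u)
  have sum_fun: "(\<Sum>i\<in>I. f i) n = (\<Sum>i\<in>I. f i n)" for I and f :: "'n \<Rightarrow> int ^ 'n \<Rightarrow> complex" and n
    by (induction I rule: infinite_finite_induct) auto
  have "(hardy_op u - cscale (of_real \<mu>) u) n = ((\<Sum>i\<in>UNIV. D i) - V) n" for n
    unfolding hardy_op_eq[OF u] V_def D_def \<mu>
    by (simp add: sum_fun sum_subtractf algebra_simps)
  then have eq: "hardy_op u - cscale (of_real \<mu>) u = (\<Sum>i\<in>UNIV. D i) - V" by (rule ext)
  define s where "s = sqrt (real k ^ (CARD('n) - 1))"
  have "s > 0" using k by (simp add: s_def)
  have "real k ^ CARD('n) = real k ^ (CARD('n) - 1) * real k"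
    using power_minus_mult[of "CARD('n)" "real k"] zero_less_card_finite[where 'a = 'n] by simp
  then have "(ell2_norm X0 u)\<^sup>2 = (s * sqrt (real k))\<^sup>2"
    unfolding u_def wave_packet_norm by (simp add: s_def power_mult_distrib)
  then have nu: "ell2_norm X0 u = s * sqrt (real k)"
    using \<open>s > 0\<close> by simp
  have "ell2_norm X0 (D i) \<le> 8 * s" for i
  proof (rule power2_le_imp_le)
    have "(ell2_norm X0 (D i))\<^sup>2 \<le> 64 * real k ^ (CARD('n) - 1)"
      unfolding D_def u_def by (rule wave_packet_boundary[OF k])
    then show "(ell2_norm X0 (D i))\<^sup>2 \<le> (8 * s)\<^sup>2" by (simp add: s_def power_mult_distrib)
  qed (use \<open>s > 0\<close> in simp)
  then have "(\<Sum>i\<in>UNIV. ell2_norm X0 (D i)) \<le> (\<Sum>i\<in>(UNIV :: 'n set). 8 * s)"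
    by (intro sum_mono)
  moreover have "ell2_norm X0 (\<Sum>i\<in>UNIV. D i) \<le> (\<Sum>i\<in>UNIV. ell2_norm X0 (D i))"
    by (intro ell2_norm_sum_le D)
  ultimately have 1: "ell2_norm X0 (\<Sum>i\<in>UNIV. D i) \<le> 8 * real CARD('n) / sqrt (real k) * ell2_norm X0 u"
    unfolding nu using k by (simp add: mult_ac)
  have "hardy_const CARD('n) \<ge> 0" by (simp add: hardy_const_def)
  then have 2: "ell2_norm X0 V \<le> hardy_const CARD('n) / real k * ell2_norm X0 u"
    using mult_left_mono[OF wave_packet_potential[OF k, of \<theta>], of "hardy_const CARD('n)"]
    unfolding V_def u_def by simp
  have "ell2_norm X0 ((\<Sum>i\<in>UNIV. D i) - V) \<le> ell2_norm X0 (\<Sum>i\<in>UNIV. D i) + ell2_norm X0 V"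
    by (intro ell2_norm_diff_le ell2_sum D V)
  then show ?thesis
    unfolding eq distrib_right using 1 2 by linarith
qed

lemma band_subset_spectrum:
  assumes \<mu>: "0 \<le> \<mu>" "\<mu> \<le> 4 * real CARD('n::finite)"
  shows "of_real \<mu> \<in> spectrum X0 (hardy_op :: (int ^ 'n \<Rightarrow> complex) \<Rightarrow> _)"
proof -
  let ?H = "hardy_op :: (int ^ 'n \<Rightarrow> complex) \<Rightarrow> _"
  define N where "N = real CARD('n)"
  define A where "A = hardy_const CARD('n)"
  have "N \<ge> 1" unfolding N_def using zero_less_card_finite[where 'a = 'n] by linarith
  have "A \<ge> 0" by (simp add: A_def hardy_const_def)
  define \<theta> where "\<theta> = arccos (1 - \<mu> / (2 * N))"
  have "- 1 \<le> 1 - \<mu> / (2 * N)" "1 - \<mu> / (2 * N) \<le> 1"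
    using \<mu> \<open>N \<ge> 1\<close> unfolding N_def[symmetric] by (auto simp: field_simps)
  then have "cos \<theta> = 1 - \<mu> / (2 * N)" by (simp add: \<theta>_def cos_arccos)
  then have \<mu>\<theta>: "\<mu> = 2 * real CARD('n) * (1 - cos \<theta>)"
    using \<open>N \<ge> 1\<close> unfolding N_def[symmetric] by simp
  have "of_real \<mu> \<notin> resolvent_set X0 ?H"
  proof
    assume "of_real \<mu> \<in> resolvent_set X0 ?H"
    then obtain c where c: "c > 0"
      "\<And>u. u \<in> ell2 X0 \<Longrightarrow> c * ell2_norm X0 u \<le> ell2_norm X0 (?H u - cscale (of_real \<mu>) u)"
      unfolding selfadjoint_resolvent_iff[OF hardy_op_bounded hardy_op_selfadjoint] by blast
    have le: "c \<le> 8 * N / sqrt (real k) + A / real k" if k: "k \<ge> 1" for k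
    proof -
      let ?u = "wave_packet \<theta> k :: int ^ 'n \<Rightarrow> complex"
      have "(ell2_norm X0 ?u)\<^sup>2 > 0" unfolding wave_packet_norm using k by simp
      then have pos: "ell2_norm X0 ?u > 0"
        using ell2_norm_nonneg[of X0 ?u] by (metis less_eq_real_def power2_eq_square mult_zero_left less_irrefl)
      have "c * ell2_norm X0 ?u \<le> (8 * N / sqrt (real k) + A / real k) * ell2_norm X0 ?u"
        using c(2)[OF wave_packet_ell2] wave_packet_approx_eigenvector[OF k \<mu>\<theta>]
        unfolding N_def A_def by (rule order_trans)
      then show ?thesis using pos by (simp only: mult_le_cancel_right_pos)
    qed
    have "(\<lambda>k. 8 * N * inverse (sqrt (real k)) + A * inverse (real k)) \<longlonglongrightarrow> 8 * N * 0 + A * 0"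
      by (intro tendsto_intros tendsto_inverse_0_at_top filterlim_compose[OF sqrt_at_top]
          filterlim_real_sequentially)
    then have lim: "(\<lambda>k. 8 * N / sqrt (real k) + A / real k) \<longlonglongrightarrow> 0"
      by (simp add: divide_inverse)
    have "c \<le> 0"
      by (rule LIMSEQ_le_const[OF lim]) (use le in blast)
    then show False using c(1) by simp
  qed
  then show ?thesis by (simp add: spectrum_def)
qed

text \<open>The band has no isolated points, so none of its points is in the discrete spectrum.\<close>

theorem hardy_essential_spectrum:
  "essential_spectrum X0 (hardy_op :: (int ^ 'n::finite \<Rightarrow> complex) \<Rightarrow> _)
    = complex_of_real ` {0..4 * real CARD('n)}"
proof
  let ?H = "hardy_op :: (int ^ 'n \<Rightarrow> complex) \<Rightarrow> _"
  let ?I = "complex_of_real ` {0..4 * real CARD('n)}"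
  show "essential_spectrum X0 ?H \<subseteq> ?I"
    using hardy_spectrum_subset[where 'n = 'n] by (auto simp: essential_spectrum_def)
  have sub: "?I \<subseteq> spectrum X0 ?H" using band_subset_spectrum by auto
  have "connected ?I"
    by (intro connected_continuous_image continuous_intros connected_Icc)
  moreover have "?I \<noteq> {x}" for x
  proof -
    have "1 \<le> real CARD('n)" using zero_less_card_finite[where 'a = 'n] by linarith
    then have "complex_of_real 1 \<in> ?I" by (intro imageI) (simp only: atLeastAtMost_iff, linarith)
    moreover have "complex_of_real 0 \<in> ?I" by (intro imageI) simp
    ultimately show ?thesis by (metis of_real_eq_iff singletonD zero_neq_one)
  qed
  ultimately have "z islimpt ?I" if "z \<in> ?I" for z
    using that by (intro connected_imp_perfect)
  then have "\<not> z isolated_in spectrum X0 ?H" if "z \<in> ?I" for z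
    using that sub islimpt_subset by (metis isolated_in_islimpt_iff)
  then show "?I \<subseteq> essential_spectrum X0 ?H"
    using sub by (auto simp: essential_spectrum_def discrete_spectrum_def)
qed

section \<open>The Hardy inequality in dimensions three and four\<close>

lemma lattice_shift_sum:
  fixes f :: "int ^ 'n::finite \<Rightarrow> 'b::{comm_monoid_add, t2_space}"
  shows "(\<Sum>\<^sub>\<infinity>n. f (n + a)) = (\<Sum>\<^sub>\<infinity>n. f n)" "(\<lambda>n. f (n + a)) summable_on UNIV \<longleftrightarrow> f summable_on UNIV"
  using infsum_reindex_bij_betw[OF bij_plus_lattice, of f a]
    summable_on_reindex_bij_betw[OF bij_plus_lattice, of f a] by simp_all

text \<open>The inequality \<open>2 Re (x * cnj y) \<le> s \<bar>y\<bar>\<^sup>2 + \<bar>x\<bar>\<^sup>2 / s\<close> with \<open>s = w m / w n\<close> on each bond between \<open>m\<close>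
  and \<open>n\<close> bounds the hopping term by a diagonal one, which the supersolution property of \<open>w\<close> controls.\<close>

lemma supersolution_imp_hardy_nonneg:
  fixes u :: "int ^ 'n::finite \<Rightarrow> complex" and w :: "int ^ 'n \<Rightarrow> real"
  assumes w: "w 0 = 0" "\<And>n. n \<noteq> 0 \<Longrightarrow> w n > 0"
    and super: "\<And>n. n \<noteq> 0 \<Longrightarrow> (\<Sum>i\<in>UNIV. w (n + unit_vec i) + w (n - unit_vec i))
      \<le> (2 * real CARD('n) - hardy_const CARD('n) / real_of_int (lattice_sq n)) * w n"
    and u: "u \<in> ell2 X0"
  shows "0 \<le> Re (ell2_inner X0 (hardy_op u) u)"
proof -
  have u0: "u 0 = 0" using ell2_outside[OF u] by simp
  have w_nonneg: "w n \<ge> 0" for n using w by (cases "n = 0") (auto intro: less_imp_le)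
  have A: "hardy_const CARD('n) \<ge> 0" by (simp add: hardy_const_def)
  define p where "p i n = w (n + unit_vec i) / w n" for i n
  define q where "q i n = w (n - unit_vec i) / w n" for i n
  have pq_nonneg: "p i n \<ge> 0" "q i n \<ge> 0" for i n by (auto simp: p_def q_def w_nonneg)
  have pq_sum: "(\<Sum>i\<in>UNIV. p i n + q i n) \<le> 2 * real CARD('n) - hardy_const CARD('n) / real_of_int (lattice_sq n)"
    if "n \<noteq> 0" for n
    using super[OF that] w(2)[OF that]
    by (simp add: p_def q_def pos_divide_le_eq flip: add_divide_distrib sum_divide_distrib)
  \<comment> \<open>the ratios of neighbouring weights are bounded, so all sums below converge\<close>
  have pq_le: "p i n \<le> 2 * real CARD('n)" "q i n \<le> 2 * real CARD('n)" if "n \<noteq> 0" for i n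
  proof -
    have "p i n + q i n \<le> (\<Sum>i\<in>UNIV. p i n + q i n)"
      by (rule member_le_sum) (auto simp: pq_nonneg)
    also note pq_sum[OF that]
    also have "2 * real CARD('n) - hardy_const CARD('n) / real_of_int (lattice_sq n) \<le> 2 * real CARD('n)"
      using A by (simp add: zero_le_divide_iff)
    finally show "p i n \<le> 2 * real CARD('n)" "q i n \<le> 2 * real CARD('n)"
      using pq_nonneg[of i n] by auto
  qed
  have sq: "(\<lambda>n. (cmod (u n))\<^sup>2) summable_on UNIV"
    using ell2_summable[OF u] u0 by (subst (asm) summable_on_cong_neutral[of UNIV]) auto
  have psum: "(\<lambda>n. p i n * (cmod (u n))\<^sup>2) summable_on UNIV"
    and qsum: "(\<lambda>n. q i n * (cmod (u n))\<^sup>2) summable_on UNIV" for i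
  proof -
    have le: "p i n * (cmod (u n))\<^sup>2 \<le> 2 * real CARD('n) * (cmod (u n))\<^sup>2"
      "q i n * (cmod (u n))\<^sup>2 \<le> 2 * real CARD('n) * (cmod (u n))\<^sup>2" for n
      using pq_le[of n i] u0 by (cases "n = 0"; simp add: mult_right_mono)+
    show "(\<lambda>n. p i n * (cmod (u n))\<^sup>2) summable_on UNIV"
      "(\<lambda>n. q i n * (cmod (u n))\<^sup>2) summable_on UNIV"
      using le by (auto intro!: summable_on_comparison_test[OF summable_on_cmult_right[OF sq]]
          simp: pq_nonneg)
  qed
  have hop: "2 * Re (ell2_inner X0 (shift (unit_vec i) u) u)
    \<le> (\<Sum>\<^sub>\<infinity>n. (p i n + q i n) * (cmod (u n))\<^sup>2)" for i
  proof -
    define e where "e = (unit_vec i :: int ^ 'n)"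
    have pt: "2 * Re (u (n + e) * cnj (u n)) \<le> p i n * (cmod (u n))\<^sup>2 + q i (n + e) * (cmod (u (n + e)))\<^sup>2" for n
    proof (cases "n = 0 \<or> n + e = 0")
      case True
      then show ?thesis using u0 by (auto simp: pq_nonneg)
    next
      case False
      define s where "s = w (n + e) / w n"
      have s: "s > 0" using False w(2) by (simp add: s_def)
      have "2 * Re (u (n + e) * cnj (u n)) \<le> 2 * (cmod (u (n + e)) * cmod (u n))"
        using complex_Re_le_cmod[of "u (n + e) * cnj (u n)"] by (simp add: norm_mult)
      also have "\<dots> \<le> s * (cmod (u n))\<^sup>2 + (cmod (u (n + e)))\<^sup>2 / s"
      proof -
        have "0 \<le> (s * cmod (u n) - cmod (u (n + e)))\<^sup>2 / s" using s by simp
        also have "\<dots> = s * (cmod (u n))\<^sup>2 + (cmod (u (n + e)))\<^sup>2 / s - 2 * (cmod (u (n + e)) * cmod (u n))"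
          using s by (simp add: field_simps power2_eq_square)
        finally show ?thesis by simp
      qed
      also have "\<dots> = p i n * (cmod (u n))\<^sup>2 + q i (n + e) * (cmod (u (n + e)))\<^sup>2"
        by (simp add: s_def p_def q_def e_def)
      finally show ?thesis .
    qed
    have "shift e u \<in> ell2 X0" using u by (rule shift_ell2)
    have inner_sum: "(\<lambda>n. u (n + e) * cnj (u n)) summable_on UNIV"
    proof -
      have "(\<lambda>n. shift e u n * cnj (u n)) summable_on X0"
        using ell2_inner_summable(2)[OF \<open>shift e u \<in> ell2 X0\<close> u] .
      also have "?this \<longleftrightarrow> (\<lambda>n. u (n + e) * cnj (u n)) summable_on UNIV"
        using u0 by (intro summable_on_cong_neutral) (auto simp: shift_def)
      finally show ?thesis .
    qed
    have qs: "(\<lambda>n. q i (n + e) * (cmod (u (n + e)))\<^sup>2) summable_on UNIV"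
      using qsum[of i] lattice_shift_sum(2)[of "\<lambda>n. q i n * (cmod (u n))\<^sup>2" e] by simp
    have "2 * Re (ell2_inner X0 (shift e u) u) = (\<Sum>\<^sub>\<infinity>n. 2 * Re (u (n + e) * cnj (u n)))"
      unfolding ell2_inner_shift_eq[OF u] infsum_cmult_right' infsum_Re[OF inner_sum] ..
    also have "\<dots> \<le> (\<Sum>\<^sub>\<infinity>n. p i n * (cmod (u n))\<^sup>2 + q i (n + e) * (cmod (u (n + e)))\<^sup>2)"
      by (intro infsum_mono summable_on_cmult_right summable_on_Re inner_sum summable_on_add psum qs pt)
    also have "\<dots> = (\<Sum>\<^sub>\<infinity>n. p i n * (cmod (u n))\<^sup>2) + (\<Sum>\<^sub>\<infinity>n. q i (n + e) * (cmod (u (n + e)))\<^sup>2)"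
      by (intro infsum_add psum qs)
    also have "(\<Sum>\<^sub>\<infinity>n. q i (n + e) * (cmod (u (n + e)))\<^sup>2) = (\<Sum>\<^sub>\<infinity>n. q i n * (cmod (u n))\<^sup>2)"
      by (rule lattice_shift_sum(1))
    also have "(\<Sum>\<^sub>\<infinity>n. p i n * (cmod (u n))\<^sup>2) + (\<Sum>\<^sub>\<infinity>n. q i n * (cmod (u n))\<^sup>2)
      = (\<Sum>\<^sub>\<infinity>n. (p i n + q i n) * (cmod (u n))\<^sup>2)"
      unfolding distrib_right by (intro infsum_add[symmetric] psum qsum)
    finally show ?thesis unfolding e_def .
  qed
  have fsum: "(\<lambda>n. (p i n + q i n) * (cmod (u n))\<^sup>2) summable_on UNIV" for i
    unfolding distrib_right by (intro summable_on_add psum qsum)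
  have "(\<Sum>i\<in>UNIV. 2 * Re (ell2_inner X0 (shift (unit_vec i) u) u))
    \<le> (\<Sum>i\<in>UNIV. \<Sum>\<^sub>\<infinity>n. (p i n + q i n) * (cmod (u n))\<^sup>2)"
    by (intro sum_mono hop)
  also have "\<dots> = (\<Sum>\<^sub>\<infinity>n. \<Sum>i\<in>UNIV. (p i n + q i n) * (cmod (u n))\<^sup>2)"
  proof -
    have "((\<lambda>n. \<Sum>i\<in>I. (p i n + q i n) * (cmod (u n))\<^sup>2) has_sum
      (\<Sum>i\<in>I. \<Sum>\<^sub>\<infinity>n. (p i n + q i n) * (cmod (u n))\<^sup>2)) UNIV" if "finite I" for I
      using that by (induction I rule: finite_induct) (auto intro!: has_sum_add has_sum_infsum fsum)
    then show ?thesis by (intro infsumI[symmetric]) simp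
  qed
  also have "\<dots> = (\<Sum>\<^sub>\<infinity>n\<in>X0. (\<Sum>i\<in>UNIV. p i n + q i n) * (cmod (u n))\<^sup>2)"
    using u0 by (intro infsum_cong_neutral) (auto simp: sum_distrib_right)
  also have "\<dots> \<le> (\<Sum>\<^sub>\<infinity>n\<in>X0. 2 * real CARD('n) * (cmod (u n))\<^sup>2 -
      hardy_const CARD('n) * ((cmod (u n))\<^sup>2 / real_of_int (lattice_sq n)))"
  proof (rule infsum_mono)
    have le: "(\<Sum>i\<in>UNIV. p i n + q i n) * (cmod (u n))\<^sup>2
      \<le> (2 * real CARD('n) - hardy_const CARD('n) / real_of_int (lattice_sq n)) * (cmod (u n))\<^sup>2"
      if "n \<in> X0" for n
      using that by (intro mult_right_mono pq_sum) auto
    then show "(\<Sum>i\<in>UNIV. p i n + q i n) * (cmod (u n))\<^sup>2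
      \<le> 2 * real CARD('n) * (cmod (u n))\<^sup>2 - hardy_const CARD('n) * ((cmod (u n))\<^sup>2 / real_of_int (lattice_sq n))"
      if "n \<in> X0" for n using that by (simp add: left_diff_distrib)
    show "(\<lambda>n. 2 * real CARD('n) * (cmod (u n))\<^sup>2 - hardy_const CARD('n) * ((cmod (u n))\<^sup>2 / real_of_int (lattice_sq n)))
      summable_on X0"
      using summable_on_add[OF summable_on_cmult_right[OF ell2_summable[OF u], of "2 * real CARD('n)"]
          summable_on_cmult_right[OF hardy_weight_summable[OF u], of "- hardy_const CARD('n)"]]
      by simp
    show "(\<lambda>n. (\<Sum>i\<in>UNIV. p i n + q i n) * (cmod (u n))\<^sup>2) summable_on X0"
    proof (rule summable_on_comparison_test[OF summable_on_cmult_right[OF ell2_summable[OF u], of "2 * real CARD('n)"]])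
      fix n :: "int ^ 'n" assume n: "n \<in> X0"
      have "2 * real CARD('n) - hardy_const CARD('n) / real_of_int (lattice_sq n) \<le> 2 * real CARD('n)"
        using A by (simp add: zero_le_divide_iff)
      then show "(\<Sum>i\<in>UNIV. p i n + q i n) * (cmod (u n))\<^sup>2 \<le> 2 * real CARD('n) * (cmod (u n))\<^sup>2"
        using pq_sum[of n] n by (intro mult_right_mono) auto
    qed (auto intro!: mult_nonneg_nonneg sum_nonneg pq_nonneg add_nonneg_nonneg)
  qed
  also have "\<dots> = 2 * real CARD('n) * (ell2_norm X0 u)\<^sup>2 -
      hardy_const CARD('n) * (\<Sum>\<^sub>\<infinity>n\<in>X0. (cmod (u n))\<^sup>2 / real_of_int (lattice_sq n))"
    using infsum_add[OF summable_on_cmult_right[OF ell2_summable[OF u], of "2 * real CARD('n)"]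
        summable_on_cmult_right[OF hardy_weight_summable[OF u], of "- hardy_const CARD('n)"]]
    unfolding ell2_norm_sq infsum_cmult_right' by simp
  finally show ?thesis unfolding hardy_form[OF u] by linarith
qed

lemma sum_power2_le_power2_sum:
  fixes x :: "'a \<Rightarrow> real"
  assumes "finite I" "\<And>i. i \<in> I \<Longrightarrow> x i \<ge> 0"
  shows "(\<Sum>i\<in>I. (x i)\<^sup>2) \<le> (\<Sum>i\<in>I. x i)\<^sup>2" "(\<Sum>i\<in>I. x i ^ 3) \<le> (\<Sum>i\<in>I. x i) ^ 3"
proof -
  define X where "X = (\<Sum>i\<in>I. x i)"
  have X: "0 \<le> X" "\<And>i. i \<in> I \<Longrightarrow> x i \<le> X"
    using assms by (auto simp: X_def intro!: sum_nonneg member_le_sum)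
  have "(\<Sum>i\<in>I. (x i)\<^sup>2) \<le> (\<Sum>i\<in>I. x i * X)"
    using assms X by (intro sum_mono) (simp add: power2_eq_square mult_left_mono)
  then show "(\<Sum>i\<in>I. (x i)\<^sup>2) \<le> (\<Sum>i\<in>I. x i)\<^sup>2"
    by (simp add: X_def power2_eq_square sum_distrib_right)
  have "(\<Sum>i\<in>I. x i ^ 3) \<le> (\<Sum>i\<in>I. x i * X\<^sup>2)"
  proof (rule sum_mono)
    fix i assume "i \<in> I"
    then have "(x i)\<^sup>2 \<le> X\<^sup>2" using assms X by (intro power_mono) auto
    then show "x i ^ 3 \<le> x i * X\<^sup>2"
      using assms(2)[OF \<open>i \<in> I\<close>] by (simp add: power3_eq_cube power2_eq_square mult.assoc mult_left_mono)
  qed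
  then show "(\<Sum>i\<in>I. x i ^ 3) \<le> (\<Sum>i\<in>I. x i) ^ 3"
    by (simp add: X_def power3_eq_cube power2_eq_square mult.assoc flip: sum_distrib_right)
qed

text \<open>The continuous problem has the critical weight \<open>\<bar>n\<bar>\<close> to the power \<open>2 b\<close>, where \<open>b = - (N - 2) / 4\<close>.
  On the lattice it fails along the axes because of the fourth-order term of the difference operator.
  Adding a constant to \<open>\<bar>n\<bar>\<^sup>2\<close> compensates this.  In dimension four the constant must be at least
  \<open>17 / 8\<close> for points far out on the axes, while \<open>4\<close> is already too large for points with \<open>\<bar>n\<bar>\<^sup>2 = 2\<close>.\<close>

definition power_weight :: "real \<Rightarrow> int ^ 'n \<Rightarrow> real" where
  "power_weight b n = (if n = 0 then 0 else (real_of_int (lattice_sq n) + 3) powr b)"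

text \<open>With \<open>\<rho> = \<bar>n\<bar>\<^sup>2\<close>, \<open>T = \<rho> + 4\<close> and \<open>z\<^sub>i = 2 n\<^sub>i / T\<close> the values of the weight at \<open>n \<plusminus> unit_vec i\<close> are
  \<open>T\<^sup>b (1 \<plusminus> z\<^sub>i)\<^sup>b\<close>, so the even part of the binomial series in \<open>z\<^sub>i\<close> and \<open>\<Sum> z\<^sub>i\<^sup>2 = 4 \<rho> / T\<^sup>2\<close> reduce
  the supersolution property to an inequality in the single variable \<open>\<rho>\<close>.  That inequality fails
  for \<open>\<rho> = 1\<close> in dimension four, but at these points one of the neighbours is the origin, whose
  weight is \<open>0\<close>.\<close>

lemma power_weight_supersolution:
  fixes n :: "int ^ 'n::finite" and b \<alpha> \<beta> \<gamma> A :: real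
  assumes n: "n \<noteq> 0" and b: "b < 0" and A: "A \<le> 1" and coeffs: "\<alpha> \<ge> 0" "\<beta> \<ge> 0" "\<gamma> \<ge> 0"
    and binomial: "\<And>z. \<bar>z\<bar> \<le> 1 / 2 \<Longrightarrow>
      (1 + z) powr b + (1 - z) powr b \<le> 2 + \<alpha> * z\<^sup>2 + \<beta> * (z\<^sup>2)\<^sup>2 + \<gamma> * (z\<^sup>2) ^ 3"
    and radial: "\<And>\<rho> Z. \<rho> \<ge> 2 \<Longrightarrow> Z = 4 * \<rho> / (\<rho> + 4)\<^sup>2 \<Longrightarrow>
      (\<rho> + 4) powr b * (2 * real CARD('n) + \<alpha> * Z + \<beta> * Z\<^sup>2 + \<gamma> * Z ^ 3)
        \<le> (2 * real CARD('n) - A / \<rho>) * (\<rho> + 3) powr b"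
  shows "(\<Sum>i\<in>UNIV. power_weight b (n + unit_vec i) + power_weight b (n - unit_vec i))
    \<le> (2 * real CARD('n) - A / real_of_int (lattice_sq n)) * power_weight b n"
proof (cases "lattice_sq n = 1")
  case True
  have le: "power_weight b m \<le> 4 powr b" for m :: "int ^ 'n"
  proof (cases "m = 0")
    case False
    then have "4 \<le> real_of_int (lattice_sq m) + 3" using lattice_sq_pos[of m] by simp
    then show ?thesis using False b by (simp add: power_weight_def powr_mono2')
  qed (simp add: power_weight_def)
  obtain j where "n = unit_vec j \<or> n = - unit_vec j"
    using True unfolding lattice_sq_eq_1_iff by blast
  then have j: "n + unit_vec j = 0 \<or> n - unit_vec j = 0" by auto
  have "(\<Sum>i\<in>UNIV. power_weight b (n + unit_vec i) + power_weight b (n - unit_vec i))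
    \<le> (\<Sum>i\<in>UNIV. 2 * 4 powr b - (if i = j then 4 powr b else 0))"
  proof (rule sum_mono)
    fix i
    show "power_weight b (n + unit_vec i) + power_weight b (n - unit_vec i)
      \<le> 2 * 4 powr b - (if i = j then 4 powr b else 0)"
      using le[of "n + unit_vec i"] le[of "n - unit_vec i"] j
      by (auto simp: power_weight_def[of b 0])
  qed
  also have "\<dots> = (2 * real CARD('n) - 1) * 4 powr b"
    by (simp add: sum_subtractf algebra_simps)
  also have "\<dots> \<le> (2 * real CARD('n) - A) * 4 powr b"
    using A by (intro mult_right_mono) auto
  finally show ?thesis using True n by (simp add: power_weight_def)
next
  case False
  define \<rho> where "\<rho> = real_of_int (lattice_sq n)"
  have \<rho>: "\<rho> \<ge> 2" using False lattice_sq_pos[OF n] by (simp add: \<rho>_def)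
  define z where "z i = 2 * real_of_int (n $ i) / (\<rho> + 4)" for i
  have \<rho>_sum: "\<rho> = (\<Sum>i\<in>UNIV. (real_of_int (n $ i))\<^sup>2)"
    by (simp add: \<rho>_def lattice_sq_def)
  have z2: "(\<Sum>i\<in>UNIV. (z i)\<^sup>2) = 4 * \<rho> / (\<rho> + 4)\<^sup>2"
    unfolding z_def power_divide power_mult_distrib \<rho>_sum
    by (simp add: sum_distrib_left sum_divide_distrib)
  have z: "\<bar>z i\<bar> \<le> 1 / 2" for i
  proof -
    have "(z i)\<^sup>2 \<le> (\<Sum>i\<in>UNIV. (z i)\<^sup>2)" by (rule member_le_sum) auto
    also have "\<dots> \<le> (1 / 2)\<^sup>2"
    proof -
      have "0 \<le> (\<rho> - 4)\<^sup>2" by simp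
      then have "16 * \<rho> \<le> (\<rho> + 4)\<^sup>2" by (simp add: power2_eq_square algebra_simps)
      then show ?thesis unfolding z2 using \<rho> by (simp add: pos_divide_le_eq power2_eq_square)
    qed
    finally show ?thesis by (simp add: abs_le_square_iff[of "z i" "1 / 2", simplified])
  qed
  have nbr: "power_weight b m = (\<rho> + 4) powr b * (1 + s * z i) powr b"
    if "\<bar>s\<bar> = 1" and m: "m = n + axis i (if s > 0 then 1 else -1)" for m i and s :: real
  proof -
    have s: "s = 1 \<or> s = -1" using that(1) by linarith
    have "real_of_int (lattice_sq m) = \<rho> + 2 * s * n $ i + 1"
      using s unfolding m lattice_sq_add_unit \<rho>_def by auto
    then have eq: "real_of_int (lattice_sq m) + 3 = (\<rho> + 4) * (1 + s * z i)"
      using \<rho> by (simp add: z_def field_simps)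
    have "m \<noteq> 0"
    proof
      assume "m = 0"
      then have "n = - axis i (if s > 0 then 1 else -1)" using m by (simp add: eq_neg_iff_add_eq_0)
      then have "lattice_sq n = 1" using lattice_sq_eq_1_iff[of n] s by (auto simp: vec_eq_iff axis_def)
      then show False using False by simp
    qed
    moreover have "1 + s * z i \<ge> 0" using z[of i] s by auto
    ultimately show ?thesis using \<rho> by (simp add: power_weight_def eq powr_mult)
  qed
  define Z where "Z = (\<Sum>i\<in>UNIV. (z i)\<^sup>2)"
  have "(\<Sum>i\<in>UNIV. power_weight b (n + unit_vec i) + power_weight b (n - unit_vec i))
    = (\<Sum>i\<in>UNIV. (\<rho> + 4) powr b * ((1 + z i) powr b + (1 - z i) powr b))"
  proof (rule sum.cong)
    fix i :: 'n
    have "n - unit_vec i = n + axis i (- 1)" by (simp add: vec_eq_iff axis_def)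
    then show "power_weight b (n + unit_vec i) + power_weight b (n - unit_vec i)
      = (\<rho> + 4) powr b * ((1 + z i) powr b + (1 - z i) powr b)"
      using nbr[of 1 "n + unit_vec i" i] nbr[of "-1" "n - unit_vec i" i] by (simp add: distrib_left)
  qed simp
  also have "\<dots> \<le> (\<Sum>i\<in>UNIV. (\<rho> + 4) powr b * (2 + \<alpha> * (z i)\<^sup>2 + \<beta> * ((z i)\<^sup>2)\<^sup>2 + \<gamma> * ((z i)\<^sup>2) ^ 3))"
    by (intro sum_mono mult_left_mono binomial z) auto
  also have "\<dots> = (\<rho> + 4) powr b * (2 * real CARD('n) + \<alpha> * Z + \<beta> * (\<Sum>i\<in>UNIV. ((z i)\<^sup>2)\<^sup>2) + \<gamma> * (\<Sum>i\<in>UNIV. ((z i)\<^sup>2) ^ 3))"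
    by (simp add: sum.distrib Z_def flip: sum_distrib_left)
  also have "\<dots> \<le> (\<rho> + 4) powr b * (2 * real CARD('n) + \<alpha> * Z + \<beta> * Z\<^sup>2 + \<gamma> * Z ^ 3)"
    using sum_power2_le_power2_sum[of UNIV "\<lambda>i. (z i)\<^sup>2"] coeffs unfolding Z_def
    by (intro mult_left_mono add_mono order_refl) auto
  also have "\<dots> \<le> (2 * real CARD('n) - A / \<rho>) * (\<rho> + 3) powr b"
    by (rule radial[OF \<rho>]) (simp add: Z_def z2)
  finally show ?thesis using n by (simp add: power_weight_def \<rho>_def)
qed

lemma powr_half_square: "x > 0 \<Longrightarrow> (x powr (a / 2))\<^sup>2 = x powr a" for x :: real
  by (simp add: power2_eq_square flip: powr_add)

text \<open>The Taylor polynomial of degree three, with its last coefficient raised from \<open>5 / 16\<close> so that it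
  absorbs the remainder on \<open>[0, 1 / 4]\<close>.\<close>

lemma inverse_sqrt_le:
  fixes y :: real
  assumes y: "0 \<le> y" "y \<le> 1 / 4"
  shows "(1 - y) powr (-1/2) \<le> 1 + y / 2 + 3 / 8 * y\<^sup>2 + 41 / 100 * y ^ 3"
proof (rule power2_le_imp_le)
  define r where "r = 1 + y / 2 + 3 / 8 * y\<^sup>2 + 41 / 100 * y ^ 3"
  have yk: "y\<^sup>2 \<le> (1/4)\<^sup>2" "y ^ 3 \<le> (1/4) ^ 3" "y ^ 4 \<le> (1/4) ^ 4"
    using y by (intro power_mono; simp)+
  have "r\<^sup>2 * (1 - y) - 1 = y ^ 3 * (39/200 - 1031/1600 * y - 389/1600 * y\<^sup>2 - 697/5000 * y ^ 3 - 1681/10000 * y ^ 4)"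
    unfolding r_def by (simp add: field_simps power2_eq_square power3_eq_cube power4_eq_xxxx)
  also have "\<dots> \<ge> 0"
    using y yk by (intro mult_nonneg_nonneg) (auto simp: power2_eq_square power3_eq_cube power4_eq_xxxx)
  finally have "1 \<le> r\<^sup>2 * (1 - y)" by simp
  moreover have "((1 - y) powr (-1/2))\<^sup>2 = 1 / (1 - y)"
    using powr_half_square[of "1 - y" "-1"] y by (simp add: powr_minus_divide)
  ultimately show "((1 - y) powr (-1/2))\<^sup>2 \<le> r\<^sup>2"
    using y by (simp add: pos_divide_le_eq)
  show "0 \<le> r" using y by (simp add: r_def)
qed

text \<open>With \<open>y = z\<^sup>2\<close>, the square of the left-hand side is \<open>2 / (1 - y) + 2 / sqrt (1 - y)\<close>.  The
  right-hand side is the truncation of twice the even part of the binomial series, with the coefficient of \<open>z\<close> to the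
  power \<open>6\<close> raised to absorb the remainder.\<close>

lemma binomial_even_half:
  fixes z :: real
  assumes z: "\<bar>z\<bar> \<le> 1 / 2"
  shows "(1 + z) powr (-1/2) + (1 - z) powr (-1/2) \<le> 2 + 3 / 4 * z\<^sup>2 + 35 / 64 * (z\<^sup>2)\<^sup>2 + 3 / 5 * (z\<^sup>2) ^ 3"
proof (rule power2_le_imp_le)
  define y where "y = z\<^sup>2"
  have "y \<le> (1/2)\<^sup>2" unfolding y_def using z by (metis abs_ge_zero power2_abs power_mono)
  then have y: "0 \<le> y" "y \<le> 1 / 4" by (auto simp: y_def power2_eq_square)
  define r where "r = 1 + y / 2 + 3 / 8 * y\<^sup>2 + 41 / 100 * y ^ 3"
  define q where "q = 2 + 3 / 4 * y + 35 / 64 * y\<^sup>2 + 3 / 5 * y ^ 3"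
  have pos: "1 + z > 0" "1 - z > 0" using z by auto
  have sq: "((1 + z) powr (-1/2))\<^sup>2 = 1 / (1 + z)" "((1 - z) powr (-1/2))\<^sup>2 = 1 / (1 - z)"
    using powr_half_square[of "1 + z" "-1"] powr_half_square[of "1 - z" "-1"] pos
    by (auto simp: powr_minus_divide)
  have prod: "(1 + z) powr (-1/2) * (1 - z) powr (-1/2) = (1 - y) powr (-1/2)"
    using pos by (simp add: y_def power2_eq_square algebra_simps flip: powr_mult)
  have "1 - y = (1 + z) * (1 - z)" by (simp add: y_def power2_eq_square algebra_simps)
  then have sum: "1 / (1 + z) + 1 / (1 - z) = 2 / (1 - y)"
    using pos by (simp add: add_frac_eq)
  have "((1 + z) powr (-1/2) + (1 - z) powr (-1/2))\<^sup>2 = 2 / (1 - y) + 2 * (1 - y) powr (-1/2)"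
    unfolding power2_sum sq using sum prod by simp
  also have "\<dots> \<le> 2 / (1 - y) + 2 * r"
    using inverse_sqrt_le[OF y] by (simp add: r_def)
  also have "\<dots> \<le> q\<^sup>2"
  proof -
    have yk: "y\<^sup>2 \<le> (1/4)\<^sup>2" "y ^ 3 \<le> (1/4) ^ 3" "y ^ 4 \<le> (1/4) ^ 4"
      using y by (intro power_mono; simp)+
    have "q\<^sup>2 * (1 - y) - (2 + 2 * r * (1 - y))
      = y ^ 3 * (1281/3200 - 123007/102400 * y - 11117/20480 * y\<^sup>2 - 237/800 * y ^ 3 - 9/25 * y ^ 4)"
      unfolding r_def q_def by (simp add: field_simps power2_eq_square power3_eq_cube power4_eq_xxxx)
    also have "\<dots> \<ge> 0"
      using y yk by (intro mult_nonneg_nonneg) (auto simp: power2_eq_square power3_eq_cube power4_eq_xxxx)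
    finally have "2 + 2 * r * (1 - y) \<le> q\<^sup>2 * (1 - y)" by simp
    then show ?thesis using y by (simp add: field_simps)
  qed
  finally show "((1 + z) powr (-1/2) + (1 - z) powr (-1/2))\<^sup>2
    \<le> (2 + 3 / 4 * z\<^sup>2 + 35 / 64 * (z\<^sup>2)\<^sup>2 + 3 / 5 * (z\<^sup>2) ^ 3)\<^sup>2" by (simp add: q_def y_def)
qed simp

text \<open>Squaring reduces the exponent \<open>- 1 / 4\<close> to \<open>- 1 / 2\<close>.\<close>

lemma binomial_even_quarter:
  fixes z :: real
  assumes z: "\<bar>z\<bar> \<le> 1 / 2"
  shows "(1 + z) powr (-1/4) + (1 - z) powr (-1/4) \<le> 2 + 5 / 16 * z\<^sup>2 + 1 / 4 * (z\<^sup>2)\<^sup>2 + 0 * (z\<^sup>2) ^ 3"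
proof (rule power2_le_imp_le)
  define y where "y = z\<^sup>2"
  have "y \<le> (1/2)\<^sup>2" unfolding y_def using z by (metis abs_ge_zero power2_abs power_mono)
  then have y: "0 \<le> y" "y \<le> 1 / 4" by (auto simp: y_def power2_eq_square)
  define q where "q = 2 + 5 / 16 * y + 1 / 4 * y\<^sup>2"
  have pos: "1 + z > 0" "1 - z > 0" "1 - y > 0" using z y by auto
  have yk: "y\<^sup>2 \<le> (1/4)\<^sup>2" "y ^ 3 \<le> (1/4) ^ 3" "y ^ 4 \<le> (1/4) ^ 4"
    using y by (intro power_mono; simp)+
  have quarter: "(1 - y) powr (-1/4) \<le> 1 + y / 4 + y\<^sup>2 / 5"
  proof (rule power2_le_imp_le)
    have "((1 - y) powr (-1/4))\<^sup>2 = (1 - y) powr (-1/2)"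
      using powr_half_square[OF pos(3), of "-1/2"] by simp
    also have "\<dots> \<le> 1 + y / 2 + 3 / 8 * y\<^sup>2 + 41 / 100 * y ^ 3" by (rule inverse_sqrt_le[OF y])
    also have "\<dots> \<le> (1 + y / 4 + y\<^sup>2 / 5)\<^sup>2"
    proof -
      have "(1 + y / 4 + y\<^sup>2 / 5)\<^sup>2 - (1 + y / 2 + 3 / 8 * y\<^sup>2 + 41 / 100 * y ^ 3)
        = y\<^sup>2 * (7/80 - 31/100 * y + 1/25 * y\<^sup>2)"
        by (simp add: field_simps power2_eq_square power3_eq_cube)
      also have "\<dots> \<ge> 0" using y by (intro mult_nonneg_nonneg add_nonneg_nonneg) auto
      finally show ?thesis by simp
    qed
    finally show "((1 - y) powr (-1/4))\<^sup>2 \<le> (1 + y / 4 + y\<^sup>2 / 5)\<^sup>2" .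
  qed (use y in simp)
  have prod: "(1 + z) powr (-1/4) * (1 - z) powr (-1/4) = (1 - y) powr (-1/4)"
    using pos by (simp add: y_def power2_eq_square algebra_simps flip: powr_mult)
  have "((1 + z) powr (-1/4) + (1 - z) powr (-1/4))\<^sup>2
    = (1 + z) powr (-1/2) + (1 - z) powr (-1/2) + 2 * (1 - y) powr (-1/4)"
    unfolding power2_sum using prod powr_half_square[OF pos(1), of "-1/2"] powr_half_square[OF pos(2), of "-1/2"]
    by simp
  also have "\<dots> \<le> (2 + 3 / 4 * y + 35 / 64 * y\<^sup>2 + 3 / 5 * y ^ 3) + 2 * (1 + y / 4 + y\<^sup>2 / 5)"
    using binomial_even_half[OF z, folded y_def] quarter by simp
  also have "\<dots> \<le> q\<^sup>2"
  proof -
    have "q\<^sup>2 - ((2 + 3 / 4 * y + 35 / 64 * y\<^sup>2 + 3 / 5 * y ^ 3) + 2 * (1 + y / 4 + y\<^sup>2 / 5))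
      = y\<^sup>2 * (193/1280 - 71/160 * y + 1/16 * y\<^sup>2)"
      unfolding q_def by (simp add: field_simps power2_eq_square power3_eq_cube)
    also have "\<dots> \<ge> 0" using y by (intro mult_nonneg_nonneg add_nonneg_nonneg) auto
    finally show ?thesis by simp
  qed
  finally show "((1 + z) powr (-1/4) + (1 - z) powr (-1/4))\<^sup>2
    \<le> (2 + 5 / 16 * z\<^sup>2 + 1 / 4 * (z\<^sup>2)\<^sup>2 + 0 * (z\<^sup>2) ^ 3)\<^sup>2" by (simp add: q_def y_def)
qed simp

text \<open>These are the upper Pade bounds \<open>(1 + x)\<^sup>b \<le> (1 + (1 + b) / 2 * x) / (1 + (1 - b) / 2 * x)\<close> at \<open>x = 1 / t\<close>.\<close>

lemma powr_Suc_le_half: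
  fixes t :: real
  assumes t: "t > 0"
  shows "(t + 1) powr (-1/2) * (t + 3 / 4) \<le> t powr (-1/2) * (t + 1 / 4)"
proof (rule power2_le_imp_le)
  have "((t + 1) powr (-1/2))\<^sup>2 = 1 / (t + 1)" "(t powr (-1/2))\<^sup>2 = 1 / t"
    using powr_half_square[of "t + 1" "-1"] powr_half_square[of t "-1"] t by (auto simp: powr_minus_divide)
  moreover have "(t + 3 / 4)\<^sup>2 / (t + 1) \<le> (t + 1 / 4)\<^sup>2 / t"
    using t by (simp add: divide_simps) (simp add: algebra_simps power2_eq_square)
  ultimately show "((t + 1) powr (-1/2) * (t + 3 / 4))\<^sup>2 \<le> (t powr (-1/2) * (t + 1 / 4))\<^sup>2"
    by (simp add: power_mult_distrib)
qed (use t in simp)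

lemma powr_Suc_le_quarter:
  fixes t :: real
  assumes t: "t > 0"
  shows "(t + 1) powr (-1/4) * (t + 5 / 8) \<le> t powr (-1/4) * (t + 3 / 8)"
proof (rule power2_le_imp_le)
  have "((t + 1) powr (-1/4))\<^sup>2 = (t + 1) powr (-1/2)" "(t powr (-1/4))\<^sup>2 = t powr (-1/2)"
    using powr_half_square[of "t + 1" "-1/2"] powr_half_square[of t "-1/2"] t by auto
  moreover have "(t + 1) powr (-1/2) * (t + 5 / 8)\<^sup>2 \<le> t powr (-1/2) * (t + 3 / 8)\<^sup>2"
  proof -
    have "(t + 3 / 4) * (t + 3 / 8)\<^sup>2 - (t + 1 / 4) * (t + 5 / 8)\<^sup>2 = 1 / 128"
      by (simp add: field_simps power2_eq_square)
    then have "(t + 1 / 4) * (t + 5 / 8)\<^sup>2 \<le> (t + 3 / 4) * (t + 3 / 8)\<^sup>2" by linarith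
    then have "t powr (-1/2) * (t + 1 / 4) * (t + 5 / 8)\<^sup>2 \<le> t powr (-1/2) * ((t + 3 / 4) * (t + 3 / 8)\<^sup>2)"
      by (simp add: mult.assoc mult_left_mono)
    moreover have "(t + 1) powr (-1/2) * (t + 3 / 4) * (t + 5 / 8)\<^sup>2 \<le> t powr (-1/2) * (t + 1 / 4) * (t + 5 / 8)\<^sup>2"
      by (intro mult_right_mono powr_Suc_le_half t) auto
    ultimately have "(t + 3 / 4) * ((t + 1) powr (-1/2) * (t + 5 / 8)\<^sup>2)
      \<le> (t + 3 / 4) * (t powr (-1/2) * (t + 3 / 8)\<^sup>2)" by (simp add: mult_ac)
    then show ?thesis using t by simp
  qed
  ultimately show "((t + 1) powr (-1/4) * (t + 5 / 8))\<^sup>2 \<le> (t powr (-1/4) * (t + 3 / 8))\<^sup>2"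
    by (simp add: power_mult_distrib)
qed (use t in simp)

text \<open>After the Pade bound with \<open>t = \<rho> + 3\<close> and multiplication by all denominators, the difference of both
  sides is a polynomial in \<open>x = \<rho> - 2\<close> with nonnegative coefficients.\<close>

lemma radial_inequality_dim4:
  fixes \<rho> Z :: real
  assumes \<rho>: "\<rho> \<ge> 2" and Z: "Z = 4 * \<rho> / (\<rho> + 4)\<^sup>2"
  shows "(\<rho> + 4) powr (-1/2) * (8 + 3 / 4 * Z + 35 / 64 * Z\<^sup>2 + 3 / 5 * Z ^ 3)
    \<le> (8 - 1 / \<rho>) * (\<rho> + 3) powr (-1/2)"
proof -
  define T where "T = \<rho> + 4"
  define L where "L = 8 + 3 / 4 * Z + 35 / 64 * Z\<^sup>2 + 3 / 5 * Z ^ 3"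
  define x where "x = \<rho> - 2"
  have x: "x \<ge> 0" "\<rho> = 2 + x" using \<rho> by (auto simp: x_def)
  have T: "T > 0" using \<rho> by (simp add: T_def)
  define P where "P = 8 * T ^ 6 + 3 * \<rho> * T ^ 4 + 35 / 4 * \<rho>\<^sup>2 * T\<^sup>2 + 192 / 5 * \<rho> ^ 3"
  have P: "P = T ^ 6 * L"
    using T unfolding P_def L_def Z T_def[symmetric]
    by (simp add: field_simps eval_nat_numeral)
  have "(8 * \<rho> - 1) * (\<rho> + 15 / 4) * T ^ 6 - P * (\<rho> + 13 / 4) * \<rho>
    = 34362/5 + 297357/5 * x + 208719/5 * x\<^sup>2 + 111971/10 * x ^ 3 + 53613/40 * x ^ 4
      + 5613/80 * x ^ 5 + 7/4 * x ^ 6"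
    unfolding P_def T_def x(2) by (simp add: field_simps eval_nat_numeral)
  moreover have "\<dots> \<ge> 0" using x(1) by (intro add_nonneg_nonneg mult_nonneg_nonneg) auto
  ultimately have "P * (\<rho> + 13 / 4) * \<rho> \<le> (8 * \<rho> - 1) * (\<rho> + 15 / 4) * T ^ 6" by linarith
  then have "T ^ 6 * (\<rho> * (L * (\<rho> + 13 / 4))) \<le> T ^ 6 * ((8 * \<rho> - 1) * (\<rho> + 15 / 4))"
    unfolding P by (simp only: mult_ac)
  then have "\<rho> * (L * (\<rho> + 13 / 4)) \<le> (8 * \<rho> - 1) * (\<rho> + 15 / 4)"
    using T by simp
  then have main: "L * (\<rho> + 13 / 4) \<le> (8 - 1 / \<rho>) * (\<rho> + 15 / 4)"
    using \<rho> by (simp add: field_simps)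
  have L: "L \<ge> 0" using \<rho> by (simp add: L_def Z)
  have step: "T powr (-1/2) * (\<rho> + 15 / 4) \<le> (\<rho> + 3) powr (-1/2) * (\<rho> + 13 / 4)"
    using powr_Suc_le_half[of "\<rho> + 3"] \<rho> by (simp add: T_def add.assoc)
  have "(T powr (-1/2) * L) * (\<rho> + 15 / 4) \<le> (\<rho> + 3) powr (-1/2) * (L * (\<rho> + 13 / 4))"
    using mult_right_mono[OF step L] by (simp add: mult_ac)
  also have "\<dots> \<le> (\<rho> + 3) powr (-1/2) * ((8 - 1 / \<rho>) * (\<rho> + 15 / 4))"
    by (intro mult_left_mono main) simp
  finally have "(T powr (-1/2) * L) * (\<rho> + 15 / 4)
    \<le> ((8 - 1 / \<rho>) * (\<rho> + 3) powr (-1/2)) * (\<rho> + 15 / 4)" by (simp only: mult_ac)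
  then show ?thesis using \<rho> by (simp only: L_def T_def mult_le_cancel_right)
qed

lemma radial_inequality_dim3:
  fixes \<rho> Z :: real
  assumes \<rho>: "\<rho> \<ge> 2" and Z: "Z = 4 * \<rho> / (\<rho> + 4)\<^sup>2"
  shows "(\<rho> + 4) powr (-1/4) * (6 + 5 / 16 * Z + 1 / 4 * Z\<^sup>2 + 0 * Z ^ 3)
    \<le> (6 - 1 / 4 / \<rho>) * (\<rho> + 3) powr (-1/4)"
proof -
  define T where "T = \<rho> + 4"
  define L where "L = 6 + 5 / 16 * Z + 1 / 4 * Z\<^sup>2"
  define x where "x = \<rho> - 2"
  have x: "x \<ge> 0" "\<rho> = 2 + x" using \<rho> by (auto simp: x_def)
  have T: "T > 0" using \<rho> by (simp add: T_def)
  define P where "P = 6 * T ^ 6 + 5 / 4 * \<rho> * T ^ 4 + 4 * \<rho>\<^sup>2 * T\<^sup>2"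
  have P: "P = T ^ 6 * L"
    using T unfolding P_def L_def Z T_def[symmetric]
    by (simp add: field_simps eval_nat_numeral)
  have "(6 * \<rho> - 1 / 4) * (\<rho> + 29 / 8) * T ^ 6 - P * (\<rho> + 27 / 8) * \<rho>
    = 33336 + 55644 * x + 30746 * x\<^sup>2 + 7858 * x ^ 3 + 1981/2 * x ^ 4 + 223/4 * x ^ 5 + 7/8 * x ^ 6"
    unfolding P_def T_def x(2) by (simp add: field_simps eval_nat_numeral)
  moreover have "\<dots> \<ge> 0" using x(1) by (intro add_nonneg_nonneg mult_nonneg_nonneg) auto
  ultimately have "P * (\<rho> + 27 / 8) * \<rho> \<le> (6 * \<rho> - 1 / 4) * (\<rho> + 29 / 8) * T ^ 6" by linarith
  then have "T ^ 6 * (\<rho> * (L * (\<rho> + 27 / 8))) \<le> T ^ 6 * ((6 * \<rho> - 1 / 4) * (\<rho> + 29 / 8))"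
    unfolding P by (simp only: mult_ac)
  then have "\<rho> * (L * (\<rho> + 27 / 8)) \<le> (6 * \<rho> - 1 / 4) * (\<rho> + 29 / 8)"
    using T by simp
  then have main: "L * (\<rho> + 27 / 8) \<le> (6 - 1 / 4 / \<rho>) * (\<rho> + 29 / 8)"
    using \<rho> by (simp add: field_simps)
  have L: "L \<ge> 0" using \<rho> by (simp add: L_def Z)
  have step: "T powr (-1/4) * (\<rho> + 29 / 8) \<le> (\<rho> + 3) powr (-1/4) * (\<rho> + 27 / 8)"
    using powr_Suc_le_quarter[of "\<rho> + 3"] \<rho> by (simp add: T_def add.assoc)
  have "(T powr (-1/4) * L) * (\<rho> + 29 / 8) \<le> (\<rho> + 3) powr (-1/4) * (L * (\<rho> + 27 / 8))"
    using mult_right_mono[OF step L] by (simp add: mult_ac)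
  also have "\<dots> \<le> (\<rho> + 3) powr (-1/4) * ((6 - 1 / 4 / \<rho>) * (\<rho> + 29 / 8))"
    by (intro mult_left_mono main) simp
  finally have "(T powr (-1/4) * L) * (\<rho> + 29 / 8)
    \<le> ((6 - 1 / 4 / \<rho>) * (\<rho> + 3) powr (-1/4)) * (\<rho> + 29 / 8)" by (simp only: mult_ac)
  then show ?thesis using \<rho> by (simp only: L_def T_def mult_le_cancel_right) auto
qed

theorem hardy_nonnegative:
  assumes "CARD('n::finite) = 3 \<or> CARD('n) = 4"
  shows "nonnegative_op X0 (hardy_op :: (int ^ 'n \<Rightarrow> complex) \<Rightarrow> _)"
proof -
  define b :: real where "b = (if CARD('n) = 3 then -1/4 else -1/2)"
  have pos: "0 < power_weight b n" if "n \<noteq> 0" for n :: "int ^ 'n"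
  proof -
    have "real_of_int (lattice_sq n) + 3 > 0" using lattice_sq_pos[OF that] by linarith
    then show ?thesis using that by (simp add: power_weight_def)
  qed
  have super: "(\<Sum>i\<in>UNIV. power_weight b (n + unit_vec i) + power_weight b (n - unit_vec i))
      \<le> (2 * real CARD('n) - hardy_const CARD('n) / real_of_int (lattice_sq n)) * power_weight b n"
    if n: "n \<noteq> 0" for n :: "int ^ 'n"
  proof (cases "CARD('n) = 3")
    case True
    have A: "hardy_const 3 = 1 / 4" by (simp add: hardy_const_def)
    show ?thesis
      using power_weight_supersolution[OF n, of "-1/4" "1/4" "5/16" "1/4" 0]
        binomial_even_quarter radial_inequality_dim3
      by (simp add: b_def True A)
  next
    case False
    then have 4: "CARD('n) = 4" using assms by simp
    have A: "hardy_const 4 = 1" by (simp add: hardy_const_def)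
    show ?thesis
      using power_weight_supersolution[OF n, of "-1/2" 1 "3/4" "35/64" "3/5"]
        binomial_even_half radial_inequality_dim4
      by (simp add: b_def 4 A)
  qed
  show ?thesis
    unfolding nonnegative_op_def
  proof
    fix u :: "int ^ 'n \<Rightarrow> complex" assume u: "u \<in> ell2 X0"
    have "0 \<le> Re (ell2_inner X0 (hardy_op u) u)"
      by (rule supersolution_imp_hardy_nonneg[OF _ pos super u]) (simp_all add: power_weight_def)
    then show "ell2_inner X0 (hardy_op u) u \<in> \<real>\<^sub>\<ge>\<^sub>0"
      using selfadjoint_inner_self_real[OF hardy_op_selfadjoint u]
      by (metis nonneg_Reals_of_real_iff)
  qed
qed

section \<open>Negative eigenvalues in dimension at least nine\<close>

text \<open>Lists of integers stand for sequences that vanish beyond the end of the list.\<close>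

definition nth0 :: "int list \<Rightarrow> nat \<Rightarrow> int" where
  "nth0 xs k = (if k < length xs then xs ! k else 0)"

lemma nth0_Nil [simp]: "nth0 [] k = 0"
  and nth0_Cons_0 [simp]: "nth0 (x # xs) 0 = x"
  and nth0_Cons_Suc [simp]: "nth0 (x # xs) (Suc k) = nth0 xs k"
  by (auto simp: nth0_def)

lemma nth0_drop [simp]: "nth0 (drop a xs) k = nth0 xs (a + k)"
  by (auto simp: nth0_def)

fun list_add :: "int list \<Rightarrow> int list \<Rightarrow> int list" where
  "list_add [] ys = []"
| "list_add xs [] = xs"
| "list_add (x # xs) (y # ys) = (x + y) # list_add xs ys"

lemma length_list_add [simp]: "length (list_add xs ys) = length xs"
  by (induction xs ys rule: list_add.induct) auto

lemma nth0_list_add: "k < length xs \<Longrightarrow> nth0 (list_add xs ys) k = nth0 xs k + nth0 ys k"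
proof (induction xs ys arbitrary: k rule: list_add.induct)
  case (3 x xs y ys)
  then show ?case by (cases k) auto
qed auto

text \<open>Multiplication of generating functions by the theta series \<open>1 + 2 q + 2 q\<^sup>4 + 2 q\<^sup>9 + \<dots>\<close>, which is
  cut off after the exponent \<open>K\<^sup>2\<close>.  Iterated \<open>N\<close> times, it counts the representations of a number as
  a sum of the squares of \<open>N\<close> integers from \<open>- K\<close> to \<open>K\<close>.\<close>

primrec theta_mult :: "nat \<Rightarrow> int list \<Rightarrow> int list" where
  "theta_mult 0 r = r"
| "theta_mult (Suc K) r = list_add (theta_mult K r) (replicate ((Suc K)\<^sup>2) 0 @ map ((*) 2) r)"

primrec square_rep_counts :: "nat \<Rightarrow> nat \<Rightarrow> nat \<Rightarrow> int list" where
  "square_rep_counts K M 0 = 1 # replicate (M - 1) 0"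
| "square_rep_counts K M (Suc N) = theta_mult K (square_rep_counts K M N)"

lemma length_theta_mult [simp]: "length (theta_mult K r) = length r"
  by (induction K) auto

lemma length_square_rep_counts [simp]: "M > 0 \<Longrightarrow> length (square_rep_counts K M N) = M"
  by (induction N) auto

lemma nth0_replicate_append:
  "nth0 (replicate a 0 @ map ((*) 2) r) k = (if a \<le> k then 2 * nth0 r (k - a) else 0)"
  by (auto simp: nth0_def nth_append)

lemma nth0_theta_mult:
  assumes "k < length r"
  shows "nth0 (theta_mult K r) k =
    nth0 r k + (\<Sum>x\<in>{1..K}. if x\<^sup>2 \<le> k then 2 * nth0 r (k - x\<^sup>2) else 0)"
proof (induction K)
  case (Suc K)
  have "nth0 (theta_mult (Suc K) r) k
    = nth0 (theta_mult K r) k + (if (Suc K)\<^sup>2 \<le> k then 2 * nth0 r (k - (Suc K)\<^sup>2) else 0)"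
    unfolding theta_mult.simps using assms by (simp only: nth0_list_add length_theta_mult nth0_replicate_append)
  then show ?case unfolding Suc.IH by simp
qed simp

lemma sum_symmetric_squares:
  fixes f :: "nat \<Rightarrow> real"
  shows "(\<Sum>x\<in>{- int K..int K}. f (nat (x\<^sup>2))) = f 0 + (\<Sum>x\<in>{1..K}. 2 * f (x\<^sup>2))"
proof (induction K)
  case (Suc K)
  have "{- int (Suc K)..int (Suc K)} = insert (- int (Suc K)) (insert (int (Suc K)) {- int K..int K})"
    by auto
  moreover have "nat ((- int (Suc K))\<^sup>2) = (Suc K)\<^sup>2" "nat ((int (Suc K))\<^sup>2) = (Suc K)\<^sup>2"
    by (simp_all only: power2_minus of_nat_power[symmetric] nat_int)
  ultimately show ?case
    using Suc.IH by simp
qed simp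

lemma sum_shifted_sequence:
  fixes \<phi> :: "nat \<Rightarrow> real"
  assumes "\<And>k. k \<ge> M \<Longrightarrow> \<phi> k = 0"
  shows "(\<Sum>k<M. c k * \<phi> (a + k)) = (\<Sum>k<M. (if a \<le> k then c (k - a) else 0) * \<phi> k)"
proof -
  have "(\<Sum>k<M. c k * \<phi> (a + k)) = (\<Sum>k\<in>{k. a + k < M}. c k * \<phi> (a + k))"
    using assms by (intro sum.mono_neutral_right) auto
  also have "\<dots> = (\<Sum>k\<in>{a..<M}. c (k - a) * \<phi> k)"
    by (rule sum.reindex_bij_witness[of _ "\<lambda>k. k - a" "\<lambda>k. a + k"]) auto
  also have "\<dots> = (\<Sum>k<M. (if a \<le> k then c (k - a) else 0) * \<phi> k)"
    by (intro sum.mono_neutral_cong_left) auto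
  finally show ?thesis .
qed

text \<open>Splitting off one coordinate \<open>x\<close> of \<open>h\<close> shifts the argument of \<open>\<phi>\<close> by \<open>x\<^sup>2\<close>, which is one
  multiplication of the counting sequence by the theta series.\<close>

lemma sum_over_cube_radial:
  fixes \<phi> :: "nat \<Rightarrow> real" and S :: "'a set"
  assumes M: "M > 0" and "finite S" and "\<And>k. k \<ge> M \<Longrightarrow> \<phi> k = 0"
  shows "(\<Sum>h\<in>PiE S (\<lambda>_. {- int K..int K}). \<phi> (nat (\<Sum>i\<in>S. (h i)\<^sup>2)))
    = (\<Sum>k<M. of_int (nth0 (square_rep_counts K M (card S)) k) * \<phi> k)"
  using assms(2,3)
proof (induction S arbitrary: \<phi> rule: finite_induct)
  case empty
  obtain M' where M': "M = Suc M'" using M by (cases M) auto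
  have "nth0 (replicate M' 0) k = 0" for k by (simp add: nth0_def)
  then show ?case
    unfolding M' sum.lessThan_Suc_shift by simp
next
  case (insert i S)
  let ?B = "{- int K..int K}"
  let ?P = "PiE S (\<lambda>_. ?B)"
  let ?r = "square_rep_counts K M (card S)"
  define c where "c k = real_of_int (nth0 ?r k)" for k
  have shifted: "2 * (\<Sum>k<M. c k * \<phi> (a + k)) = (\<Sum>k<M. (if a \<le> k then 2 * c (k - a) else 0) * \<phi> k)" for a
    using sum_shifted_sequence[of M \<phi> "\<lambda>k. 2 * c k" a] insert.prems
    by (simp add: sum_distrib_left mult.assoc)
  have "(\<Sum>h\<in>PiE (insert i S) (\<lambda>_. ?B). \<phi> (nat (\<Sum>i\<in>insert i S. (h i)\<^sup>2)))
    = (\<Sum>(x, h)\<in>?B \<times> ?P. \<phi> (nat (\<Sum>j\<in>insert i S. ((h(i := x)) j)\<^sup>2)))"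
    unfolding PiE_insert_eq using inj_combinator[OF insert(2), of "\<lambda>_. ?B"]
    by (simp add: sum.reindex case_prod_unfold)
  also have "\<dots> = (\<Sum>(x, h)\<in>?B \<times> ?P. \<phi> (nat (x\<^sup>2) + nat (\<Sum>j\<in>S. (h j)\<^sup>2)))"
  proof (intro sum.cong refl, clarify)
    fix x :: int and h :: "'a \<Rightarrow> int"
    have "(\<Sum>j\<in>S. ((h(i := x)) j)\<^sup>2) = (\<Sum>j\<in>S. (h j)\<^sup>2)"
      using insert(2) by (intro sum.cong) auto
    then show "\<phi> (nat (\<Sum>j\<in>insert i S. ((h(i := x)) j)\<^sup>2)) = \<phi> (nat (x\<^sup>2) + nat (\<Sum>j\<in>S. (h j)\<^sup>2))"
      using insert(1,2) by (simp add: nat_add_distrib sum_nonneg)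
  qed
  also have "\<dots> = (\<Sum>x\<in>?B. \<Sum>h\<in>?P. \<phi> (nat (x\<^sup>2) + nat (\<Sum>j\<in>S. (h j)\<^sup>2)))"
    by (simp add: sum.cartesian_product)
  also have "\<dots> = (\<Sum>x\<in>?B. \<Sum>k<M. c k * \<phi> (nat (x\<^sup>2) + k))"
    unfolding c_def using insert.prems by (intro sum.cong refl insert.IH) auto
  also have "\<dots> = (\<Sum>k<M. c k * \<phi> (0 + k)) + (\<Sum>x\<in>{1..K}. 2 * (\<Sum>k<M. c k * \<phi> (x\<^sup>2 + k)))"
    by (rule sum_symmetric_squares)
  also have "\<dots> = (\<Sum>k<M. c k * \<phi> k) + (\<Sum>x\<in>{1..K}. \<Sum>k<M. (if x\<^sup>2 \<le> k then 2 * c (k - x\<^sup>2) else 0) * \<phi> k)"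
    by (simp only: shifted add_0)
  also have "(\<Sum>x\<in>{1..K}. \<Sum>k<M. (if x\<^sup>2 \<le> k then 2 * c (k - x\<^sup>2) else 0) * \<phi> k)
    = (\<Sum>k<M. (\<Sum>x\<in>{1..K}. if x\<^sup>2 \<le> k then 2 * c (k - x\<^sup>2) else 0) * \<phi> k)"
    by (subst sum.swap) (simp add: sum_distrib_right)
  also have "(\<Sum>k<M. c k * \<phi> k) + \<dots>
    = (\<Sum>k<M. (c k + (\<Sum>x\<in>{1..K}. if x\<^sup>2 \<le> k then 2 * c (k - x\<^sup>2) else 0)) * \<phi> k)"
    by (simp add: sum.distrib distrib_right)
  also have "\<dots> = (\<Sum>k<M. of_int (nth0 (theta_mult K ?r) k) * \<phi> k)"
    using M by (intro sum.cong refl) (simp add: nth0_theta_mult c_def if_distrib cong: if_cong)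
  finally show ?case using insert(1,2) by simp
qed

definition lattice_cube :: "nat \<Rightarrow> (int ^ 'n) set" where
  "lattice_cube K = {n. \<forall>j. n $ j \<in> {- int K..int K}}"

lemma bij_lattice_cube: "bij_betw vec_nth (lattice_cube K) (PiE UNIV (\<lambda>_. {- int K..int K}))"
  unfolding lattice_cube_def by (rule bij_betw_byWitness[of _ vec_lambda]) auto

lemma finite_lattice_cube: "finite (lattice_cube K :: (int ^ 'n::finite) set)"
  unfolding lattice_cube_def by (rule finite_lattice_box) auto

lemma sum_lattice_cube_radial:
  fixes \<phi> :: "nat \<Rightarrow> real"
  assumes "M > 0" "\<And>k. k \<ge> M \<Longrightarrow> \<phi> k = 0"
  shows "(\<Sum>n\<in>(lattice_cube K :: (int ^ 'n::finite) set). \<phi> (nat (lattice_sq n)))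
    = (\<Sum>k<M. of_int (nth0 (square_rep_counts K M CARD('n)) k) * \<phi> k)"
proof -
  have "(\<Sum>n\<in>(lattice_cube K :: (int ^ 'n) set). \<phi> (nat (\<Sum>i\<in>UNIV. (n $ i)\<^sup>2)))
    = (\<Sum>h\<in>PiE (UNIV :: 'n set) (\<lambda>_. {- int K..int K}). \<phi> (nat (\<Sum>i\<in>UNIV. (h i)\<^sup>2)))"
    by (rule sum.reindex_bij_betw[OF bij_lattice_cube, of "\<lambda>h :: 'n \<Rightarrow> int. \<phi> (nat (\<Sum>i\<in>UNIV. (h i)\<^sup>2))"])
  then show ?thesis
    using sum_over_cube_radial[of M "UNIV :: 'n set" \<phi> K, OF assms(1) finite_class.finite_UNIV assms(2)]
    by (simp add: lattice_sq_def)
qed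

lemma sum_lattice_cube_split:
  fixes F :: "int \<Rightarrow> nat \<Rightarrow> real" and i :: "'n::finite"
  assumes M: "M > 0" and F: "\<And>x k. k \<ge> M \<Longrightarrow> F x k = 0"
  shows "(\<Sum>n\<in>(lattice_cube K :: (int ^ 'n) set). F (n $ i) (nat (\<Sum>j\<in>UNIV - {i}. (n $ j)\<^sup>2)))
    = (\<Sum>x\<in>{- int K..int K}. \<Sum>k<M. of_int (nth0 (square_rep_counts K M (CARD('n) - 1)) k) * F x k)"
proof -
  let ?B = "{- int K..int K}"
  let ?S = "UNIV - {i}"
  let ?P = "PiE ?S (\<lambda>_. ?B)"
  have U: "UNIV = insert i ?S" by auto
  have "(\<Sum>n\<in>(lattice_cube K :: (int ^ 'n) set). F (n $ i) (nat (\<Sum>j\<in>?S. (n $ j)\<^sup>2)))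
    = (\<Sum>h\<in>PiE UNIV (\<lambda>_. ?B). F (h i) (nat (\<Sum>j\<in>?S. (h j)\<^sup>2)))"
    by (rule sum.reindex_bij_betw[OF bij_lattice_cube, of "\<lambda>h. F (h i) (nat (\<Sum>j\<in>?S. (h j)\<^sup>2))"])
  also have "\<dots> = (\<Sum>h\<in>PiE (insert i ?S) (\<lambda>_. ?B). F (h i) (nat (\<Sum>j\<in>?S. (h j)\<^sup>2)))"
    using U by simp
  also have "\<dots> = (\<Sum>(x, h)\<in>?B \<times> ?P. F ((h(i := x)) i) (nat (\<Sum>j\<in>?S. ((h(i := x)) j)\<^sup>2)))"
    unfolding PiE_insert_eq using inj_combinator[of i ?S "\<lambda>_. ?B"]
    by (simp add: sum.reindex case_prod_unfold)
  also have "\<dots> = (\<Sum>(x, h)\<in>?B \<times> ?P. F x (nat (\<Sum>j\<in>?S. (h j)\<^sup>2)))"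
    by (intro sum.cong refl) auto
  also have "\<dots> = (\<Sum>x\<in>?B. \<Sum>h\<in>?P. F x (nat (\<Sum>j\<in>?S. (h j)\<^sup>2)))"
    by (simp add: sum.cartesian_product)
  also have "\<dots> = (\<Sum>x\<in>?B. \<Sum>k<M. of_int (nth0 (square_rep_counts K M (card ?S)) k) * F x k)"
    using F by (intro sum.cong refl sum_over_cube_radial M) auto
  finally show ?thesis by simp
qed

fun dot3 :: "int list \<Rightarrow> int list \<Rightarrow> int list \<Rightarrow> int" where
  "dot3 (x # xs) (y # ys) (z # zs) = x * y * z + dot3 xs ys zs"
| "dot3 _ _ _ = 0"

lemma dot3_eq_sum: "dot3 xs ys zs = (\<Sum>k<length xs. nth0 xs k * nth0 ys k * nth0 zs k)"
  by (induction xs ys zs rule: dot3.induct) (simp_all add: sum.lessThan_Suc_shift del: sum.lessThan_Suc)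

text \<open>Rounding each term down keeps the evaluation in the integers.\<close>

fun potential_floor :: "int \<Rightarrow> int \<Rightarrow> int list \<Rightarrow> int list \<Rightarrow> int" where
  "potential_floor A k (x # xs) (y # ys) = (A * x * y * y) div k + potential_floor A (k + 1) xs ys"
| "potential_floor A k _ _ = 0"

lemma potential_floor_le:
  "real_of_int (potential_floor A k xs ys)
    \<le> (\<Sum>j<length xs. real_of_int (A * nth0 xs j * nth0 ys j * nth0 ys j) / real_of_int (k + int j))"
proof (induction A k xs ys rule: potential_floor.induct)
  case (1 A k x xs y ys)
  have "real_of_int ((A * x * y * y) div k) \<le> real_of_int (A * x * y * y) / real_of_int k"
    by (rule real_of_int_div4)
  then show ?case
    using 1 by (simp add: sum.lessThan_Suc_shift add.assoc del: sum.lessThan_Suc)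
qed (simp_all add: nth0_def)

text \<open>Up to the rounding of the potential term and for \<open>length g \<le> K\<^sup>2\<close>, this is four times the form of
  the Hardy operator in dimension \<open>N\<close> at the radial function with value \<open>nth0 g k\<close> on the sphere
  \<open>\<bar>n\<bar>\<^sup>2 = k\<close>.\<close>

definition radial_energy :: "nat \<Rightarrow> nat \<Rightarrow> int list \<Rightarrow> int" where
  "radial_energy K N g =
    (let r = square_rep_counts K (length g) N; r' = square_rep_counts K (length g) (N - 1) in
      8 * int N * dot3 r g g
      - 8 * int N * sum_list (map (\<lambda>x. dot3 r' (drop (nat (x\<^sup>2)) g) (drop (nat ((x + 1)\<^sup>2)) g)) [- int K..int K])
      - potential_floor ((int N - 2)\<^sup>2) 0 r g)"

text \<open>A bond in direction \<open>i\<close> is determined by \<open>x = n\<^sub>i\<close> and the other \<open>N - 1\<close> coordinates.  If \<open>k\<close> is the sum of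
  the squares of the latter, its endpoints lie on the spheres \<open>x\<^sup>2 + k\<close> and \<open>(x + 1)\<^sup>2 + k\<close>.  Hence the form
  at a radial function only involves the numbers of representations by \<open>N\<close> and by \<open>N - 1\<close> squares.\<close>

lemma hardy_form_le_radial_energy:
  fixes g :: "int list" and K :: nat
  defines "u \<equiv> (\<lambda>n :: int ^ 'n::finite. complex_of_int (nth0 g (nat (lattice_sq n))))"
  assumes g: "g \<noteq> []" "g ! 0 = 0" "length g \<le> K\<^sup>2"
  shows "u \<in> ell2 X0" "4 * Re (ell2_inner X0 (hardy_op u) u) \<le> real_of_int (radial_energy K CARD('n) g)"
proof -
  define M where "M = length g"
  define G where "G k = nth0 g k" for k
  have M: "M > 0" using g(1) by (simp add: M_def)
  have G0: "G 0 = 0" using g by (cases g) (auto simp: G_def)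
  have GM: "G k = 0" if "k \<ge> M" for k using that by (simp add: G_def M_def nth0_def)
  define C where "C = (lattice_cube K :: (int ^ 'n) set)"
  have finC: "finite C" unfolding C_def by (rule finite_lattice_cube)
  have sq0: "lattice_sq (0 :: int ^ 'n) = 0" by simp
  have un: "u n = of_int (G (nat (lattice_sq n)))" for n by (simp add: u_def G_def)
  have off: "G (nat (lattice_sq n)) = 0" if "n \<notin> C" for n
  proof -
    obtain j where j: "n $ j \<notin> {- int K..int K}" using \<open>n \<notin> C\<close> by (auto simp: C_def lattice_cube_def)
    have "\<bar>int K\<bar> \<le> \<bar>n $ j\<bar>" using j by auto
    then have "(int K)\<^sup>2 \<le> (n $ j)\<^sup>2" by (simp only: abs_le_square_iff)
    also have "\<dots> \<le> lattice_sq n" unfolding lattice_sq_remove[of n j] by (simp add: sum_nonneg)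
    finally have "K\<^sup>2 \<le> nat (lattice_sq n)" by (simp add: le_nat_iff)
    then show ?thesis using GM g(3) unfolding M_def by simp
  qed
  show u: "u \<in> ell2 X0"
    by (rule ell2_finite_supportI[OF finite_subset[OF _ finC]]) (use off G0 in \<open>auto simp: un sq0\<close>)
  define r where "r = square_rep_counts K M CARD('n)"
  define r' where "r' = square_rep_counts K M (CARD('n) - 1)"
  have lr: "length r = M" "length r' = M" using M by (auto simp: r_def r'_def)
  have norm: "(ell2_norm X0 u)\<^sup>2 = real_of_int (dot3 r g g)"
  proof -
    have "(ell2_norm X0 u)\<^sup>2 = (\<Sum>n\<in>C. (real_of_int (G (nat (lattice_sq n))))\<^sup>2)"
      unfolding ell2_norm_sq
    proof (rule infsumI)
      have "((\<lambda>n. (cmod (u n))\<^sup>2) has_sum (\<Sum>n\<in>C. (real_of_int (G (nat (lattice_sq n))))\<^sup>2)) X0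
        \<longleftrightarrow> ((\<lambda>n. (cmod (u n))\<^sup>2) has_sum (\<Sum>n\<in>C. (real_of_int (G (nat (lattice_sq n))))\<^sup>2)) UNIV"
        using G0 by (intro has_sum_cong_neutral) (auto simp: un sq0)
      also have "\<dots>" using finC off by (intro has_sum_finite_neutralI[of C]) (auto simp: un)
      finally show "((\<lambda>n. (cmod (u n))\<^sup>2) has_sum (\<Sum>n\<in>C. (real_of_int (G (nat (lattice_sq n))))\<^sup>2)) X0" .
    qed
    also have "\<dots> = (\<Sum>k<M. of_int (nth0 r k) * (real_of_int (G k))\<^sup>2)"
      unfolding C_def r_def using GM by (intro sum_lattice_cube_radial M) simp
    finally show ?thesis
      by (simp add: dot3_eq_sum lr G_def power2_eq_square mult.assoc)
  qed
  have hop: "Re (ell2_inner X0 (shift (unit_vec i) u) u) = real_of_int (sum_list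
      (map (\<lambda>x. dot3 r' (drop (nat (x\<^sup>2)) g) (drop (nat ((x + 1)\<^sup>2)) g)) [- int K..int K]))" for i
  proof -
    define F where "F x k = real_of_int (G (nat (x\<^sup>2) + k) * G (nat ((x + 1)\<^sup>2) + k))" for x k
    have "ell2_inner X0 (shift (unit_vec i) u) u
      = of_real (\<Sum>n\<in>C. real_of_int (G (nat (lattice_sq n)) * G (nat (lattice_sq (n + unit_vec i)))))"
      unfolding ell2_inner_shift_eq[OF u]
      using finC off by (intro infsumI has_sum_finite_neutralI[of C]) (auto simp: un mult.commute)
    then have "Re (ell2_inner X0 (shift (unit_vec i) u) u)
      = (\<Sum>n\<in>C. real_of_int (G (nat (lattice_sq n)) * G (nat (lattice_sq (n + unit_vec i)))))" by simp
    also have "\<dots> = (\<Sum>n\<in>C. F (n $ i) (nat (\<Sum>j\<in>UNIV - {i}. (n $ j)\<^sup>2)))"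
    proof (rule sum.cong)
      fix n :: "int ^ 'n"
      have s: "(\<Sum>j\<in>UNIV - {i}. (n $ j)\<^sup>2) \<ge> 0" by (simp add: sum_nonneg)
      have "lattice_sq (n + unit_vec i) = (n $ i + 1)\<^sup>2 + (\<Sum>j\<in>UNIV - {i}. (n $ j)\<^sup>2)"
        unfolding lattice_sq_add_unit lattice_sq_remove[of n i] by (simp add: power2_eq_square algebra_simps)
      then show "real_of_int (G (nat (lattice_sq n)) * G (nat (lattice_sq (n + unit_vec i))))
        = F (n $ i) (nat (\<Sum>j\<in>UNIV - {i}. (n $ j)\<^sup>2))"
        using s by (simp add: F_def lattice_sq_remove[of n i] nat_add_distrib)
    qed simp
    also have "\<dots> = (\<Sum>x\<in>{- int K..int K}. \<Sum>k<M. of_int (nth0 r' k) * F x k)"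
      unfolding C_def r'_def using GM by (intro sum_lattice_cube_split M) (simp add: F_def)
    also have "\<dots> = (\<Sum>x\<in>{- int K..int K}. real_of_int (dot3 r' (drop (nat (x\<^sup>2)) g) (drop (nat ((x + 1)\<^sup>2)) g)))"
      by (intro sum.cong refl) (simp add: dot3_eq_sum lr F_def G_def mult.assoc)
    also have "\<dots> = real_of_int (sum_list
      (map (\<lambda>x. dot3 r' (drop (nat (x\<^sup>2)) g) (drop (nat ((x + 1)\<^sup>2)) g)) [- int K..int K]))"
      by (simp add: sum_list_distinct_conv_sum_set)
    finally show ?thesis .
  qed
  have pot: "real_of_int (potential_floor ((int CARD('n) - 2)\<^sup>2) 0 r g)
    \<le> (real CARD('n) - 2)\<^sup>2 * (\<Sum>\<^sub>\<infinity>n\<in>X0. (cmod (u n))\<^sup>2 / real_of_int (lattice_sq n))"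
  proof -
    have "(\<Sum>\<^sub>\<infinity>n\<in>X0. (cmod (u n))\<^sup>2 / real_of_int (lattice_sq n))
      = (\<Sum>n\<in>C. (real_of_int (G (nat (lattice_sq n))))\<^sup>2 / real (nat (lattice_sq n)))"
    proof (rule infsumI)
      let ?s = "\<Sum>n\<in>C. (real_of_int (G (nat (lattice_sq n))))\<^sup>2 / real (nat (lattice_sq n))"
      have "((\<lambda>n. (cmod (u n))\<^sup>2 / real_of_int (lattice_sq n)) has_sum ?s) X0
        \<longleftrightarrow> ((\<lambda>n. (cmod (u n))\<^sup>2 / real_of_int (lattice_sq n)) has_sum ?s) UNIV"
        using G0 by (intro has_sum_cong_neutral) (auto simp: un sq0)
      also have "\<dots>" using finC off by (intro has_sum_finite_neutralI[of C]) (auto simp: un)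
      finally show "((\<lambda>n. (cmod (u n))\<^sup>2 / real_of_int (lattice_sq n)) has_sum ?s) X0" .
    qed
    also have "\<dots> = (\<Sum>k<M. of_int (nth0 r k) * ((real_of_int (G k))\<^sup>2 / real k))"
      unfolding C_def r_def using GM sum_lattice_cube_radial[OF M, of "\<lambda>k. (real_of_int (G k))\<^sup>2 / real k" K, where 'n = 'n]
      by simp
    finally have "(real CARD('n) - 2)\<^sup>2 * (\<Sum>\<^sub>\<infinity>n\<in>X0. (cmod (u n))\<^sup>2 / real_of_int (lattice_sq n))
      = (\<Sum>k<M. real_of_int ((int CARD('n) - 2)\<^sup>2 * nth0 r k * nth0 g k * nth0 g k) / real_of_int (0 + int k))"
      by (simp add: sum_distrib_left G_def power2_eq_square mult.assoc)
    then show ?thesis using potential_floor_le[of "(int CARD('n) - 2)\<^sup>2" 0 r g] lr by simp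
  qed
  show "4 * Re (ell2_inner X0 (hardy_op u) u) \<le> real_of_int (radial_energy K CARD('n) g)"
    using pot unfolding hardy_form[OF u] norm hop radial_energy_def Let_def hardy_const_def
      r_def[symmetric] r'_def[symmetric] M_def[symmetric]
    by (simp add: algebra_simps)
qed

text \<open>A numerical approximation of the minimiser of the Rayleigh quotient in dimension nine among radial
  functions supported in \<open>\<bar>n\<bar>\<^sup>2 \<le> 40\<close>, scaled to the value \<open>20000\<close> on the unit sphere.  The large
  support is essential: the least Rayleigh quotient among radial functions supported in
  \<open>\<bar>n\<bar>\<^sup>2 \<le> 30\<close> is still positive.  In dimensions ten and eleven the same function suffices.\<close>

definition ground_state_profile :: "int list" where
  "ground_state_profile = [0, 20000, 7105, 3039, 1589, 966, 648, 459, 335, 252, 195, 154, 123, 100,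
    82, 68, 57, 48, 41, 35, 30, 26, 22, 19, 16, 14, 12, 11, 9, 8, 7, 6, 5, 4, 4, 3, 2, 2, 2, 1, 1]"

lemma radial_energy_profile_9: "radial_energy 7 9 ground_state_profile < 0"
  by code_simp

lemma radial_energy_profile_10: "radial_energy 7 10 ground_state_profile < 0"
  by code_simp

lemma radial_energy_profile_11: "radial_energy 7 11 ground_state_profile < 0"
  by code_simp

text \<open>No two of the \<open>2 N\<close> unit vectors are neighbours, so on functions supported on them the form is the
  multiplication by \<open>2 N - (N - 2)\<^sup>2 / 4\<close>, which is negative for \<open>N \<ge> 12\<close>.\<close>

lemma radial_energy_unit_sphere:
  assumes "N \<ge> 12"
  shows "radial_energy 2 N [0, 1] < 0"
proof -
  have r: "square_rep_counts 2 (Suc (Suc 0)) N = [1, 2 * int N]" for N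
    by (induction N) (simp_all add: numeral_2_eq_2)
  have "[- int 2..int 2] = [-2, -1, 0, 1, 2]" by (simp add: upto.simps)
  then have "radial_energy 2 N [0, 1] = 8 * int N * (2 * int N) - (int N - 2)\<^sup>2 * (2 * int N)"
    unfolding radial_energy_def by (simp add: r)
  also have "\<dots> = 2 * int N * (8 * int N - (int N - 2)\<^sup>2)" by (simp add: algebra_simps)
  also have "\<dots> < 0"
  proof (rule mult_pos_neg)
    have "12 * int N \<le> int N * int N" using assms by (intro mult_right_mono) auto
    moreover have "(int N - 2)\<^sup>2 = int N * int N - 4 * int N + 4"
      by (simp add: power2_eq_square algebra_simps)
    ultimately show "8 * int N - (int N - 2)\<^sup>2 < 0" by linarith
  qed (use assms in simp)
  finally show ?thesis .
qed

theorem hardy_negative_eigenvalue: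
  assumes "CARD('n::finite) \<ge> 9"
  obtains m where "m < 0"
    "complex_of_real m \<in> discrete_spectrum X0 (hardy_op :: (int ^ 'n \<Rightarrow> complex) \<Rightarrow> _)"
proof -
  let ?H = "hardy_op :: (int ^ 'n \<Rightarrow> complex) \<Rightarrow> _"
  obtain K g where g: "g \<noteq> []" "g ! 0 = 0" "length g \<le> K\<^sup>2" "radial_energy K CARD('n) g < 0"
  proof (cases "CARD('n) \<ge> 12")
    case True
    show ?thesis by (rule that[of "[0, 1]" 2]) (use radial_energy_unit_sphere[OF True] in simp_all)
  next
    case False
    then have "CARD('n) = 9 \<or> CARD('n) = 10 \<or> CARD('n) = 11" using assms by linarith
    then have "radial_energy 7 CARD('n) ground_state_profile < 0"
      using radial_energy_profile_9 radial_energy_profile_10 radial_energy_profile_11 by metis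
    then show ?thesis by (intro that[of ground_state_profile 7]) (simp_all add: ground_state_profile_def)
  qed
  define u where "u = (\<lambda>n :: int ^ 'n. complex_of_int (nth0 g (nat (lattice_sq n))))"
  have u: "u \<in> ell2 X0" unfolding u_def by (rule hardy_form_le_radial_energy(1)[OF g(1-3)])
  have "4 * Re (ell2_inner X0 (?H u) u) \<le> real_of_int (radial_energy K CARD('n) g)"
    unfolding u_def by (rule hardy_form_le_radial_energy(2)[OF g(1-3)])
  then have "Re (ell2_inner X0 (?H u) u) < 0" using g(4) by linarith
  then obtain m where m: "m < 0" "complex_of_real m \<in> spectrum X0 ?H"
    by (rule negative_form_imp_negative_spectrum[OF hardy_op_bounded hardy_op_selfadjoint u])
  then have "complex_of_real m \<in> discrete_spectrum X0 ?H"
    by (intro coercive_mod_finite_imp_discrete[OF hardy_op_bounded hardy_op_selfadjoint]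
        hardy_coercive_mod_finite) auto
  with m(1) show thesis by (rule that)
qed

theorem corollary6p1:
  assumes "CARD('n::finite) \<ge> 3"
  shows "bounded_op (punctured_lattice :: (int ^ 'n) set) hardy_op
       \<and> selfadjoint_op (punctured_lattice :: (int ^ 'n) set) hardy_op
       \<and> essential_spectrum (punctured_lattice :: (int ^ 'n) set) hardy_op
           = complex_of_real ` {0..4 * real CARD('n)}
       \<and> (CARD('n) = 3 \<or> CARD('n) = 4 \<longrightarrow>
            nonnegative_op (punctured_lattice :: (int ^ 'n) set) hardy_op)
       \<and> (CARD('n) \<ge> 9 \<longrightarrow>
            (\<exists>\<mu>::real. \<mu> < 0 \<and>
               complex_of_real \<mu> \<in> discrete_spectrum (punctured_lattice :: (int ^ 'n) set) hardy_op))"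
proof (intro conjI impI)
  show "bounded_op (punctured_lattice :: (int ^ 'n) set) hardy_op" by (rule hardy_op_bounded)
  show "selfadjoint_op (punctured_lattice :: (int ^ 'n) set) hardy_op" by (rule hardy_op_selfadjoint)
  show "essential_spectrum (punctured_lattice :: (int ^ 'n) set) hardy_op
      = complex_of_real ` {0..4 * real CARD('n)}" by (rule hardy_essential_spectrum)
  show "nonnegative_op (punctured_lattice :: (int ^ 'n) set) hardy_op"
    if "CARD('n) = 3 \<or> CARD('n) = 4" using that by (rule hardy_nonnegative)
  show "\<exists>\<mu>::real. \<mu> < 0 \<and>
      complex_of_real \<mu> \<in> discrete_spectrum (punctured_lattice :: (int ^ 'n) set) hardy_op"
    if "CARD('n) \<ge> 9"
    using hardy_negative_eigenvalue[OF that] by metis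
qed

end
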